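(* Let $G$ be a group of type FP over $\mathbb{C}$ such that the centralizer of every element of finite order in $G$ has finite $L^2$-Betti numbers, and suppose that $E(G)(s)=\chi^{(2)}(C_G(s))$ for every $s\in G$. Then $$\chi(G)=\sum_{[s]\in[G]}\chi^{(2)}(C_G(s)),$$ where $\chi(G)=\sum_i(-1)^i\dim_{\mathbb{C}}H_i(G;\mathbb{C})$ and $[G]$ is the set of conjugacy classes of $G$.
   Context: Type FP: a group $G$ is of type FP over $\mathbb{C}$ if the trivial module $\mathbb{C}$ has a finite-length resolution $0\to P_n\to\cdots\to P_0\to\mathbb{C}\to 0$ by finitely generated projective $\mathbb{C}G$-modules. Hattori-Stallings trace: for a finitely generated projective left $\mathbb{C}G$-module $P\cong(\mathbb{C}G)^n M$ with $M=(m_{ij})$ an idempotent $n\times n$ matrix over $\mathbb{C}G$, $\mathrm{HS}(P)(s)=\sum_{i=1}^n\sum_{t\in[s]}m_{ii}(t)$, where $[s]$ is the conjugacy class of $s\in G$ and $m_{ii}(t)$ is the coefficient of $t$ in $m_{ii}$. This induces a homomorphism $\mathrm{HS}:K_0(\mathbb{C}G)\to\bigoplus_{[G]}\mathbb{C}$. Complete Euler characteristic: for $G$ of type FP over $\mathbb{C}$ with a finite-length resolution $P_*: 0\to P_n\to\cdots\to P_0\to\mathbb{C}\to 0$ of the trivial module $\mathbb{C}$ by finitely generated projective $\mathbb{C}G$-modules, the Wall element is $W(G)=\sum_i(-1)^i[P_i]\in K_0(\mathbb{C}G)$ (independent of the resolution), and $E(G)=\mathrm{HS}(W(G))$; $E(G)(s)$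 denotes its $[s]$-component, i.e. $E(G)(s)=\sum_i(-1)^i\mathrm{HS}(P_i)(s)$. $L^2$-Euler characteristic: for any group $H$, $\beta_i(H)=\dim_H H_i(H;\mathcal{N}(H))\in[0,\infty]$ is the $i$-th $L^2$-Betti number, where $\mathcal{N}(H)$ is the group von Neumann algebra and $\dim_H$ is Lück's von Neumann dimension for arbitrary $\mathcal{N}(H)$-modules; $\chi^{(2)}(H)=\sum_i(-1)^i\beta_i(H)$ when the series converges. $C_G(s)$ is the centralizer of $s$ in $G$. *)

theory Defs
  imports "HOL-Analysis.Analysis" "HOL-Algebra.Module" "HOL-Algebra.AbelCoset"
begin

section \<open>Left modules over rings that need not be commutative\<close>

text \<open>The library locale \<open>module\<close> requires a commutative ring; only its record type is used here.
  The fields \<open>mult\<close> and \<open>one\<close> of a module record carry no information.\<close>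

locale left_module = R?: ring R + M?: abelian_group M for R (structure) and M (structure) +
  assumes smult_closed:
      "\<lbrakk>a \<in> carrier R; x \<in> carrier M\<rbrakk> \<Longrightarrow> a \<odot>\<^bsub>M\<^esub> x \<in> carrier M"
    and smult_l_distr:
      "\<lbrakk>a \<in> carrier R; b \<in> carrier R; x \<in> carrier M\<rbrakk> \<Longrightarrow>
        (a \<oplus>\<^bsub>R\<^esub> b) \<odot>\<^bsub>M\<^esub> x = (a \<odot>\<^bsub>M\<^esub> x) \<oplus>\<^bsub>M\<^esub> (b \<odot>\<^bsub>M\<^esub> x)"
    and smult_r_distr:
      "\<lbrakk>a \<in> carrier R; x \<in> carrier M; y \<in> carrier M\<rbrakk> \<Longrightarrow>
        a \<odot>\<^bsub>M\<^esub> (x \<oplus>\<^bsub>M\<^esub> y) = (a \<odot>\<^bsub>M\<^esub> x) \<oplus>\<^bsub>M\<^esub> (a \<odot>\<^bsub>M\<^esub> y)"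
    and smult_assoc:
      "\<lbrakk>a \<in> carrier R; b \<in> carrier R; x \<in> carrier M\<rbrakk> \<Longrightarrow>
        (a \<otimes>\<^bsub>R\<^esub> b) \<odot>\<^bsub>M\<^esub> x = a \<odot>\<^bsub>M\<^esub> (b \<odot>\<^bsub>M\<^esub> x)"
    and smult_one: "x \<in> carrier M \<Longrightarrow> \<one>\<^bsub>R\<^esub> \<odot>\<^bsub>M\<^esub> x = x"

definition mod_hom ::
  "('r, 'x) ring_scheme \<Rightarrow> ('r, 'm, 'y) module_scheme \<Rightarrow> ('r, 'n, 'z) module_scheme \<Rightarrow> ('m \<Rightarrow> 'n) set"
  where "mod_hom R M N = {f \<in> carrier M \<rightarrow> carrier N.
    (\<forall>x\<in>carrier M. \<forall>y\<in>carrier M. f (x \<oplus>\<^bsub>M\<^esub> y) = f x \<oplus>\<^bsub>N\<^esub> f y) \<and>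
    (\<forall>a\<in>carrier R. \<forall>x\<in>carrier M. f (a \<odot>\<^bsub>M\<^esub> x) = a \<odot>\<^bsub>N\<^esub> f x)}"

definition mod_isomorphic ::
  "('r, 'x) ring_scheme \<Rightarrow> ('r, 'm, 'y) module_scheme \<Rightarrow> ('r, 'n, 'z) module_scheme \<Rightarrow> bool"
  where "mod_isomorphic R M N \<longleftrightarrow> (\<exists>f\<in>mod_hom R M N. bij_betw f (carrier M) (carrier N))"

text \<open>\<open>R\<^sup>n\<close>, as row vectors padded by zero.\<close>

definition free_module :: "('r, 'x) ring_scheme \<Rightarrow> nat \<Rightarrow> ('r, nat \<Rightarrow> 'r) module"
  where "free_module R n =
    \<lparr>carrier = {v. (\<forall>i<n. v i \<in> carrier R) \<and> (\<forall>i\<ge>n. v i = \<zero>\<^bsub>R\<^esub>)},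
     mult = undefined, one = undefined,
     zero = (\<lambda>i. \<zero>\<^bsub>R\<^esub>), add = (\<lambda>v w i. v i \<oplus>\<^bsub>R\<^esub> w i),
     smult = (\<lambda>a v i. a \<otimes>\<^bsub>R\<^esub> v i)\<rparr>"

definition idempotent_matrix :: "('r, 'x) ring_scheme \<Rightarrow> nat \<Rightarrow> (nat \<Rightarrow> nat \<Rightarrow> 'r) \<Rightarrow> bool"
  where "idempotent_matrix R n A \<longleftrightarrow>
    (\<forall>i<n. \<forall>j<n. A i j \<in> carrier R) \<and>
    (\<forall>i<n. \<forall>k<n. (\<Oplus>\<^bsub>R\<^esub>j\<in>{..<n}. A i j \<otimes>\<^bsub>R\<^esub> A j k) = A i k)"

definition row_mult :: "('r, 'x) ring_scheme \<Rightarrow> nat \<Rightarrow> (nat \<Rightarrow> nat \<Rightarrow> 'r) \<Rightarrow> (nat \<Rightarrow> 'r) \<Rightarrow> nat \<Rightarrow> 'r"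
  where "row_mult R n A v = (\<lambda>j. if j < n then (\<Oplus>\<^bsub>R\<^esub>i\<in>{..<n}. v i \<otimes>\<^bsub>R\<^esub> A i j) else \<zero>\<^bsub>R\<^esub>)"

text \<open>The left module \<open>R\<^sup>n A\<close>.\<close>

definition matrix_module :: "('r, 'x) ring_scheme \<Rightarrow> nat \<Rightarrow> (nat \<Rightarrow> nat \<Rightarrow> 'r) \<Rightarrow> ('r, nat \<Rightarrow> 'r) module"
  where "matrix_module R n A =
    (free_module R n)\<lparr>carrier := row_mult R n A ` carrier (free_module R n)\<rparr>"

text \<open>Finitely generated projective: a direct summand (retract) of some \<open>R\<^sup>n\<close>.\<close>

definition fg_projective :: "('r, 'x) ring_scheme \<Rightarrow> ('r, 'm, 'y) module_scheme \<Rightarrow> bool"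
  where "fg_projective R P \<longleftrightarrow> left_module R P \<and>
    (\<exists>n. \<exists>f\<in>mod_hom R P (free_module R n). \<exists>g\<in>mod_hom R (free_module R n) P.
      \<forall>x\<in>carrier P. g (f x) = x)"

text \<open>The trace of \<open>P \<cong> R\<^sup>n A\<close> with respect to a trace function \<open>\<tau>\<close> on \<open>R\<close>. The pair \<open>(n, A)\<close> is
  chosen independently of \<open>\<tau>\<close>; for \<open>\<tau>\<close> vanishing on commutators the value does not depend on it.\<close>

definition matrix_presentation ::
  "('r, 'x) ring_scheme \<Rightarrow> ('r, 'm, 'y) module_scheme \<Rightarrow> nat \<times> (nat \<Rightarrow> nat \<Rightarrow> 'r)"
  where "matrix_presentation R P =
    (SOME (n, A). idempotent_matrix R n A \<and> mod_isomorphic R P (matrix_module R n A))"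

definition projective_trace ::
  "('r, 'x) ring_scheme \<Rightarrow> ('r \<Rightarrow> complex) \<Rightarrow> ('r, 'm, 'y) module_scheme \<Rightarrow> complex"
  where "projective_trace R \<tau> P =
    (case matrix_presentation R P of (n, A) \<Rightarrow> \<Sum>i<n. \<tau> (A i i))"

definition quotient_module ::
  "('r, 'x) ring_scheme \<Rightarrow> ('r, 'm, 'y) module_scheme \<Rightarrow> 'm set \<Rightarrow> ('r, 'm set) module"
  where "quotient_module R M N =
    \<lparr>carrier = a_rcosets\<^bsub>M\<^esub> N, mult = undefined, one = undefined,
     zero = N, add = (\<lambda>X Y. X <+>\<^bsub>M\<^esub> Y),
     smult = (\<lambda>a X. N <+>\<^bsub>M\<^esub> ((\<lambda>x. a \<odot>\<^bsub>M\<^esub> x) ` X))\<rparr>"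

text \<open>A resolution of \<open>M\<close> by finitely generated projectives, of length at most \<open>n\<close>; beyond degree
  \<open>n\<close> it is continued by zero modules.\<close>

definition fg_projective_resolution ::
  "('r, 'x) ring_scheme \<Rightarrow> ('r, 'm, 'y) module_scheme \<Rightarrow> nat \<Rightarrow> (nat \<Rightarrow> ('r, 'p) module) \<Rightarrow>
   (nat \<Rightarrow> 'p \<Rightarrow> 'p) \<Rightarrow> ('p \<Rightarrow> 'm) \<Rightarrow> bool"
  where "fg_projective_resolution R M n P d \<epsilon> \<longleftrightarrow>
    (\<forall>i. fg_projective R (P i)) \<and>
    (\<forall>i>n. carrier (P i) = {\<zero>\<^bsub>P i\<^esub>}) \<and>
    \<epsilon> \<in> mod_hom R (P 0) M \<and> (\<forall>i. d i \<in> mod_hom R (P (Suc i)) (P i)) \<and>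
    \<epsilon> ` carrier (P 0) = carrier M \<and>
    d 0 ` carrier (P 1) = {x \<in> carrier (P 0). \<epsilon> x = \<zero>\<^bsub>M\<^esub>} \<and>
    (\<forall>i. d (Suc i) ` carrier (P (Suc (Suc i))) = {x \<in> carrier (P (Suc i)). d i x = \<zero>\<^bsub>P i\<^esub>})"


section \<open>Group rings, type FP and the complete Euler characteristic\<close>

definition group_ring :: "('a, 'b) monoid_scheme \<Rightarrow> ('a \<Rightarrow> complex) ring"
  where "group_ring G =
    \<lparr>carrier = {a. finite {x. a x \<noteq> 0} \<and> {x. a x \<noteq> 0} \<subseteq> carrier G},
     mult = (\<lambda>a b x. if x \<in> carrier G
       then (\<Sum>y\<in>{y. a y \<noteq> 0}. a y * b (inv\<^bsub>G\<^esub> y \<otimes>\<^bsub>G\<^esub> x)) else 0),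
     one = (\<lambda>x. if x = \<one>\<^bsub>G\<^esub> then 1 else 0),
     zero = (\<lambda>x. 0), add = (\<lambda>a b x. a x + b x)\<rparr>"

definition complex_ring :: "complex ring"
  where "complex_ring = \<lparr>carrier = UNIV, mult = (*), one = 1, zero = 0, add = (+)\<rparr>"

definition complex_line :: "(complex, complex) module"
  where "complex_line =
    \<lparr>carrier = UNIV, mult = (*), one = 1, zero = 0, add = (+), smult = (*)\<rparr>"

definition trivial_module :: "('a, 'b) monoid_scheme \<Rightarrow> ('a \<Rightarrow> complex, complex) module"
  where "trivial_module G =
    \<lparr>carrier = UNIV, mult = (*), one = 1, zero = 0, add = (+),
     smult = (\<lambda>a z. (\<Sum>x\<in>{x. a x \<noteq> 0}. a x) * z)\<rparr>"

text \<open>Every finitely generated projective module over \<open>\<complex>G\<close> is isomorphic to a submodule of some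
  \<open>(\<complex>G)\<^sup>n\<close>, so fixing the element type of the modules in a resolution is no restriction.\<close>

definition type_FP :: "('a, 'b) monoid_scheme \<Rightarrow> bool"
  where "type_FP G \<longleftrightarrow>
    (\<exists>n (P :: nat \<Rightarrow> ('a \<Rightarrow> complex, nat \<Rightarrow> 'a \<Rightarrow> complex) module) d \<epsilon>.
      fg_projective_resolution (group_ring G) (trivial_module G) n P d \<epsilon>)"

definition conj_class :: "('a, 'b) monoid_scheme \<Rightarrow> 'a \<Rightarrow> 'a set"
  where "conj_class G s = (\<lambda>g. g \<otimes>\<^bsub>G\<^esub> s \<otimes>\<^bsub>G\<^esub> inv\<^bsub>G\<^esub> g) ` carrier G"

definition conj_classes :: "('a, 'b) monoid_scheme \<Rightarrow> 'a set set"
  where "conj_classes G = conj_class G ` carrier G"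

text \<open>The sum over the conjugacy class of \<open>s\<close> is restricted to the finite support of \<open>m\<close>.\<close>

definition class_trace :: "('a, 'b) monoid_scheme \<Rightarrow> 'a \<Rightarrow> ('a \<Rightarrow> complex) \<Rightarrow> complex"
  where "class_trace G s m = (\<Sum>t\<in>{t \<in> conj_class G s. m t \<noteq> 0}. m t)"

definition hattori_stallings ::
  "('a, 'b) monoid_scheme \<Rightarrow> ('a \<Rightarrow> complex, 'p, 'y) module_scheme \<Rightarrow> 'a \<Rightarrow> complex"
  where "hattori_stallings G P s = projective_trace (group_ring G) (class_trace G s) P"

text \<open>\<open>E(G)\<close>, computed from one resolution of finite length (the same one for all \<open>s\<close>).\<close>

definition complete_euler_char :: "('a, 'b) monoid_scheme \<Rightarrow> 'a \<Rightarrow> complex"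
  where "complete_euler_char G =
    (case (SOME (n, P, d, \<epsilon>). fg_projective_resolution (group_ring G) (trivial_module G) n
             (P :: nat \<Rightarrow> ('a \<Rightarrow> complex, nat \<Rightarrow> 'a \<Rightarrow> complex) module) d \<epsilon>)
     of (n, P, d, \<epsilon>) \<Rightarrow> \<lambda>s. \<Sum>i\<le>n. (-1) ^ i * hattori_stallings G (P i) s)"


section \<open>Group homology\<close>

text \<open>\<open>M\<close> is a left \<open>R\<close>-module with a right action \<open>act m g\<close> of \<open>G\<close> by \<open>R\<close>-linear maps.
  The chain complex is \<open>M \<otimes>\<^bsub>\<int>G\<^esub> B\<^sub>*\<close> for the (unnormalised) bar resolution \<open>B\<^sub>*\<close>: an
  \<open>n\<close>-chain is a finitely supported map from \<open>G\<^sup>n\<close> (lists of length \<open>n\<close>) to \<open>M\<close>, and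
  \<open>d(m[g\<^sub>1|\<dots>|g\<^sub>n]) = mg\<^sub>1[g\<^sub>2|\<dots>|g\<^sub>n] +
     \<Sum>\<^sub>i (-1)\<^sup>i m[\<dots>|g\<^sub>ig\<^sub>i\<^sub>+\<^sub>1|\<dots>] + (-1)\<^sup>n m[g\<^sub>1|\<dots>|g\<^sub>n\<^sub>-\<^sub>1]\<close>.\<close>

definition bar_chains ::
  "('a, 'b) monoid_scheme \<Rightarrow> ('r, 'm, 'y) module_scheme \<Rightarrow> nat \<Rightarrow> ('r, 'a list \<Rightarrow> 'm) module"
  where "bar_chains G M n =
    \<lparr>carrier = {c. (\<forall>w. c w \<in> carrier M) \<and> finite {w. c w \<noteq> \<zero>\<^bsub>M\<^esub>} \<and>
       (\<forall>w. c w \<noteq> \<zero>\<^bsub>M\<^esub> \<longrightarrow> length w = n \<and> set w \<subseteq> carrier G)},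
     mult = undefined, one = undefined,
     zero = (\<lambda>w. \<zero>\<^bsub>M\<^esub>), add = (\<lambda>b c w. b w \<oplus>\<^bsub>M\<^esub> c w), smult = (\<lambda>a c w. a \<odot>\<^bsub>M\<^esub> c w)\<rparr>"

definition bar_face :: "('a, 'b) monoid_scheme \<Rightarrow> nat \<Rightarrow> 'a list \<Rightarrow> 'a list"
  where "bar_face G i w =
    (if i = 0 then tl w
     else if i = length w then butlast w
     else take (i - 1) w @ (w ! (i - 1) \<otimes>\<^bsub>G\<^esub> w ! i) # drop (Suc i) w)"

definition bar_coeff ::
  "('r, 'm, 'y) module_scheme \<Rightarrow> ('m \<Rightarrow> 'a \<Rightarrow> 'm) \<Rightarrow> nat \<Rightarrow> 'a list \<Rightarrow> 'm \<Rightarrow> 'm"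
  where "bar_coeff M act i w m =
    (if i = 0 then act m (hd w) else if even i then m else \<ominus>\<^bsub>M\<^esub> m)"

definition bar_boundary ::
  "('a, 'b) monoid_scheme \<Rightarrow> ('r, 'm, 'y) module_scheme \<Rightarrow> ('m \<Rightarrow> 'a \<Rightarrow> 'm) \<Rightarrow> nat \<Rightarrow>
   ('a list \<Rightarrow> 'm) \<Rightarrow> 'a list \<Rightarrow> 'm"
  where "bar_boundary G M act n c = (\<lambda>v. if n = 0 then \<zero>\<^bsub>M\<^esub> else
    (\<Oplus>\<^bsub>M\<^esub>w\<in>{w. c w \<noteq> \<zero>\<^bsub>M\<^esub>}. \<Oplus>\<^bsub>M\<^esub>i\<in>{..n}.
       if bar_face G i w = v then bar_coeff M act i w (c w) else \<zero>\<^bsub>M\<^esub>))"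

definition bar_cycles ::
  "('a, 'b) monoid_scheme \<Rightarrow> ('r, 'm, 'y) module_scheme \<Rightarrow> ('m \<Rightarrow> 'a \<Rightarrow> 'm) \<Rightarrow> nat \<Rightarrow>
   ('a list \<Rightarrow> 'm) set"
  where "bar_cycles G M act n =
    {c \<in> carrier (bar_chains G M n). bar_boundary G M act n c = (\<lambda>v. \<zero>\<^bsub>M\<^esub>)}"

definition group_homology ::
  "('a, 'b) monoid_scheme \<Rightarrow> ('r, 'x) ring_scheme \<Rightarrow> ('r, 'm, 'y) module_scheme \<Rightarrow>
   ('m \<Rightarrow> 'a \<Rightarrow> 'm) \<Rightarrow> nat \<Rightarrow> ('r, ('a list \<Rightarrow> 'm) set) module"
  where "group_homology G R M act n =
    quotient_module R ((bar_chains G M n)\<lparr>carrier := bar_cycles G M act n\<rparr>)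
      (bar_boundary G M act (Suc n) ` carrier (bar_chains G M (Suc n)))"


section \<open>The Euler characteristic\<close>

definition complex_homology ::
  "('a, 'b) monoid_scheme \<Rightarrow> nat \<Rightarrow> (complex, ('a list \<Rightarrow> complex) set) module"
  where "complex_homology G = group_homology G complex_ring complex_line (\<lambda>z g. z)"

definition finite_dim :: "(complex, 'm, 'y) module_scheme \<Rightarrow> bool"
  where "finite_dim V \<longleftrightarrow> (\<exists>n. mod_isomorphic complex_ring V (free_module complex_ring n))"

definition complex_dim :: "(complex, 'm, 'y) module_scheme \<Rightarrow> nat"
  where "complex_dim V = (THE n. mod_isomorphic complex_ring V (free_module complex_ring n))"

definition euler_char_defined :: "('a, 'b) monoid_scheme \<Rightarrow> bool"
  where "euler_char_defined G \<longleftrightarrow>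
    (\<forall>i. finite_dim (complex_homology G i)) \<and> finite {i. complex_dim (complex_homology G i) \<noteq> 0}"

definition euler_char :: "('a, 'b) monoid_scheme \<Rightarrow> int"
  where "euler_char G =
    (\<Sum>i\<in>{i. complex_dim (complex_homology G i) \<noteq> 0}.
       (-1) ^ i * int (complex_dim (complex_homology G i)))"


section \<open>Group von Neumann algebras and L2-Betti numbers\<close>

definition ell2 :: "('a, 'b) monoid_scheme \<Rightarrow> ('a \<Rightarrow> complex) set"
  where "ell2 G = {f. (\<forall>x. x \<notin> carrier G \<longrightarrow> f x = 0) \<and>
    (\<lambda>x. (norm (f x))\<^sup>2) summable_on carrier G}"

definition ell2_norm :: "('a, 'b) monoid_scheme \<Rightarrow> ('a \<Rightarrow> complex) \<Rightarrow> real"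
  where "ell2_norm G f = sqrt (\<Sum>\<^sub>\<infinity>x\<in>carrier G. (norm (f x))\<^sup>2)"

text \<open>Operators on \<open>\<ell>\<^sup>2(G)\<close> are represented by maps that are 0 outside \<open>\<ell>\<^sup>2(G)\<close>.\<close>

definition ell2_bounded_operators ::
  "('a, 'b) monoid_scheme \<Rightarrow> (('a \<Rightarrow> complex) \<Rightarrow> 'a \<Rightarrow> complex) set"
  where "ell2_bounded_operators G = {T.
    (\<forall>f. f \<notin> ell2 G \<longrightarrow> T f = (\<lambda>x. 0)) \<and>
    (\<forall>f\<in>ell2 G. T f \<in> ell2 G) \<and>
    (\<forall>f\<in>ell2 G. \<forall>h\<in>ell2 G. T (\<lambda>x. f x + h x) = (\<lambda>x. T f x + T h x)) \<and>
    (\<forall>z. \<forall>f\<in>ell2 G. T (\<lambda>x. z * f x) = (\<lambda>x. z * T f x)) \<and>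
    (\<exists>K. \<forall>f\<in>ell2 G. ell2_norm G (T f) \<le> K * ell2_norm G f)}"

definition left_translation ::
  "('a, 'b) monoid_scheme \<Rightarrow> 'a \<Rightarrow> ('a \<Rightarrow> complex) \<Rightarrow> 'a \<Rightarrow> complex"
  where "left_translation G g f =
    (\<lambda>x. if f \<in> ell2 G \<and> x \<in> carrier G then f (inv\<^bsub>G\<^esub> g \<otimes>\<^bsub>G\<^esub> x) else 0)"

definition right_translation ::
  "('a, 'b) monoid_scheme \<Rightarrow> 'a \<Rightarrow> ('a \<Rightarrow> complex) \<Rightarrow> 'a \<Rightarrow> complex"
  where "right_translation G g f =
    (\<lambda>x. if f \<in> ell2 G \<and> x \<in> carrier G then f (x \<otimes>\<^bsub>G\<^esub> g) else 0)"

text \<open>\<open>\<N>(G)\<close>: the bounded operators commuting with the right regular representation. It contains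
  \<open>\<complex>G\<close> via the left regular representation \<open>left_translation\<close>.\<close>

definition group_vN_algebra ::
  "('a, 'b) monoid_scheme \<Rightarrow> (('a \<Rightarrow> complex) \<Rightarrow> 'a \<Rightarrow> complex) ring"
  where "group_vN_algebra G =
    \<lparr>carrier = {T \<in> ell2_bounded_operators G.
       \<forall>g\<in>carrier G. \<forall>f\<in>ell2 G. T (right_translation G g f) = right_translation G g (T f)},
     mult = (\<lambda>S T f. S (T f)), one = (\<lambda>f. if f \<in> ell2 G then f else (\<lambda>x. 0)),
     zero = (\<lambda>f x. 0), add = (\<lambda>S T f x. S f x + T f x)\<rparr>"

definition group_vN_module ::
  "('a, 'b) monoid_scheme \<Rightarrow>
   (('a \<Rightarrow> complex) \<Rightarrow> 'a \<Rightarrow> complex, ('a \<Rightarrow> complex) \<Rightarrow> 'a \<Rightarrow> complex) module"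
  where "group_vN_module G =
    ring.extend (group_vN_algebra G) \<lparr>smult = (\<lambda>S T. S \<otimes>\<^bsub>group_vN_algebra G\<^esub> T)\<rparr>"

text \<open>\<open>T \<mapsto> \<langle>T \<delta>\<^sub>1, \<delta>\<^sub>1\<rangle>\<close>\<close>

definition vN_trace ::
  "('a, 'b) monoid_scheme \<Rightarrow> (('a \<Rightarrow> complex) \<Rightarrow> 'a \<Rightarrow> complex) \<Rightarrow> complex"
  where "vN_trace G T = T (\<lambda>x. if x = \<one>\<^bsub>G\<^esub> then 1 else 0) \<one>\<^bsub>G\<^esub>"

text \<open>Lueck's dimension of an arbitrary \<open>\<N>(G)\<close>-module: the supremum of the von Neumann dimensions
  (real and nonnegative) of its finitely generated projective submodules.\<close>

definition vN_dim ::
  "('a, 'b) monoid_scheme \<Rightarrow> (('a \<Rightarrow> complex) \<Rightarrow> 'a \<Rightarrow> complex, 'm, 'y) module_scheme \<Rightarrow> ennreal"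
  where "vN_dim G M =
    (SUP P \<in> {P. submodule P (group_vN_algebra G) M \<and>
                fg_projective (group_vN_algebra G) (M\<lparr>carrier := P\<rparr>)}.
      ennreal (Re (projective_trace (group_vN_algebra G) (vN_trace G) (M\<lparr>carrier := P\<rparr>))))"

definition l2_betti :: "('a, 'b) monoid_scheme \<Rightarrow> nat \<Rightarrow> ennreal"
  where "l2_betti G i = vN_dim G
    (group_homology G (group_vN_algebra G) (group_vN_module G)
      (\<lambda>T g. T \<otimes>\<^bsub>group_vN_algebra G\<^esub> left_translation G g) i)"

definition l2_euler_char_defined :: "('a, 'b) monoid_scheme \<Rightarrow> bool"
  where "l2_euler_char_defined G \<longleftrightarrow>
    (\<forall>i. l2_betti G i < \<infinity>) \<and> summable (\<lambda>i. (-1) ^ i * enn2real (l2_betti G i))"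

definition l2_euler_char :: "('a, 'b) monoid_scheme \<Rightarrow> real"
  where "l2_euler_char G = (\<Sum>i. (-1) ^ i * enn2real (l2_betti G i))"

definition centralizer_group :: "('a, 'b) monoid_scheme \<Rightarrow> 'a \<Rightarrow> ('a, 'b) monoid_scheme"
  where "centralizer_group G s =
    G\<lparr>carrier := {g \<in> carrier G. g \<otimes>\<^bsub>G\<^esub> s = s \<otimes>\<^bsub>G\<^esub> g}\<rparr>"

end

theory Submission
  imports Defs "HOL-Library.Function_Algebras"
begin

text \<open>All modules are realised as spaces of finitely supported functions on \<open>G \<times> J\<close>, on which \<open>G\<close>
  acts by left translation; such a module \<open>X\<close> is projective as soon as it has elements \<open>gen j\<close> with
  \<open>x = (\<Sum>(g, j). x (g, j) g (gen j))\<close> for all \<open>x \<in> X\<close>. Both the bar resolution and the given resolution by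
  finitely generated projectives \<open>P\<^sub>i = (\<complex>G)\<^sup>m A\<^sub>i\<close> are of this form, hence chain homotopy equivalent, and
  their coinvariants have the same homology. By Euler--Poincare, \<open>\<chi>(G)\<close> is the alternating sum of the
  dimensions of the coinvariants of the \<open>P\<^sub>i\<close>. The coinvariants of \<open>P\<^sub>i\<close> are the image of the augmented
  idempotent matrix, so their dimension is its trace, and the augmentation of an element of \<open>\<complex>G\<close> is
  the sum of its class traces. Hence \<open>\<chi>(G)\<close> is the finite sum of \<open>E(G)(s)\<close> over the conjugacy classes.\<close>

section \<open>Finitely supported functions and linear extension\<close>

text \<open>Homology is given by cosets of bar chains, E(G) by modules that are records. Plain
  function spaces put both into one linear algebra, in which index sets J of different types (words
  for the bar resolution, numbers for matrices) can be compared.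

  The condition on \<open>gen\<close> is the dual basis form of projectivity, with the coordinates
  \<open>x (g, j)\<close> as functionals: it lets a map be defined by choosing images for the
  \<open>gen j\<close>. It is also the reason why coinvariants can be read off inside the functions
  on J. For an arbitrary submodule of a free module, the map from its coinvariants to those of the
  free module may have a kernel; for a direct summand it is injective, so summing over the group
  coordinate computes them.

  E(G) is evaluated on the resolution and the matrices that choice operators select, whereas
  \<chi>(G) refers to the bar complex. The argument keeps exactly the selected data, and the
  comparison of resolutions is the bridge to the bar complex. Only finitely many diagonal entries
  occur, each of finite support, so almost all conjugacy classes contribute 0.\<close>

definition cscale :: "complex \<Rightarrow> ('i \<Rightarrow> complex) \<Rightarrow> 'i \<Rightarrow> complex"  (infixr "\<cdot>" 75)
  where "c \<cdot> f = (\<lambda>i. c * f i)"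

declare plus_fun_apply [simp del] minus_apply [simp del] zero_fun_apply [simp del]

lemma cscale_apply: "(c \<cdot> f) i = c * f i"
  by (simp add: cscale_def)

interpretation fs: vector_space cscale
  by standard (auto simp: cscale_def fun_eq_iff plus_fun_apply zero_fun_apply algebra_simps)

lemma sum_fun_apply: "(\<Sum>x\<in>A. f x) i = (\<Sum>x\<in>A. f x i)"
  for f :: "'x \<Rightarrow> 'i \<Rightarrow> 'b::comm_monoid_add"
  by (induction A rule: infinite_finite_induct) (auto simp: plus_fun_apply zero_fun_apply)

lemmas pointwise = plus_fun_apply zero_fun_apply minus_apply cscale_apply sum_fun_apply

definition unit_fun :: "'i \<Rightarrow> 'i \<Rightarrow> complex"
  where "unit_fun w = (\<lambda>x. if x = w then 1 else 0)"

definition supp :: "('i \<Rightarrow> complex) \<Rightarrow> 'i set"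
  where "supp f = {x. f x \<noteq> 0}"

definition fin_supp_on :: "'i set \<Rightarrow> ('i \<Rightarrow> complex) set"
  where "fin_supp_on A = {f. finite (supp f) \<and> supp f \<subseteq> A}"

text \<open>The linear map that sends the basis vector \<open>unit_fun w\<close> to
  \<open>u w\<close>. For a function of infinite support the sum takes its default value 0, so
  linearity is claimed on \<open>fin_supp_on A\<close> only.\<close>

definition lext :: "('i \<Rightarrow> 'j \<Rightarrow> complex) \<Rightarrow> ('i \<Rightarrow> complex) \<Rightarrow> 'j \<Rightarrow> complex"
  where "lext u f = (\<Sum>w\<in>supp f. f w \<cdot> u w)"

text \<open>Linearity is relative to a set because modules are subspaces of a function type and maps
  between them are arbitrary elsewhere.\<close>

definition lin_on :: "('i \<Rightarrow> complex) set \<Rightarrow> (('i \<Rightarrow> complex) \<Rightarrow> 'j \<Rightarrow> complex) \<Rightarrow> bool"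
  where "lin_on X f \<longleftrightarrow> (\<forall>x\<in>X. \<forall>y\<in>X. f (x + y) = f x + f y) \<and> (\<forall>c. \<forall>x\<in>X. f (c \<cdot> x) = c \<cdot> f x)"

lemma lin_onI:
  assumes "\<And>x y. x \<in> X \<Longrightarrow> y \<in> X \<Longrightarrow> f (x + y) = f x + f y" "\<And>c x. x \<in> X \<Longrightarrow> f (c \<cdot> x) = c \<cdot> f x"
  shows "lin_on X f"
  using assms by (auto simp: lin_on_def)

lemma lin_on_add: "lin_on X f \<Longrightarrow> x \<in> X \<Longrightarrow> y \<in> X \<Longrightarrow> f (x + y) = f x + f y"
  and lin_on_scale: "lin_on X f \<Longrightarrow> x \<in> X \<Longrightarrow> f (c \<cdot> x) = c \<cdot> f x"
  by (auto simp: lin_on_def)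

lemma lin_on_zero: "lin_on X f \<Longrightarrow> fs.subspace X \<Longrightarrow> f 0 = 0"
  using lin_on_scale[of X f 0 0] by (simp add: fs.subspace_0)

lemma diff_conv_scale: "x - y = x + (-1) \<cdot> y"
  by (auto simp: fun_eq_iff pointwise)

lemma lin_on_diff:
  assumes "lin_on X f" "fs.subspace X" "x \<in> X" "y \<in> X"
  shows "f (x - y) = f x - f y"
  unfolding diff_conv_scale[of x y] diff_conv_scale[of "f x" "f y"]
  using assms by (simp only: lin_on_add lin_on_scale fs.subspace_scale)

lemma lin_on_sum:
  assumes "lin_on X f" "fs.subspace X" "\<And>w. w \<in> A \<Longrightarrow> u w \<in> X"
  shows "f (\<Sum>w\<in>A. u w) = (\<Sum>w\<in>A. f (u w))"
  using assms(3)
proof (induction A rule: infinite_finite_induct)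
  case (insert x F)
  then show ?case
    using assms(1,2) lin_on_add[OF assms(1), of "u x" "sum u F"] by (simp add: fs.subspace_sum)
qed (use assms lin_on_zero in auto)

lemma lin_on_sum_scale:
  assumes "lin_on X f" "fs.subspace X" "\<And>w. w \<in> A \<Longrightarrow> u w \<in> X"
  shows "f (\<Sum>w\<in>A. c w \<cdot> u w) = (\<Sum>w\<in>A. c w \<cdot> f (u w))"
  using assms by (subst lin_on_sum[OF assms(1,2)]) (auto simp: fs.subspace_scale lin_on_scale)

lemma lin_on_compose:
  assumes "lin_on X f" "lin_on Y g" "f \<in> X \<rightarrow> Y"
  shows "lin_on X (\<lambda>x. g (f x))"
  using assms by (intro lin_onI) (auto simp: lin_on_add lin_on_scale Pi_iff)

lemma lin_on_diff_fun: "lin_on X f \<Longrightarrow> lin_on X g \<Longrightarrow> lin_on X (\<lambda>x. f x - g x)"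
  by (auto simp: lin_on_def fun_eq_iff pointwise algebra_simps)

lemma lin_on_subset: "lin_on X f \<Longrightarrow> Y \<subseteq> X \<Longrightarrow> lin_on Y f"
  unfolding lin_on_def by blast

lemma lin_on_id: "lin_on X (\<lambda>x. x)"
  by (auto simp: lin_on_def)

lemma subspace_image:
  assumes "fs.subspace X" "lin_on X f"
  shows "fs.subspace (f ` X)"
proof (rule fs.subspaceI)
  show "0 \<in> f ` X"
    using lin_on_zero[OF assms(2,1)] assms(1) fs.subspace_0 by (metis imageI)
qed (use assms in \<open>auto simp: fs.subspace_add fs.subspace_scale simp flip: lin_on_add lin_on_scale\<close>)

lemma subspace_kernel:
  assumes "fs.subspace X" "lin_on X f"
  shows "fs.subspace {x \<in> X. f x = 0}"
  using assms by (intro fs.subspaceI) (auto simp: fs.subspace_0 fs.subspace_add fs.subspace_scale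
      lin_on_add lin_on_scale lin_on_zero)

section \<open>Supports and linear extension from a basis\<close>

lemma supp_unit_fun [simp]: "supp (unit_fun w) = {w}"
  by (auto simp: supp_def unit_fun_def)

lemma unit_fun_same [simp]: "unit_fun w w = 1"
  by (simp add: unit_fun_def)

lemma supp_add_subset: "supp (f + g) \<subseteq> supp f \<union> supp g"
  by (auto simp: supp_def pointwise)

lemma supp_scale_subset: "supp (c \<cdot> f) \<subseteq> supp f"
  by (auto simp: supp_def pointwise)

lemma subspace_fin_supp_on: "fs.subspace (fin_supp_on A)"
proof (rule fs.subspaceI)
  show "0 \<in> fin_supp_on A" by (simp add: fin_supp_on_def supp_def pointwise)
next
  fix f g assume "f \<in> fin_supp_on A" "g \<in> fin_supp_on A"
  then show "f + g \<in> fin_supp_on A"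
    using supp_add_subset[of f g] finite_subset[OF supp_add_subset[of f g]] by (auto simp: fin_supp_on_def)
next
  fix c f assume "f \<in> fin_supp_on A"
  then show "c \<cdot> f \<in> fin_supp_on A"
    using supp_scale_subset[of c f] finite_subset[OF supp_scale_subset[of c f]] by (auto simp: fin_supp_on_def)
qed

lemma unit_fun_in_fin_supp_on [simp]: "unit_fun w \<in> fin_supp_on A \<longleftrightarrow> w \<in> A"
  by (auto simp: fin_supp_on_def)

lemma fin_supp_onD: "f \<in> fin_supp_on A \<Longrightarrow> finite (supp f)" "f \<in> fin_supp_on A \<Longrightarrow> w \<in> supp f \<Longrightarrow> w \<in> A"
  by (auto simp: fin_supp_on_def)

lemma fin_supp_on_mono: "A \<subseteq> B \<Longrightarrow> fin_supp_on A \<subseteq> fin_supp_on B"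
  by (auto simp: fin_supp_on_def)

text \<open>The support of a sum need not be the union of the supports. Summing over any larger
  finite set gives several functions a common index set, from which additivity follows.\<close>

lemma lext_superset:
  assumes "finite A" "supp f \<subseteq> A"
  shows "lext u f = (\<Sum>w\<in>A. f w \<cdot> u w)"
  unfolding lext_def using assms by (intro sum.mono_neutral_left) (auto simp: supp_def)

lemma lext_apply_superset:
  assumes "finite A" "supp f \<subseteq> A"
  shows "lext u f j = (\<Sum>w\<in>A. f w * u w j)"
  by (simp add: lext_superset[OF assms] pointwise)

lemma lin_on_lext: "lin_on (fin_supp_on A) (lext u)"
proof (rule lin_onI)
  fix f g :: "'a \<Rightarrow> complex" assume "f \<in> fin_supp_on A" "g \<in> fin_supp_on A"
  then have *: "finite (supp f \<union> supp g)" by (auto simp: fin_supp_on_def)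
  show "lext u (f + g) = lext u f + lext u g"
    by (auto simp: fun_eq_iff pointwise lext_apply_superset[OF *] supp_add_subset algebra_simps sum.distrib)
next
  fix c and f :: "'a \<Rightarrow> complex" assume "f \<in> fin_supp_on A"
  then have *: "finite (supp f)" by (auto simp: fin_supp_on_def)
  show "lext u (c \<cdot> f) = c \<cdot> lext u f"
    by (auto simp: fun_eq_iff pointwise lext_apply_superset[OF *] supp_scale_subset algebra_simps sum_distrib_left)
qed

lemma lext_unit_fun [simp]: "lext u (unit_fun w) = u w"
  by (simp add: lext_def)

lemma lext_cong: "(\<And>w. w \<in> supp f \<Longrightarrow> u w = v w) \<Longrightarrow> lext u f = lext v f"
  by (simp add: lext_def)

lemma lext_zero [simp]: "lext u 0 = 0"
  by (simp add: lext_def supp_def pointwise)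

lemma lext_id: "finite (supp f) \<Longrightarrow> lext unit_fun f = f"
  by (auto simp: fun_eq_iff pointwise lext_def unit_fun_def sum.delta' supp_def if_distrib[of "\<lambda>z. _ * z"] cong: if_cong)

lemma lext_in:
  assumes "fs.subspace X" "\<And>w. w \<in> supp f \<Longrightarrow> u w \<in> X"
  shows "lext u f \<in> X"
  unfolding lext_def using assms by (intro fs.subspace_sum fs.subspace_scale) auto

lemma lext_fin_supp_on: "(\<And>w. w \<in> supp f \<Longrightarrow> u w \<in> fin_supp_on A) \<Longrightarrow> lext u f \<in> fin_supp_on A"
  by (rule lext_in[OF subspace_fin_supp_on])

lemma lin_on_lext_apply:
  assumes "lin_on X g" "fs.subspace X" "\<And>w. w \<in> supp f \<Longrightarrow> u w \<in> X"
  shows "g (lext u f) = lext (\<lambda>w. g (u w)) f"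
  using assms by (simp add: lext_def lin_on_sum fs.subspace_scale lin_on_scale)

lemma lin_on_fin_supp_ext:
  assumes "lin_on (fin_supp_on A) f" "x \<in> fin_supp_on A"
  shows "f x = lext (\<lambda>w. f (unit_fun w)) x"
proof -
  have "f (lext unit_fun x) = lext (\<lambda>w. f (unit_fun w)) x"
    using assms(2) by (intro lin_on_lext_apply[OF assms(1)] subspace_fin_supp_on) (auto simp: fin_supp_on_def)
  with assms(2) show ?thesis by (simp add: lext_id fin_supp_on_def)
qed

lemma lin_on_fin_supp_eqI:
  assumes "lin_on (fin_supp_on A) f" "lin_on (fin_supp_on A) g"
    "\<And>w. w \<in> A \<Longrightarrow> f (unit_fun w) = g (unit_fun w)" "x \<in> fin_supp_on A"
  shows "f x = g x"
proof -
  have "lext (\<lambda>w. f (unit_fun w)) x = lext (\<lambda>w. g (unit_fun w)) x"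
    using assms(3,4) by (intro lext_cong) (auto simp: fin_supp_on_def)
  then show ?thesis by (metis assms lin_on_fin_supp_ext)
qed

lemma lext_lext:
  assumes "finite (supp f)" "\<And>w. w \<in> supp f \<Longrightarrow> finite (supp (v w))"
  shows "lext u (lext v f) = lext (\<lambda>w. lext u (v w)) f"
  using assms by (intro lin_on_lext_apply[OF lin_on_lext subspace_fin_supp_on]) (auto simp: fin_supp_on_def)

section \<open>Dimensions of quotients\<close>

definition coord_space :: "nat \<Rightarrow> (nat \<Rightarrow> complex) set"
  where "coord_space k = {v. \<forall>i\<ge>k. v i = 0}"

text \<open>S/B has dimension k, expressed without forming the quotient. The form makes sense for
  infinite-dimensional S and B, as needed for spaces of bar chains, and is close to the isomorphism
  with a free module in \<open>complex_dim\<close>.\<close>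

definition quot_dim :: "('i \<Rightarrow> complex) set \<Rightarrow> ('i \<Rightarrow> complex) set \<Rightarrow> nat \<Rightarrow> bool"
  where "quot_dim S B k \<longleftrightarrow> (\<exists>L. lin_on S L \<and> L ` S = coord_space k \<and> {x \<in> S. L x = 0} = B)"

lemma subspace_coord_space: "fs.subspace (coord_space k)"
  by (rule fs.subspaceI) (auto simp: coord_space_def pointwise)

lemma coord_space_fin_supp: "coord_space k = fin_supp_on {..<k}"
proof -
  have "finite (supp v)" if "\<forall>i\<ge>k. v i = 0" for v
    by (rule finite_subset[of _ "{..<k}"]) (use that in \<open>auto simp: supp_def not_le[symmetric]\<close>)
  then show ?thesis
    by (auto simp: coord_space_def fin_supp_on_def supp_def not_le[symmetric])
qed

lemma coord_space_sum: "v \<in> coord_space k \<Longrightarrow> v = (\<Sum>i<k. v i \<cdot> unit_fun i)"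
  by (auto simp: fun_eq_iff pointwise coord_space_def unit_fun_def if_distrib[of "\<lambda>z. _ * z"] cong: if_cong)

text \<open>An injective map keeps the unit vectors independent, and their images lie in the span of
  k' unit vectors, so the exchange lemma bounds k.\<close>

lemma coord_space_le:
  assumes "lin_on (coord_space k) M" "M \<in> coord_space k \<rightarrow> coord_space k'"
    "\<And>v. v \<in> coord_space k \<Longrightarrow> M v = 0 \<Longrightarrow> v = 0"
  shows "k \<le> k'"
proof -
  define y where "y i = M (unit_fun i)" for i :: nat
  have comb: "M (\<Sum>i<k. c i \<cdot> unit_fun i) = (\<Sum>i<k. c i \<cdot> y i)" for c
    unfolding y_def using assms(1)
    by (subst lin_on_sum[OF assms(1) subspace_coord_space])
      (auto simp: lin_on_scale coord_space_fin_supp fs.subspace_scale subspace_fin_supp_on)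
  have in_sp: "(\<Sum>i<k. c i \<cdot> unit_fun i) \<in> coord_space k" for c
    by (auto simp: coord_space_fin_supp intro!: fs.subspace_sum fs.subspace_scale subspace_fin_supp_on)
  have null: "c i = 0" if "(\<Sum>i<k. c i \<cdot> y i) = 0" "i < k" for c i
  proof -
    have "(\<Sum>i<k. c i \<cdot> unit_fun i) = (0 :: nat \<Rightarrow> complex)"
      using assms(3)[OF in_sp] comb that by simp
    from fun_cong[OF this, of i] show ?thesis
      using that by (simp add: unit_fun_def pointwise if_distrib[of "\<lambda>z. _ * z"] cong: if_cong)
  qed
  have inj: "inj_on y {..<k}"
  proof (rule inj_onI)
    fix a b assume ab: "a \<in> {..<k}" "b \<in> {..<k}" "y a = y b"
    show "a = b"
    proof (rule ccontr)
      assume "a \<noteq> b"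
      \<comment> \<open>Two equal images would give a vanishing combination with coefficients 1 and
        -1. Excluding this makes the set of images have exactly k elements.\<close>
      define c where "c i = (if i = a then 1 else if i = b then -1 else (0::complex))" for i
      have "(\<Sum>i<k. c i \<cdot> y i) = (\<Sum>i\<in>{a,b}. c i \<cdot> y i)"
        using ab by (intro sum.mono_neutral_right) (auto simp: c_def)
      also have "\<dots> = 0" using \<open>a \<noteq> b\<close> ab by (auto simp: c_def fun_eq_iff pointwise)
      finally have "c a = 0" using null ab by blast
      then show False by (simp add: c_def)
    qed
  qed
  have "fs.independent (y ` {..<k})"
  proof (rule fs.independent_if_scalars_zero)
    fix f x assume "(\<Sum>x\<in>y ` {..<k}. f x \<cdot> x) = 0" "x \<in> y ` {..<k}"
    then show "f x = 0" using null[of "\<lambda>i. f (y i)"] by (auto simp: sum.reindex[OF inj])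
  qed simp
  moreover have "y ` {..<k} \<subseteq> fs.span (unit_fun ` {..<k'})"
  proof clarify
    fix i assume "i < k"
    then have "y i \<in> coord_space k'"
      using assms(2) unfolding y_def by (auto simp: Pi_iff coord_space_fin_supp)
    then show "y i \<in> fs.span (unit_fun ` {..<k'})"
      by (subst coord_space_sum) (auto intro: fs.span_sum fs.span_scale[OF fs.span_base])
  qed
  ultimately have "card (y ` {..<k}) \<le> card (unit_fun ` {..<k'} :: (nat \<Rightarrow> complex) set)"
    using fs.independent_span_bound by blast
  also have "\<dots> \<le> k'" using card_image_le[of "{..<k'}" unit_fun] by simp
  finally show ?thesis by (simp add: card_image[OF inj])
qed

text \<open>L and L' have the same kernel, so L' factors through L. The factor is L' composed with a
  section r of L; although r is merely chosen, the composite is linear and injective.\<close>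

lemma quot_dim_unique_le:
  assumes S: "fs.subspace S" and "quot_dim S B k" "quot_dim S B k'"
  shows "k \<le> k'"
proof -
  obtain L where L: "lin_on S L" "L ` S = coord_space k" "{x \<in> S. L x = 0} = B"
    using assms(2) by (auto simp: quot_dim_def)
  obtain L' where L': "lin_on S L'" "L' ` S = coord_space k'" "{x \<in> S. L' x = 0} = B"
    using assms(3) by (auto simp: quot_dim_def)
  have same: "L' x = L' y" if "L x = L y" "x \<in> S" "y \<in> S" for x y
  proof -
    have "x - y \<in> B" using that L(1) S by (auto simp flip: L(3) simp: lin_on_diff fs.subspace_diff)
    then show ?thesis using lin_on_diff[OF L'(1) S that(2,3)] by (auto simp flip: L'(3))
  qed
  define r where "r v = (SOME x. x \<in> S \<and> L x = v)" for v
  have r: "r v \<in> S \<and> L (r v) = v" if "v \<in> coord_space k" for v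
  proof -
    have "v \<in> L ` S" using that by (simp only: L(2))
    then have "\<exists>x. x \<in> S \<and> L x = v" by (auto simp only: image_iff)
    then show ?thesis unfolding r_def by (rule someI_ex)
  qed
  show ?thesis
  proof (rule coord_space_le)
    show "lin_on (coord_space k) (\<lambda>v. L' (r v))"
    proof (rule lin_onI)
      fix x y assume xy: "x \<in> coord_space k" "y \<in> coord_space k"
      have *: "r x \<in> S" "L (r x) = x" "r y \<in> S" "L (r y) = y" "r (x + y) \<in> S" "L (r (x + y)) = x + y"
        using r xy fs.subspace_add[OF subspace_coord_space] by blast+
      have "L' (r (x + y)) = L' (r x + r y)"
        using * L(1) S by (intro same) (auto simp: lin_on_add fs.subspace_add)
      then show "L' (r (x + y)) = L' (r x) + L' (r y)" using * L'(1) by (simp add: lin_on_add)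
    next
      fix c x assume x: "x \<in> coord_space k"
      have *: "r x \<in> S" "L (r x) = x" "r (c \<cdot> x) \<in> S" "L (r (c \<cdot> x)) = c \<cdot> x"
        using r x fs.subspace_scale[OF subspace_coord_space] by blast+
      have "L' (r (c \<cdot> x)) = L' (c \<cdot> r x)"
        using * L(1) S by (intro same) (auto simp: lin_on_scale fs.subspace_scale)
      then show "L' (r (c \<cdot> x)) = c \<cdot> L' (r x)" using * L'(1) by (simp add: lin_on_scale)
    qed
    show "(\<lambda>v. L' (r v)) \<in> coord_space k \<rightarrow> coord_space k'" using r L'(2) by auto
    fix v assume v: "v \<in> coord_space k" "L' (r v) = 0"
    then have "r v \<in> B" using r L'(3) by blast
    then show "v = 0" using r[OF v(1)] L(3) by auto
  qed
qed

lemma quot_dim_unique: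
  "fs.subspace S \<Longrightarrow> quot_dim S B k \<Longrightarrow> quot_dim S B k' \<Longrightarrow> k = k'"
  by (meson le_antisym quot_dim_unique_le)

text \<open>The map f induces an isomorphism from Z/B to Z'/B'. The condition on preimages of B'
  says that it is well defined and injective, the approximation of each z' modulo B' that it is
  surjective. This serves both for homotopy equivalences and for rank and nullity.\<close>

lemma quot_dim_transfer:
  assumes "lin_on Z f" "f \<in> Z \<rightarrow> Z'" "\<And>z. z \<in> Z \<Longrightarrow> f z \<in> B' \<longleftrightarrow> z \<in> B" "B \<subseteq> Z"
    "fs.subspace Z'" "\<And>z'. z' \<in> Z' \<Longrightarrow> \<exists>z\<in>Z. z' - f z \<in> B'" "quot_dim Z' B' k"
  shows "quot_dim Z B k"
proof -
  obtain L where L: "lin_on Z' L" "L ` Z' = coord_space k" "{x \<in> Z'. L x = 0} = B'"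
    using assms(7) by (auto simp: quot_dim_def)
  have "lin_on Z (\<lambda>z. L (f z))" by (rule lin_on_compose[OF assms(1) L(1) assms(2)])
  moreover have "(\<lambda>z. L (f z)) ` Z = coord_space k"
  proof
    show "(\<lambda>z. L (f z)) ` Z \<subseteq> coord_space k" using assms(2) L(2) by auto
    show "coord_space k \<subseteq> (\<lambda>z. L (f z)) ` Z"
    proof
      fix v assume "v \<in> coord_space k"
      then obtain z' where z': "z' \<in> Z'" "L z' = v" using L(2) by (metis imageE)
      then obtain z where z: "z \<in> Z" "z' - f z \<in> B'" using assms(6) by auto
      then have "L (z' - f z) = 0" "f z \<in> Z'" using L(3) assms(2) by auto
      then have "L (f z) = v" using z' lin_on_diff[OF L(1) assms(5)] by simp
      then show "v \<in> (\<lambda>z. L (f z)) ` Z" using z by auto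
    qed
  qed
  moreover have "{x \<in> Z. L (f x) = 0} = B"
    using assms(2-4) L(3) by (auto simp: Pi_iff)
  ultimately show ?thesis unfolding quot_dim_def by blast
qed

section \<open>Dimension and trace inside coordinate spaces\<close>

lemma dim_zero_space: "fs.dim {0 :: 'i \<Rightarrow> complex} = 0"
proof -
  have "fs.independent ({} :: ('i \<Rightarrow> complex) set)" by (rule fs.independent_empty)
  from fs.dim_eq_card_independent[OF this] show ?thesis
    using fs.dim_span[of "{} :: ('i \<Rightarrow> complex) set"] by simp
qed

lemma representation_lincomb:
  assumes "fs.independent C" "\<And>i. i \<in> I \<Longrightarrow> u i \<in> fs.span C"
  shows "fs.representation C (\<Sum>i\<in>I. c i \<cdot> u i) b = (\<Sum>i\<in>I. c i * fs.representation C (u i) b)"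
  using assms by (subst fs.representation_sum) (auto simp: fs.span_scale fs.representation_scale)

lemma finite_independent_coord_space:
  assumes "fs.independent C" "C \<subseteq> coord_space m" shows "finite C"
proof -
  have "C \<subseteq> fs.span (unit_fun ` {..<m})"
  proof
    fix v assume "v \<in> C"
    then have v: "v \<in> coord_space m" using assms(2) by blast
    show "v \<in> fs.span (unit_fun ` {..<m})"
      by (subst coord_space_sum[OF v]) (auto intro: fs.span_sum fs.span_scale[OF fs.span_base])
  qed
  then show ?thesis using fs.independent_span_bound[OF _ assms(1)] by blast
qed

text \<open>Extend a basis B' of B to a basis C of S. The map L reads the coordinates along the new
  vectors \<open>C - B'\<close>, so its kernel is the span of B'. The ambient coordinate space makes
  all bases finite.\<close>

lemma quot_dim_exists:
  assumes S: "fs.subspace S" "S \<subseteq> coord_space m" and B: "fs.subspace B" "B \<subseteq> S"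
  shows "\<exists>k. quot_dim S B k \<and> fs.dim S = fs.dim B + k"
proof -
  obtain B' where B': "B' \<subseteq> B" "fs.independent B'" "B \<subseteq> fs.span B'" "card B' = fs.dim B"
    using fs.basis_exists by blast
  obtain C where C: "B' \<subseteq> C" "C \<subseteq> S" "fs.independent C" "S \<subseteq> fs.span C"
    using fs.maximal_independent_subset_extend[OF _ B'(2), of S] B'(1) B(2) by blast
  have finC: "finite C" using C S(2) by (intro finite_independent_coord_space) auto
  have spanC: "fs.span C = S" using C S(1) by (simp add: fs.span_subspace)
  have spanB': "fs.span B' = B" using B' B(1) by (simp add: fs.span_subspace)
  define k where "k = card (C - B')"
  obtain h where h: "bij_betw h {..<k} (C - B')"
    unfolding k_def using finC ex_bij_betw_nat_finite[of "C - B'"] by (auto simp: atLeast0LessThan)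
  have hC: "h i \<in> C" "h i \<notin> B'" if "i < k" for i using h that by (auto simp: bij_betw_def)
  define L where "L x = (\<lambda>i. if i < k then fs.representation C x (h i) else 0)" for x
  have "lin_on S L"
    by (rule lin_onI)
      (auto simp: L_def fun_eq_iff pointwise fs.representation_add[OF C(3)] fs.representation_scale[OF C(3)] spanC)
  moreover have "L ` S = coord_space k"
  proof (intro equalityI subsetI)
    fix v assume v: "v \<in> coord_space k"
    define x where "x = (\<Sum>i<k. v i \<cdot> h i)"
    have xS: "x \<in> S" unfolding x_def using hC C(2) by (intro fs.subspace_sum[OF S(1)] fs.subspace_scale[OF S(1)]) auto
    have "fs.representation C x (h j) = v j" if "j < k" for j
    proof -
      have "fs.representation C x (h j) = (\<Sum>i<k. v i * fs.representation C (h i) (h j))"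
        unfolding x_def using hC by (intro representation_lincomb[OF C(3)] fs.span_base) auto
      also have "\<dots> = (\<Sum>i<k. if i = j then v i else 0)"
        using hC h that
        by (intro sum.cong) (auto simp: fs.representation_basis[OF C(3)] bij_betw_def inj_on_def)
      finally show ?thesis using that by simp
    qed
    then have "L x = v" using v by (auto simp: L_def fun_eq_iff coord_space_def)
    then show "v \<in> L ` S" using xS by blast
  qed (auto simp: L_def coord_space_def)
  moreover have "{x \<in> S. L x = 0} = B"
  proof (intro equalityI subsetI)
    fix x assume "x \<in> {x \<in> S. L x = 0}"
    then have x: "x \<in> S" "L x = 0" by auto
    have x': "fs.representation C x (h i) = 0" if "i < k" for i
      using fun_cong[OF x(2), of i] that by (simp add: L_def zero_fun_apply)
    have out: "fs.representation C x b = 0" if "b \<in> C - B'" for b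
      using x' h that unfolding bij_betw_def by (metis imageE lessThan_iff)
    have "x = (\<Sum>b\<in>C. fs.representation C x b \<cdot> b)"
      using fs.sum_representation_eq[OF C(3) _ finC order_refl, of x] x(1) spanC by simp
    also have "\<dots> = (\<Sum>b\<in>B'. fs.representation C x b \<cdot> b)"
      using C(1) finC out by (intro sum.mono_neutral_right) auto
    also have "\<dots> \<in> fs.span B'" by (intro fs.span_sum fs.span_scale fs.span_base)
    finally show "x \<in> B" using spanB' by simp
  next
    fix x assume x: "x \<in> B"
    have "fs.representation C x = fs.representation B' x"
      using x spanB' C(1) by (intro fs.representation_extend[OF C(3)]) auto
    then have "fs.representation C x (h i) = 0" if "i < k" for i
      using hC(2)[OF that] fs.representation_ne_zero[of B' x "h i"] by auto
    then show "x \<in> {x \<in> S. L x = 0}" using x B(2) by (auto simp: L_def fun_eq_iff zero_fun_apply)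
  qed
  ultimately have "quot_dim S B k" unfolding quot_dim_def by blast
  moreover have "fs.dim S = card C" using fs.basis_card_eq_dim[OF C(2,4,3)] by simp
  moreover have "card C = card B' + k"
    using finC C(1) card_mono[OF finC C(1)] by (simp add: k_def card_Diff_subset finite_subset)
  ultimately show ?thesis using B'(4) by auto
qed

lemma quot_dim_dim:
  assumes "fs.subspace S" "S \<subseteq> coord_space m" "fs.subspace B" "B \<subseteq> S" "quot_dim S B k"
  shows "fs.dim S = fs.dim B + k"
  using quot_dim_exists[OF assms(1-4)] quot_dim_unique[OF assms(1,5)] by blast

text \<open>The matrix with rows \<open>a j\<close> is a projection onto \<open>V\<close>, so that its trace is its rank.\<close>

lemma dim_eq_trace:
  assumes V: "fs.subspace V" "V \<subseteq> coord_space m"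
    and a: "\<And>j. j < m \<Longrightarrow> a j \<in> V" "\<And>v. v \<in> V \<Longrightarrow> v = (\<Sum>j<m. v j \<cdot> a j)"
  shows "of_nat (fs.dim V) = (\<Sum>j<m. a j j)"
proof -
  obtain C where C: "C \<subseteq> V" "fs.independent C" "V \<subseteq> fs.span C" "card C = fs.dim V"
    using fs.basis_exists by blast
  have finC: "finite C" using C V(2) by (intro finite_independent_coord_space) auto
  have spanC: "fs.span C = V" using C V(1) by (simp add: fs.span_subspace)
  have rep: "x j = (\<Sum>c\<in>C. fs.representation C x c * c j)" if "x \<in> V" for x j
  proof -
    have "x = (\<Sum>c\<in>C. fs.representation C x c \<cdot> c)"
      using fs.sum_representation_eq[OF C(2) _ finC order_refl, of x] that spanC by simp
    from fun_cong[OF this, of j] show ?thesis by (simp add: pointwise)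
  qed
  \<comment> \<open>This is the cyclic property of the trace: writing the rows in the basis C and
    exchanging the sums moves the projection to C, where it is the identity and every basis vector
    contributes 1.\<close>
  have "(\<Sum>j<m. a j j) = (\<Sum>j<m. \<Sum>c\<in>C. fs.representation C (a j) c * c j)"
    using rep[OF a(1)] by (intro sum.cong) auto
  also have "\<dots> = (\<Sum>c\<in>C. \<Sum>j<m. c j * fs.representation C (a j) c)"
    by (subst sum.swap) (simp add: mult.commute)
  also have "\<dots> = (\<Sum>c\<in>C. fs.representation C (\<Sum>j<m. c j \<cdot> a j) c)"
    by (intro sum.cong refl representation_lincomb[OF C(2), symmetric]) (use a(1) spanC in auto)
  also have "\<dots> = (\<Sum>c\<in>C. fs.representation C c c)"
    using C(1) a(2) by (intro sum.cong) (auto simp flip: a(2))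
  also have "\<dots> = of_nat (card C)" by (simp add: fs.representation_basis[OF C(2)])
  finally show ?thesis using C(4) by simp
qed

section \<open>Comparison of resolutions\<close>

text \<open>The left regular action on the group coordinate. The type may be larger than the group,
  and off the carrier the product with \<open>inv g\<close> is unspecified, hence the value 0
  there.\<close>

definition translate :: "('a, 'b) monoid_scheme \<Rightarrow> 'a \<Rightarrow> ('a \<times> 'j \<Rightarrow> complex) \<Rightarrow> 'a \<times> 'j \<Rightarrow> complex"
  where "translate G g x = (\<lambda>(h, j). if h \<in> carrier G then x (inv\<^bsub>G\<^esub> g \<otimes>\<^bsub>G\<^esub> h, j) else 0)"

text \<open>Summation over the group coordinate: the quotient map of the free module with basis J
  onto its coinvariants. For a direct summand X, the image of X under this map is a copy of the
  coinvariants of X.\<close>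

definition coinv :: "('a \<times> 'j \<Rightarrow> complex) \<Rightarrow> 'j \<Rightarrow> complex"
  where "coinv = lext (\<lambda>(g, j). unit_fun j)"

abbreviation grp_funs :: "('a, 'b) monoid_scheme \<Rightarrow> ('a \<times> 'j \<Rightarrow> complex) set"
  where "grp_funs G \<equiv> fin_supp_on (carrier G \<times> UNIV)"

definition translation_hom ::
  "('a, 'b) monoid_scheme \<Rightarrow> ('a \<times> 'j \<Rightarrow> complex) set \<Rightarrow> ('a \<times> 'k \<Rightarrow> complex) set \<Rightarrow>
   (('a \<times> 'j \<Rightarrow> complex) \<Rightarrow> 'a \<times> 'k \<Rightarrow> complex) \<Rightarrow> bool"
  where "translation_hom G X Y f \<longleftrightarrow> f \<in> X \<rightarrow> Y \<and> lin_on X f \<and>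
    (\<forall>g\<in>carrier G. \<forall>x\<in>X. f (translate G g x) = translate G g (f x))"

text \<open>Elements of the resolution whose coinvariants are cycles of the complex of coinvariants.\<close>

definition cycles :: "(nat \<Rightarrow> ('a \<times> 'j \<Rightarrow> complex) set) \<Rightarrow> (nat \<Rightarrow> ('a \<times> 'j \<Rightarrow> complex) \<Rightarrow> 'a \<times> 'j \<Rightarrow> complex) \<Rightarrow>
    nat \<Rightarrow> ('a \<times> 'j \<Rightarrow> complex) set"
  where "cycles X d n = (case n of 0 \<Rightarrow> X 0 | Suc m \<Rightarrow> {x \<in> X (Suc m). coinv (d m x) = 0})"

definition chain_map where
  "chain_map G X d eps Y d' eps' \<phi> \<longleftrightarrow> (\<forall>n. translation_hom G (X n) (Y n) (\<phi> n)) \<and>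
    (\<forall>x\<in>X 0. eps' (\<phi> 0 x) = eps x) \<and> (\<forall>n. \<forall>x\<in>X (Suc n). d' n (\<phi> (Suc n) x) = \<phi> n (d n x))"

lemma translation_hom_id: "translation_hom G X X (\<lambda>x. x)"
  by (auto simp: translation_hom_def lin_on_id)

lemma translation_hom_compose:
  "translation_hom G X Y f \<Longrightarrow> translation_hom G Y Z g \<Longrightarrow> translation_hom G X Z (\<lambda>x. g (f x))"
  unfolding translation_hom_def by (auto intro: lin_on_compose simp: Pi_iff)

lemma chain_map_compose:
  assumes "chain_map G X d eps Y d' eps' \<phi>" "chain_map G Y d' eps' Z d'' eps'' \<psi>"
  shows "chain_map G X d eps Z d'' eps'' (\<lambda>n x. \<psi> n (\<phi> n x))"
proof -
  have "translation_hom G (X n) (Z n) (\<lambda>x. \<psi> n (\<phi> n x))" for n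
    using assms unfolding chain_map_def by (blast intro: translation_hom_compose)
  moreover have "\<phi> n x \<in> Y n" if "x \<in> X n" for n x
    using assms(1) that unfolding chain_map_def translation_hom_def by auto
  ultimately show ?thesis using assms unfolding chain_map_def by auto
qed

lemma chain_map_id: "chain_map G X d eps X d eps (\<lambda>n x. x)"
  by (auto simp: chain_map_def translation_hom_id)

lemma lin_on_translate: "lin_on X (translate G g)"
  by (rule lin_onI) (auto simp: translate_def fun_eq_iff pointwise)

lemma lin_on_coinv: "X \<subseteq> grp_funs G \<Longrightarrow> lin_on X coinv"
  unfolding coinv_def by (rule lin_on_subset[OF lin_on_lext])

section \<open>Translation on finitely supported functions\<close>

context group
begin

lemma translate_unit_fun:
  "g \<in> carrier G \<Longrightarrow> h \<in> carrier G \<Longrightarrow> translate G g (unit_fun (h, j)) = unit_fun (g \<otimes> h, j)"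
  by (auto simp: translate_def unit_fun_def fun_eq_iff inv_solve_left m_assoc[symmetric])

lemma translate_closed:
  assumes "g \<in> carrier G" "x \<in> grp_funs G"
  shows "translate G g x \<in> grp_funs G"
proof -
  have "supp (translate G g x) \<subseteq> (\<lambda>(h, j). (g \<otimes> h, j)) ` supp x"
  proof
    fix w assume "w \<in> supp (translate G g x)"
    then obtain h j where w: "w = (h, j)" "h \<in> carrier G" "x (inv g \<otimes> h, j) \<noteq> 0"
      by (cases w) (auto simp: supp_def translate_def split: if_splits)
    then have "(h, j) = (\<lambda>(h, j). (g \<otimes> h, j)) (inv g \<otimes> h, j)" using assms(1) by (simp add: m_assoc[symmetric])
    then show "w \<in> (\<lambda>(h, j). (g \<otimes> h, j)) ` supp x"
      using w unfolding supp_def by blast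
  qed
  then show ?thesis
    using assms finite_subset[of _ "(\<lambda>(h, j). (g \<otimes> h, j)) ` supp x"] by (fastforce simp: fin_supp_on_def)
qed

lemma translate_lext:
  assumes "g \<in> carrier G" "x \<in> grp_funs G"
  shows "translate G g x = lext (\<lambda>(h, j). unit_fun (g \<otimes> h, j)) x"
proof -
  have "translate G g x = lext (\<lambda>w. translate G g (unit_fun w)) x"
    by (rule lin_on_fin_supp_ext[OF lin_on_translate assms(2)])
  also have "\<dots> = lext (\<lambda>(h, j). unit_fun (g \<otimes> h, j)) x"
    using assms by (intro lext_cong) (auto simp: fin_supp_on_def translate_unit_fun)
  finally show ?thesis .
qed

lemma lext_translate:
  assumes "g \<in> carrier G" "x \<in> grp_funs G"
  shows "lext u (translate G g x) = lext (\<lambda>(h, j). u (g \<otimes> h, j)) x"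
proof -
  have "lext u (translate G g x) = lext (\<lambda>w. lext u (case w of (h, j) \<Rightarrow> unit_fun (g \<otimes> h, j))) x"
    using assms by (subst translate_lext) (auto intro!: lext_lext simp: fin_supp_on_def)
  also have "\<dots> = lext (\<lambda>(h, j). u (g \<otimes> h, j)) x"
    by (intro lext_cong) auto
  finally show ?thesis .
qed

lemma coinv_translate: "g \<in> carrier G \<Longrightarrow> x \<in> grp_funs G \<Longrightarrow> coinv (translate G g x) = coinv x"
  by (simp add: coinv_def lext_translate)

lemma translate_mult:
  "g \<in> carrier G \<Longrightarrow> h \<in> carrier G \<Longrightarrow> translate G g (translate G h x) = translate G (g \<otimes> h) x"
  by (auto simp: translate_def fun_eq_iff m_assoc inv_mult_group)

end

text \<open>The axiom \<open>expand\<close> is projectivity of \<open>X n\<close> as a dual basis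
  condition; a redundant index j may have \<open>gen n j\<close> equal to 0. The augmentation takes
  values in functions on \<open>unit\<close>, which makes \<complex> one more function space, to
  which \<open>lin_on\<close> and \<open>lift\<close> apply.\<close>

locale group_resolution = group G for G :: "('a, 'b) monoid_scheme" (structure) +
  fixes X :: "nat \<Rightarrow> ('a \<times> 'j \<Rightarrow> complex) set"
    and d :: "nat \<Rightarrow> ('a \<times> 'j \<Rightarrow> complex) \<Rightarrow> 'a \<times> 'j \<Rightarrow> complex"
    and eps :: "('a \<times> 'j \<Rightarrow> complex) \<Rightarrow> unit \<Rightarrow> complex"
    and gen :: "nat \<Rightarrow> 'j \<Rightarrow> 'a \<times> 'j \<Rightarrow> complex"
  assumes X_sub: "X n \<subseteq> grp_funs G"
    and X_subspace: "fs.subspace (X n)"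
    and X_translate: "g \<in> carrier G \<Longrightarrow> x \<in> X n \<Longrightarrow> translate G g x \<in> X n"
    and d_hom: "translation_hom G (X (Suc n)) (X n) (d n)"
    and eps_lin: "lin_on (X 0) eps"
    and eps_translate: "g \<in> carrier G \<Longrightarrow> x \<in> X 0 \<Longrightarrow> eps (translate G g x) = eps x"
    and eps_surj: "eps ` X 0 = UNIV"
    and exact_0: "{x \<in> X 0. eps x = 0} = d 0 ` X (Suc 0)"
    and exact_Suc: "{x \<in> X (Suc n). d n x = 0} = d (Suc n) ` X (Suc (Suc n))"
    and gen_closed: "gen n j \<in> X n"
    and expand: "x \<in> X n \<Longrightarrow> lext (\<lambda>(g, j). translate G g (gen n j)) x = x"
begin

lemma d_closed: "x \<in> X (Suc n) \<Longrightarrow> d n x \<in> X n"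
  and d_lin: "lin_on (X (Suc n)) (d n)"
  and d_translate: "g \<in> carrier G \<Longrightarrow> x \<in> X (Suc n) \<Longrightarrow> d n (translate G g x) = translate G g (d n x)"
  using d_hom[of n] unfolding translation_hom_def by auto

lemma d_d: "x \<in> X (Suc (Suc n)) \<Longrightarrow> d n (d (Suc n) x) = 0"
  using exact_Suc[of n] by blast

lemma X_fst: "x \<in> X n \<Longrightarrow> (g, j) \<in> supp x \<Longrightarrow> g \<in> carrier G"
  using X_sub[of n] by (auto simp: fin_supp_on_def)

text \<open>Projectivity at work: choose preimages \<open>y j\<close> of \<open>h (gen n j)\<close>
  under \<delta>, send the basis vector at (g, j) to g acting on \<open>y j\<close>, and compare
  through \<open>expand\<close>. The two actions are parameters because \<delta> is a boundary map
  in one use, with translation on its target, and the augmentation in the other, with the trivial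
  action.\<close>

lemma lift:
  fixes Y :: "('y \<Rightarrow> complex) set" and h :: "('a \<times> 'j \<Rightarrow> complex) \<Rightarrow> 't \<Rightarrow> complex"
  assumes Y: "fs.subspace Y" "\<And>g y. g \<in> carrier G \<Longrightarrow> y \<in> Y \<Longrightarrow> act g y \<in> Y"
      "\<And>g. g \<in> carrier G \<Longrightarrow> lin_on Y (act g)"
      "\<And>g g' y. g \<in> carrier G \<Longrightarrow> g' \<in> carrier G \<Longrightarrow> y \<in> Y \<Longrightarrow> act (g \<otimes> g') y = act g (act g' y)"
    and \<delta>: "lin_on Y \<delta>" "\<And>g y. g \<in> carrier G \<Longrightarrow> y \<in> Y \<Longrightarrow> \<delta> (act g y) = act' g (\<delta> y)"
    and h: "lin_on (X n) h" "\<And>g x. g \<in> carrier G \<Longrightarrow> x \<in> X n \<Longrightarrow> h (translate G g x) = act' g (h x)"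
      "\<And>x. x \<in> X n \<Longrightarrow> h x \<in> \<delta> ` Y"
  obtains F where "F \<in> X n \<rightarrow> Y" "lin_on (X n) F"
    "\<And>g x. g \<in> carrier G \<Longrightarrow> x \<in> X n \<Longrightarrow> F (translate G g x) = act g (F x)"
    "\<And>x. x \<in> X n \<Longrightarrow> \<delta> (F x) = h x"
proof -
  have "\<forall>j. \<exists>y. y \<in> Y \<and> \<delta> y = h (gen n j)"
    using h(3)[OF gen_closed] by (metis imageE)
  then obtain y where y: "\<And>j. y j \<in> Y" "\<And>j. \<delta> (y j) = h (gen n j)" by metis
  define F where "F = lext (\<lambda>(g, j). act g (y j))"
  show thesis
  proof
    show "F \<in> X n \<rightarrow> Y"
      unfolding F_def using X_fst y Y by (auto intro!: lext_in)
    show "lin_on (X n) F"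
      unfolding F_def by (rule lin_on_subset[OF lin_on_lext X_sub])
    fix x assume x: "x \<in> X n"
    show "F (translate G g x) = act g (F x)" if g: "g \<in> carrier G" for g
    proof -
      have "F (translate G g x) = lext (\<lambda>(h, j). act (g \<otimes> h) (y j)) x"
        unfolding F_def using g x X_sub by (subst lext_translate) auto
      also have "\<dots> = lext (\<lambda>w. act g (case w of (h, j) \<Rightarrow> act h (y j))) x"
        using X_fst[OF x] Y g y by (intro lext_cong) auto
      also have "\<dots> = act g (F x)"
        unfolding F_def using X_fst[OF x] Y g y by (intro lin_on_lext_apply[OF Y(3) Y(1), symmetric]) auto
      finally show ?thesis .
    qed
    have "\<delta> (F x) = lext (\<lambda>w. \<delta> (case w of (g, j) \<Rightarrow> act g (y j))) x"
      unfolding F_def using X_fst[OF x] Y y by (intro lin_on_lext_apply[OF \<delta>(1) Y(1)]) auto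
    also have "\<dots> = lext (\<lambda>w. h (case w of (g, j) \<Rightarrow> translate G g (gen n j))) x"
      using X_fst[OF x] Y y \<delta> h gen_closed by (intro lext_cong) auto
    also have "\<dots> = h (lext (\<lambda>(g, j). translate G g (gen n j)) x)"
      using X_fst[OF x] gen_closed X_translate by (intro lin_on_lext_apply[OF h(1) X_subspace, symmetric]) auto
    also have "\<dots> = h x" by (simp add: expand[OF x])
    finally show "\<delta> (F x) = h x" .
  qed
qed

text \<open>Expand x in the translates of the \<open>gen n j\<close>; by equivariance of f the
  translations disappear under \<open>coinv\<close>. Thus \<open>coinv (f x)\<close> depends on
  \<open>coinv x\<close> alone, and f has an induced map on coinvariants whose matrix has the rows
  \<open>coinv (f (gen n j))\<close>.\<close>

lemma coinv_hom:
  assumes "translation_hom G (X n) Y f" "Y \<subseteq> grp_funs G" "x \<in> X n"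
  shows "coinv (f x) = lext (\<lambda>j. coinv (f (gen n j))) (coinv x)"
proof -
  have f: "lin_on (X n) f" "\<And>x. x \<in> X n \<Longrightarrow> f x \<in> grp_funs G"
    "\<And>g x. g \<in> carrier G \<Longrightarrow> x \<in> X n \<Longrightarrow> f (translate G g x) = translate G g (f x)"
    using assms(1,2) unfolding translation_hom_def by auto
  have fin: "finite (supp x)" using assms(3) X_sub by (auto simp: fin_supp_on_def)
  have "coinv (f x) = coinv (f (lext (\<lambda>(g, j). translate G g (gen n j)) x))"
    by (simp add: expand[OF assms(3)])
  also have "\<dots> = lext (\<lambda>w. coinv (f (case w of (g, j) \<Rightarrow> translate G g (gen n j)))) x"
    using X_fst[OF assms(3)] gen_closed X_translate
    by (intro lin_on_lext_apply[where g = "\<lambda>x. coinv (f x)", OF _ X_subspace[of n]]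
        lin_on_compose[OF f(1) lin_on_coinv[OF order_refl]]) (use f(2) in auto)
  also have "\<dots> = lext (\<lambda>w. lext (\<lambda>j. coinv (f (gen n j))) (case w of (g, j) \<Rightarrow> unit_fun j)) x"
    using X_fst[OF assms(3)] gen_closed f by (intro lext_cong) (auto simp: coinv_translate)
  also have "\<dots> = lext (\<lambda>j. coinv (f (gen n j))) (coinv x)"
    unfolding coinv_def by (rule lext_lext[OF fin, symmetric]) auto
  finally show ?thesis .
qed

lemma coinv_hom_zero:
  assumes "translation_hom G (X n) Y f" "Y \<subseteq> grp_funs G" "x \<in> X n" "coinv x = 0"
  shows "coinv (f x) = 0"
  by (simp add: coinv_hom[OF assms(1-3)] assms(4))

lemma cycles_sub: "cycles X d n \<subseteq> X n"
  by (auto simp: cycles_def split: nat.splits)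

lemma subspace_cycles: "fs.subspace (cycles X d n)"
proof (cases n)
  case 0
  then show ?thesis by (simp add: cycles_def X_subspace)
next
  case (Suc m)
  have "lin_on (X (Suc m)) (\<lambda>x. coinv (d m x))"
    using d_closed by (intro lin_on_compose[OF d_lin lin_on_coinv[OF X_sub]]) auto
  then show ?thesis unfolding Suc cycles_def using subspace_kernel[OF X_subspace] by simp
qed

lemma subspace_coinv_boundaries: "fs.subspace (coinv ` d n ` X (Suc n))"
  by (intro subspace_image[OF subspace_image] X_subspace d_lin lin_on_coinv[of _ G])
    (use d_closed X_sub in blast)

lemma d_cycles:
  assumes "x \<in> X (Suc n)"
  shows "d n x \<in> cycles X d n"
proof (cases n)
  case (Suc m)
  have "coinv (0 :: 'a \<times> 'j \<Rightarrow> complex) = 0" unfolding coinv_def by simp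
  then show ?thesis using d_closed[OF assms] d_d assms Suc by (simp add: cycles_def)
qed (use d_closed[OF assms] in \<open>simp add: cycles_def\<close>)

end

section \<open>Chain maps and chain homotopies between two resolutions\<close>

locale group_resolution_pair = X: group_resolution G X d eps gen + Y: group_resolution G Y d' eps' gen'
  for G :: "('a, 'b) monoid_scheme" (structure)
    and X :: "nat \<Rightarrow> ('a \<times> 'j \<Rightarrow> complex) set" and d eps gen
    and Y :: "nat \<Rightarrow> ('a \<times> 'k \<Rightarrow> complex) set" and d' eps' gen'
begin

lemma lift_d:
  assumes h: "translation_hom G (X n) (Y m) h" "\<And>x. x \<in> X n \<Longrightarrow> h x \<in> d' m ` Y (Suc m)"
  shows "\<exists>F. translation_hom G (X n) (Y (Suc m)) F \<and> (\<forall>x\<in>X n. d' m (F x) = h x)"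
proof -
  obtain F where "F \<in> X n \<rightarrow> Y (Suc m)" "lin_on (X n) F"
    "\<And>g x. g \<in> carrier G \<Longrightarrow> x \<in> X n \<Longrightarrow> F (translate G g x) = translate G g (F x)"
    "\<And>x. x \<in> X n \<Longrightarrow> d' m (F x) = h x"
    using h(1) by (rule_tac X.lift[of "Y (Suc m)" "translate G" "d' m" "translate G" n h])
      (auto simp: translation_hom_def X.translate_mult Y.X_subspace Y.X_translate lin_on_translate
        Y.d_lin Y.d_translate h(2))
  then show ?thesis unfolding translation_hom_def by (intro exI[of _ F]) auto
qed

lemma lift_eps:
  "\<exists>F. translation_hom G (X 0) (Y 0) F \<and> (\<forall>x\<in>X 0. eps' (F x) = eps x)"
proof -
  obtain F where "F \<in> X 0 \<rightarrow> Y 0" "lin_on (X 0) F"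
    "\<And>g x. g \<in> carrier G \<Longrightarrow> x \<in> X 0 \<Longrightarrow> F (translate G g x) = translate G g (F x)"
    "\<And>x. x \<in> X 0 \<Longrightarrow> eps' (F x) = eps x"
    by (rule_tac X.lift[of "Y 0" "translate G" "eps'" "\<lambda>g x. x" 0 eps])
      (auto simp: X.translate_mult Y.X_subspace Y.X_translate lin_on_translate X.eps_lin X.eps_translate
        Y.eps_lin Y.eps_translate Y.eps_surj)
  then show ?thesis unfolding translation_hom_def by (intro exI[of _ F]) auto
qed

text \<open>The kernel of the augmentation in degree 0 and of the boundary map above it. Both are
  images of the next boundary map, so one induction step covers all degrees.\<close>

definition kerX :: "nat \<Rightarrow> ('a \<times> 'j \<Rightarrow> complex) set"
  where "kerX n = (case n of 0 \<Rightarrow> {x \<in> X 0. eps x = 0} | Suc m \<Rightarrow> {x \<in> X (Suc m). d m x = 0})"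

definition kerY :: "nat \<Rightarrow> ('a \<times> 'k \<Rightarrow> complex) set"
  where "kerY n = (case n of 0 \<Rightarrow> {x \<in> Y 0. eps' x = 0} | Suc m \<Rightarrow> {x \<in> Y (Suc m). d' m x = 0})"

lemma kerX_eq: "kerX n = d n ` X (Suc n)"
  by (cases n) (auto simp: kerX_def X.exact_0 X.exact_Suc)

lemma kerY_eq: "kerY n = d' n ` Y (Suc n)"
  by (cases n) (auto simp: kerY_def Y.exact_0 Y.exact_Suc)

lemma kerX_sub: "kerX n \<subseteq> X n"
  by (auto simp: kerX_def split: nat.splits)

lemma chain_map_exists: "\<exists>\<phi>. chain_map G X d eps Y d' eps' \<phi>"
proof -
  \<comment> \<open>Preservation of kernels is the invariant that carries the recursion: it puts f
    (d n x) into the image of the next boundary map of Y, where \<open>lift_d\<close>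
    applies.\<close>
  define P where "P n f \<longleftrightarrow> translation_hom G (X n) (Y n) f \<and> f ` kerX n \<subseteq> kerY n \<and>
    (n = 0 \<longrightarrow> (\<forall>x\<in>X 0. eps' (f x) = eps x))" for n f
  define Q where "Q n f f' \<longleftrightarrow> (\<forall>x\<in>X (Suc n). d' n (f' x) = f (d n x))" for n f f'
  have "\<exists>\<phi>. \<forall>n. P n (\<phi> n) \<and> Q n (\<phi> n) (\<phi> (Suc n))"
  proof (rule dependent_nat_choice)
    obtain F where F: "translation_hom G (X 0) (Y 0) F" "\<forall>x\<in>X 0. eps' (F x) = eps x"
      using lift_eps by blast
    then have "P 0 F" by (auto simp: P_def kerX_def kerY_def translation_hom_def)
    then show "\<exists>f. P 0 f" by blast
  next
    fix f n assume f: "P n f"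
    have hom: "translation_hom G (X (Suc n)) (Y n) (\<lambda>x. f (d n x))"
      by (rule translation_hom_compose[OF X.d_hom[of n]]) (use f in \<open>simp add: P_def\<close>)
    have "f (d n x) \<in> d' n ` Y (Suc n)" if "x \<in> X (Suc n)" for x
      using f that by (auto simp: P_def kerX_eq kerY_eq)
    from lift_d[OF hom this] obtain F where
      F: "translation_hom G (X (Suc n)) (Y (Suc n)) F" "\<forall>x\<in>X (Suc n). d' n (F x) = f (d n x)"
      by blast
    \<comment> \<open>If d n x = 0, then F x has boundary f 0; its vanishing is the invariant in the
      next degree.\<close>
    have "f 0 = 0"
      using f by (intro lin_on_zero[OF _ X.X_subspace[of n]]) (simp add: P_def translation_hom_def)
    then have "P (Suc n) F"
      using F by (auto simp: P_def kerX_def kerY_def translation_hom_def)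
    then show "\<exists>f'. P (Suc n) f' \<and> Q n f f'" using F(2) by (auto simp: Q_def)
  qed
  then obtain \<phi> where \<phi>: "\<And>n. P n (\<phi> n)" "\<And>n. Q n (\<phi> n) (\<phi> (Suc n))" by blast
  then have "chain_map G X d eps Y d' eps' \<phi>"
    by (auto simp: chain_map_def P_def Q_def)
  then show ?thesis by blast
qed

lemma translation_hom_diff:
  assumes "translation_hom G (X n) (Y m) f" "translation_hom G (X n) (Y m) g"
  shows "translation_hom G (X n) (Y m) (\<lambda>x. f x - g x)"
  using assms lin_on_diff[OF lin_on_translate[of _ G] Y.X_subspace[of m]]
  by (auto simp: translation_hom_def lin_on_diff_fun Pi_iff fs.subspace_diff Y.X_subspace)

lemma chain_homotopy:
  assumes "chain_map G X d eps Y d' eps' \<phi>" "chain_map G X d eps Y d' eps' \<psi>"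
  obtains s where "\<And>n. translation_hom G (X n) (Y (Suc n)) (s n)"
    "\<And>x. x \<in> X 0 \<Longrightarrow> \<phi> 0 x - \<psi> 0 x = d' 0 (s 0 x)"
    "\<And>n x. x \<in> X (Suc n) \<Longrightarrow> \<phi> (Suc n) x - \<psi> (Suc n) x = d' (Suc n) (s (Suc n) x) + s n (d n x)"
proof -
  define k where "k n x = \<phi> n x - \<psi> n x" for n x
  have homs: "translation_hom G (X n) (Y n) (\<phi> n)" "translation_hom G (X n) (Y n) (\<psi> n)" for n
    using assms by (auto simp: chain_map_def)
  have k_hom: "translation_hom G (X n) (Y n) (k n)" for n
    unfolding k_def by (rule translation_hom_diff[OF homs])
  have in_Y: "\<phi> n x \<in> Y n" "\<psi> n x \<in> Y n" "k n x \<in> Y n" if "x \<in> X n" for n x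
    using homs[of n] k_hom[of n] that by (auto simp: translation_hom_def)
  have k0: "eps' (k 0 x) = 0" if "x \<in> X 0" for x
    unfolding k_def using assms that in_Y[OF that]
    by (simp add: lin_on_diff[OF Y.eps_lin Y.X_subspace] chain_map_def)
  have kd: "d' n (k (Suc n) x) = k n (d n x)" if "x \<in> X (Suc n)" for n x
    unfolding k_def using assms that in_Y[OF that]
    by (simp add: lin_on_diff[OF Y.d_lin Y.X_subspace] chain_map_def)
  \<comment> \<open>On \<open>kerX n\<close> the homotopy equation loses the term with s after d.
    This weak form is the invariant: applied to d n x, it shows that k (Suc n) x - s (d n x) is a
    cycle and can be lifted. The full equation is \<open>Q\<close>; degree 0 has no preceding
    homotopy, so there it belongs to \<open>P\<close>.\<close>
  define P where "P n s \<longleftrightarrow> translation_hom G (X n) (Y (Suc n)) s \<and> (\<forall>x\<in>kerX n. d' n (s x) = k n x) \<and>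
    (n = 0 \<longrightarrow> (\<forall>x\<in>X 0. d' 0 (s x) = k 0 x))" for n s
  define Q where "Q n s s' \<longleftrightarrow> (\<forall>x\<in>X (Suc n). d' (Suc n) (s' x) = k (Suc n) x - s (d n x))" for n s s'
  have "\<exists>s. \<forall>n. P n (s n) \<and> Q n (s n) (s (Suc n))"
  proof (rule dependent_nat_choice)
    have "k 0 x \<in> d' 0 ` Y (Suc 0)" if "x \<in> X 0" for x
      using k0[OF that] in_Y[OF that] by (simp flip: Y.exact_0)
    from lift_d[OF k_hom this] obtain F where
      F: "translation_hom G (X 0) (Y (Suc 0)) F" "\<forall>x\<in>X 0. d' 0 (F x) = k 0 x"
      by blast
    then have "P 0 F" using kerX_sub[of 0] unfolding P_def by blast
    then show "\<exists>f. P 0 f" by blast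
  next
    fix s n assume s: "P n s"
    have sd: "translation_hom G (X (Suc n)) (Y (Suc n)) (\<lambda>x. s (d n x))"
      by (rule translation_hom_compose[OF X.d_hom[of n]]) (use s in \<open>simp add: P_def\<close>)
    have hom: "translation_hom G (X (Suc n)) (Y (Suc n)) (\<lambda>x. k (Suc n) x - s (d n x))"
      by (rule translation_hom_diff[OF k_hom sd])
    have "k (Suc n) x - s (d n x) \<in> d' (Suc n) ` Y (Suc (Suc n))" if x: "x \<in> X (Suc n)" for x
    proof -
      have sY: "s (d n x) \<in> Y (Suc n)" using sd x by (auto simp: translation_hom_def)
      have "d' n (s (d n x)) = k n (d n x)" using s x by (auto simp: P_def kerX_eq)
      then have "d' n (k (Suc n) x - s (d n x)) = 0"
        using in_Y[OF x] sY kd[OF x] by (simp add: lin_on_diff[OF Y.d_lin Y.X_subspace])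
      then show ?thesis
        using in_Y[OF x] sY by (simp flip: Y.exact_Suc add: fs.subspace_diff Y.X_subspace)
    qed
    from lift_d[OF hom this] obtain F where
      F: "translation_hom G (X (Suc n)) (Y (Suc (Suc n))) F"
      "\<forall>x\<in>X (Suc n). d' (Suc n) (F x) = k (Suc n) x - s (d n x)"
      by blast
    have "s 0 = 0"
      using s by (intro lin_on_zero[OF _ X.X_subspace[of n]]) (simp add: P_def translation_hom_def)
    then have "P (Suc n) F"
      using F by (auto simp: P_def kerX_def)
    then show "\<exists>s'. P (Suc n) s' \<and> Q n s s'" using F(2) by (auto simp: Q_def)
  qed
  then obtain s where s: "\<And>n. P n (s n)" "\<And>n. Q n (s n) (s (Suc n))" by blast
  show thesis
  proof
    show "translation_hom G (X n) (Y (Suc n)) (s n)" for n using s(1) by (simp add: P_def)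
    show "\<phi> 0 x - \<psi> 0 x = d' 0 (s 0 x)" if "x \<in> X 0" for x
      using s(1)[of 0] that by (simp add: P_def k_def)
    show "\<phi> (Suc n) x - \<psi> (Suc n) x = d' (Suc n) (s (Suc n) x) + s n (d n x)" if "x \<in> X (Suc n)" for n x
      using s(2)[of n] that by (simp add: Q_def k_def)
  qed
qed

text \<open>In the homotopy formula the term s (d x) vanishes after \<open>coinv\<close>, because
  \<open>coinv (d x)\<close> is 0 for a cycle and s induces a map on coinvariants. Only a boundary
  remains.\<close>

lemma coinv_chain_map_diff:
  assumes "chain_map G X d eps Y d' eps' \<phi>" "chain_map G X d eps Y d' eps' \<psi>" "x \<in> cycles X d n"
  shows "coinv (\<phi> n x) - coinv (\<psi> n x) \<in> coinv ` d' n ` Y (Suc n)"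
proof -
  obtain s where s: "\<And>n. translation_hom G (X n) (Y (Suc n)) (s n)"
    "\<And>x. x \<in> X 0 \<Longrightarrow> \<phi> 0 x - \<psi> 0 x = d' 0 (s 0 x)"
    "\<And>n x. x \<in> X (Suc n) \<Longrightarrow> \<phi> (Suc n) x - \<psi> (Suc n) x = d' (Suc n) (s (Suc n) x) + s n (d n x)"
    using chain_homotopy[OF assms(1,2)] by blast
  have sY: "s n x \<in> Y (Suc n)" if "x \<in> X n" for n x
    using s(1)[of n] that by (auto simp: translation_hom_def)
  have x: "x \<in> X n" using assms(3) X.cycles_sub by blast
  then have Y: "\<phi> n x \<in> Y n" "\<psi> n x \<in> Y n"
    using assms(1,2) by (auto simp: chain_map_def translation_hom_def)
  have "coinv (\<phi> n x) - coinv (\<psi> n x) = coinv (\<phi> n x - \<psi> n x)"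
    using lin_on_diff[OF lin_on_coinv[OF Y.X_sub] Y.X_subspace Y] by simp
  also have "\<dots> = coinv (d' n (s n x))"
  proof (cases n)
    case 0
    then show ?thesis using s(2) x by simp
  next
    case (Suc m)
    have dx: "d m x \<in> X m" "coinv (d m x) = 0"
      using x X.d_closed assms(3) Suc by (auto simp: cycles_def)
    have "coinv (s m (d m x)) = 0"
      by (rule X.coinv_hom_zero[OF s(1) Y.X_sub dx])
    then show ?thesis
      using s(3) x Suc lin_on_add[OF lin_on_coinv[OF Y.X_sub] Y.d_closed[OF sY[OF x]], of "s m (d m x)"] sY[OF dx(1)]
      by simp
  qed
  finally show ?thesis using sY[OF x] by auto
qed

lemma chain_map_cycles:
  assumes "chain_map G X d eps Y d' eps' \<phi>" "x \<in> cycles X d n"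
  shows "\<phi> n x \<in> cycles Y d' n"
proof -
  have x: "x \<in> X n" using assms(2) X.cycles_sub by blast
  then have y: "\<phi> n x \<in> Y n"
    using assms(1) by (auto simp: chain_map_def translation_hom_def)
  show ?thesis
  proof (cases n)
    case (Suc m)
    have hom: "translation_hom G (X m) (Y m) (\<phi> m)" using assms(1) by (auto simp: chain_map_def)
    have "coinv (d' m (\<phi> n x)) = coinv (\<phi> m (d m x))" using assms(1) x Suc by (simp add: chain_map_def)
    also have "\<dots> = 0"
      using assms(2) x X.d_closed Suc by (intro X.coinv_hom_zero[OF hom Y.X_sub]) (auto simp: cycles_def)
    finally show ?thesis using y Suc by (simp add: cycles_def)
  qed (use y in \<open>simp add: cycles_def\<close>)
qed

end

text \<open>Take chain maps \<phi> and \<psi> in both directions. The homotopy from \<psi> after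
  \<phi> to the identity gives injectivity on homology, the one from \<phi> after \<psi>
  surjectivity. The index types of X and Y may differ; the conclusion transfers only a
  dimension.\<close>

theorem coinv_homology_invariant:
  assumes X: "group_resolution G X d eps gen" and Y: "group_resolution G Y d' eps' gen'"
    and dim: "quot_dim (coinv ` cycles Y d' n) (coinv ` d' n ` Y (Suc n)) k"
  shows "quot_dim (coinv ` cycles X d n) (coinv ` d n ` X (Suc n)) k"
proof -
  interpret X: group_resolution G X d eps gen by (rule X)
  interpret Y: group_resolution G Y d' eps' gen' by (rule Y)
  interpret XY: group_resolution_pair G X d eps gen Y d' eps' gen' ..
  interpret YX: group_resolution_pair G Y d' eps' gen' X d eps gen ..
  \<comment> \<open>Pairing each resolution with itself allows the composites to be compared with
    the identity chain map.\<close>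
  interpret XX: group_resolution_pair G X d eps gen X d eps gen ..
  interpret YY: group_resolution_pair G Y d' eps' gen' Y d' eps' gen' ..
  obtain \<phi> where \<phi>: "chain_map G X d eps Y d' eps' \<phi>" using XY.chain_map_exists by blast
  obtain \<psi> where \<psi>: "chain_map G Y d' eps' X d eps \<psi>" using YX.chain_map_exists by blast
  have \<phi>_hom: "translation_hom G (X n) (Y n) (\<phi> n)" for n using \<phi> by (simp add: chain_map_def)
  have \<psi>_hom: "translation_hom G (Y n) (X n) (\<psi> n)" for n using \<psi> by (simp add: chain_map_def)
  have \<phi>Y: "\<phi> n x \<in> Y n" if "x \<in> X n" for n x using \<phi>_hom[of n] that by (auto simp: translation_hom_def)
  have \<psi>X: "\<psi> n x \<in> X n" if "x \<in> Y n" for n x using \<psi>_hom[of n] that by (auto simp: translation_hom_def)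
  \<comment> \<open>The map induced by \<phi> on coinvariants, extended to all functions on the
    index type; \<open>coinv_hom\<close> is its defining property.\<close>
  define f where "f = lext (\<lambda>j. coinv (\<phi> n (gen n j)))"
  have f: "f (coinv x) = coinv (\<phi> n x)" if "x \<in> X n" for x
    unfolding f_def by (rule X.coinv_hom[OF \<phi>_hom Y.X_sub that, symmetric])
  have coinv_fin: "coinv ` X n \<subseteq> fin_supp_on UNIV"
    using X.X_sub[of n] subspace_fin_supp_on by (auto simp: coinv_def intro!: lext_in)
  show ?thesis
  proof (rule quot_dim_transfer[OF _ _ _ _ _ _ dim, of _ f])
    show "lin_on (coinv ` cycles X d n) f"
      unfolding f_def using X.cycles_sub coinv_fin by (intro lin_on_subset[OF lin_on_lext]) blast
    show "f \<in> coinv ` cycles X d n \<rightarrow> coinv ` cycles Y d' n"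
      using f X.cycles_sub XY.chain_map_cycles[OF \<phi>] by fastforce
    show "fs.subspace (coinv ` cycles Y d' n)"
      using Y.cycles_sub Y.X_sub by (intro subspace_image[OF Y.subspace_cycles] lin_on_coinv[of _ G]) blast
    show "coinv ` d n ` X (Suc n) \<subseteq> coinv ` cycles X d n"
      using X.d_cycles by auto
  next
    fix z assume "z \<in> coinv ` cycles X d n"
    then obtain x where x: "x \<in> cycles X d n" "z = coinv x" by auto
    then have xX: "x \<in> X n" using X.cycles_sub by blast
    show "f z \<in> coinv ` d' n ` Y (Suc n) \<longleftrightarrow> z \<in> coinv ` d n ` X (Suc n)"
    proof
      assume "z \<in> coinv ` d n ` X (Suc n)"
      then obtain x' where x': "x' \<in> X (Suc n)" "z = coinv (d n x')" by auto
      then have "f z = coinv (d' n (\<phi> (Suc n) x'))"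
        using \<phi> f[OF X.d_closed] by (simp add: chain_map_def)
      then show "f z \<in> coinv ` d' n ` Y (Suc n)" using \<phi>Y[OF x'(1)] by auto
    next
      assume "f z \<in> coinv ` d' n ` Y (Suc n)"
      then obtain y where y: "y \<in> Y (Suc n)" "coinv (\<phi> n x) = coinv (d' n y)"
        using f[OF xX] x by auto
      \<comment> \<open>Applying the map induced by \<psi> turns the boundary into one of X. Since
        \<psi> (\<phi> x) and x differ by a boundary on coinvariants, \<open>coinv x\<close> is a
        boundary as well.\<close>
      have "coinv (\<psi> n (\<phi> n x)) = coinv (\<psi> n (d' n y))"
        using y Y.coinv_hom[OF \<psi>_hom X.X_sub] \<phi>Y[OF xX] Y.d_closed[OF y(1)] by metis
      also have "\<dots> = coinv (d n (\<psi> (Suc n) y))" using \<psi> y by (simp add: chain_map_def)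
      finally have 1: "coinv (\<psi> n (\<phi> n x)) \<in> coinv ` d n ` X (Suc n)" using \<psi>X[OF y(1)] by auto
      have "coinv (\<psi> n (\<phi> n x)) - coinv x \<in> coinv ` d n ` X (Suc n)"
        by (rule XX.coinv_chain_map_diff[OF chain_map_compose[OF \<phi> \<psi>] chain_map_id x(1)])
      from fs.subspace_diff[OF X.subspace_coinv_boundaries 1 this] show "z \<in> coinv ` d n ` X (Suc n)" using x(2) by simp
    qed
  next
    fix z' assume "z' \<in> coinv ` cycles Y d' n"
    then obtain y where y: "y \<in> cycles Y d' n" "z' = coinv y" by auto
    then have yY: "y \<in> Y n" using Y.cycles_sub by blast
    have "z' - f (coinv (\<psi> n y)) \<in> coinv ` d' n ` Y (Suc n)"
      unfolding f[OF \<psi>X[OF yY]] y(2)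
      by (rule YY.coinv_chain_map_diff[OF chain_map_id chain_map_compose[OF \<psi> \<phi>] y(1)])
    then show "\<exists>z\<in>coinv ` cycles X d n. z' - f z \<in> coinv ` d' n ` Y (Suc n)"
      using YX.chain_map_cycles[OF \<psi> y(1)] by blast
  qed
qed

section \<open>The bar resolution\<close>

lemma abelian_group_complex_line: "abelian_group complex_line"
proof (rule abelian_groupI)
  show "\<exists>y\<in>carrier complex_line. y \<oplus>\<^bsub>complex_line\<^esub> x = \<zero>\<^bsub>complex_line\<^esub>" for x
    by (rule bexI[of _ "-x"]) (auto simp: complex_line_def)
qed (auto simp: complex_line_def)

interpretation cl: abelian_group complex_line
  by (rule abelian_group_complex_line)

lemma complex_line_simps:
  "carrier complex_line = UNIV" "\<zero>\<^bsub>complex_line\<^esub> = 0" "x \<oplus>\<^bsub>complex_line\<^esub> y = x + y"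
  by (auto simp: complex_line_def)

lemma finsum_complex_line: "finite A \<Longrightarrow> finsum complex_line f A = sum f A"
proof (induction A rule: finite_induct)
  case (insert x F)
  then have "finsum complex_line f (insert x F) = f x \<oplus>\<^bsub>complex_line\<^esub> finsum complex_line f F"
    by (intro cl.finsum_insert) (auto simp: complex_line_simps)
  then show ?case using insert by (simp add: complex_line_simps)
qed (simp add: complex_line_simps)

lemma a_inv_complex_line: "\<ominus>\<^bsub>complex_line\<^esub> x = - x"
  by (rule cl.minus_equality) (auto simp: complex_line_def)

section \<open>Boundary, augmentation and contraction of the bar resolution\<close>

context group
begin

definition words :: "nat \<Rightarrow> 'a list set"
  where "words n = {w. length w = n \<and> set w \<subseteq> carrier G}"

definition bar_module :: "nat \<Rightarrow> ('a \<times> 'a list \<Rightarrow> complex) set"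
  where "bar_module n = fin_supp_on (carrier G \<times> words n)"

text \<open>The boundary of the free generator [w]. Only face 0 carries a group element as
  coefficient, the first letter of w. The value at the empty word is junk; only words of positive
  length are used.\<close>

definition bar_simplex :: "'a list \<Rightarrow> 'a \<times> 'a list \<Rightarrow> complex"
  where "bar_simplex w =
    (\<Sum>i\<le>length w. (-1) ^ i \<cdot> unit_fun (if i = 0 then hd w else \<one>, bar_face G i w))"

text \<open>One map serves all degrees, as the length of a word records its degree.\<close>

definition bar_d :: "('a \<times> 'a list \<Rightarrow> complex) \<Rightarrow> 'a \<times> 'a list \<Rightarrow> complex"
  where "bar_d = lext (\<lambda>(g, w). translate G g (bar_simplex w))"

definition bar_eps :: "('a \<times> 'a list \<Rightarrow> complex) \<Rightarrow> unit \<Rightarrow> complex"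
  where "bar_eps = lext (\<lambda>_ _. 1)"

text \<open>The contracting homotopy; \<open>d h + h d = 1\<close> yields \<open>d d = 0\<close> by induction, without simplicial
  identities.\<close>

definition bar_h :: "('a \<times> 'a list \<Rightarrow> complex) \<Rightarrow> 'a \<times> 'a list \<Rightarrow> complex"
  where "bar_h = lext (\<lambda>(g, w). unit_fun (\<one>, g # w))"

text \<open>A resolution requires a generator for every index, so words of the wrong length or with
  letters outside the group get 0.\<close>

definition bar_gen :: "nat \<Rightarrow> 'a list \<Rightarrow> 'a \<times> 'a list \<Rightarrow> complex"
  where "bar_gen n w = (if w \<in> words n then unit_fun (\<one>, w) else 0)"

lemma bar_face_words: "w \<in> words (Suc n) \<Longrightarrow> i \<le> Suc n \<Longrightarrow> bar_face G i w \<in> words n"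
  unfolding words_def bar_face_def
  by (auto dest: in_set_takeD in_set_dropD in_set_butlastD list.set_sel(2)[rotated]
      simp: subset_iff nth_mem)

lemma hd_words: "w \<in> words (Suc n) \<Longrightarrow> hd w \<in> carrier G"
  by (cases w) (auto simp: words_def)

lemma length_words: "w \<in> words n \<Longrightarrow> length w = n"
  by (simp add: words_def)

lemma bar_face_1: "w \<noteq> [] \<Longrightarrow> bar_face G (Suc 0) (g # w) = (g \<otimes> hd w) # tl w"
  by (cases w) (auto simp: bar_face_def)

text \<open>Prefixing a letter commutes with all faces except face 0, whose successor multiplies g
  into the first letter instead (\<open>bar_face_1\<close>). Both cases are needed for the
  contraction.\<close>

lemma bar_face_Suc:
  assumes "0 < i" "i \<le> length w" shows "bar_face G (Suc i) (g # w) = g # bar_face G i w"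
proof (cases "i = length w")
  case True
  then show ?thesis using assms by (auto simp: bar_face_def)
next
  case False
  obtain k where "i = Suc k" using assms by (cases i) auto
  then show ?thesis using assms False by (auto simp: bar_face_def)
qed

lemma subspace_bar_module: "fs.subspace (bar_module n)"
  unfolding bar_module_def by (rule subspace_fin_supp_on)

lemma bar_module_sub: "bar_module n \<subseteq> grp_funs G"
  unfolding bar_module_def by (rule fin_supp_on_mono) auto

lemma unit_fun_bar_module [simp]: "unit_fun (g, w) \<in> bar_module n \<longleftrightarrow> g \<in> carrier G \<and> w \<in> words n"
  by (simp add: bar_module_def)

lemma bar_moduleD: "x \<in> bar_module n \<Longrightarrow> (g, w) \<in> supp x \<Longrightarrow> g \<in> carrier G \<and> w \<in> words n"
  unfolding bar_module_def by (blast dest: fin_supp_onD(2))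

lemma translate_bar_module:
  assumes "g \<in> carrier G" "x \<in> bar_module n" shows "translate G g x \<in> bar_module n"
proof -
  have "x \<in> grp_funs G" using assms(2) bar_module_sub by blast
  moreover have "lext (\<lambda>(h, j). unit_fun (g \<otimes> h, j)) x \<in> bar_module n"
    using assms bar_moduleD[OF assms(2)] by (intro lext_in[OF subspace_bar_module]) auto
  ultimately show ?thesis using translate_lext[OF assms(1)] by metis
qed

lemma bar_simplex_closed: "w \<in> words (Suc n) \<Longrightarrow> bar_simplex w \<in> bar_module n"
  unfolding bar_simplex_def
  by (intro fs.subspace_sum[OF subspace_bar_module] fs.subspace_scale[OF subspace_bar_module])
    (auto simp: bar_face_words hd_words length_words)

lemma bar_d_closed: "x \<in> bar_module (Suc n) \<Longrightarrow> bar_d x \<in> bar_module n"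
  unfolding bar_d_def
  by (rule lext_in[OF subspace_bar_module])
    (auto simp: bar_module_def[of "Suc n"] fin_supp_on_def intro!: translate_bar_module bar_simplex_closed)

lemma lin_on_bar_d: "lin_on (bar_module n) bar_d"
  unfolding bar_d_def bar_module_def by (rule lin_on_lext)

lemma lin_on_bar_h: "lin_on (bar_module n) bar_h"
  unfolding bar_h_def bar_module_def by (rule lin_on_lext)

lemma bar_h_closed: "x \<in> bar_module n \<Longrightarrow> bar_h x \<in> bar_module (Suc n)"
  unfolding bar_h_def
  by (rule lext_in[OF subspace_bar_module]) (auto simp: bar_module_def[of n] fin_supp_on_def words_def)

lemma lin_on_bar_eps: "lin_on (bar_module n) bar_eps"
  unfolding bar_eps_def bar_module_def by (rule lin_on_lext)

lemma bar_d_unit: "bar_d (unit_fun (g, w)) = translate G g (bar_simplex w)"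
  by (simp add: bar_d_def)

lemma bar_d_translate:
  assumes "g \<in> carrier G" "x \<in> bar_module (Suc n)"
  shows "bar_d (translate G g x) = translate G g (bar_d x)"
proof -
  have x: "\<And>h w. (h, w) \<in> supp x \<Longrightarrow> h \<in> carrier G \<and> w \<in> words (Suc n)"
    using assms(2) by (auto simp: bar_module_def fin_supp_on_def)
  have "bar_d (translate G g x) = lext (\<lambda>(h, w). translate G (g \<otimes> h) (bar_simplex w)) x"
    using assms bar_module_sub unfolding bar_d_def by (subst lext_translate) auto
  also have "\<dots> = lext (\<lambda>p. translate G g (case p of (h, w) \<Rightarrow> translate G h (bar_simplex w))) x"
    using x assms(1) by (intro lext_cong) (auto simp: translate_mult)
  also have "\<dots> = translate G g (bar_d x)"
    unfolding bar_d_def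
    using x bar_simplex_closed translate_bar_module
    by (intro lin_on_lext_apply[OF lin_on_translate subspace_bar_module[of n], symmetric]) auto
  finally show ?thesis .
qed

text \<open>This is d h + h d = 1 on the basis vector g[w]. As h (g[w]) is [g|w], face 0 returns
  g[w], and every later face of [g|w] is h of the translate by g of the preceding face of w, with
  opposite sign.\<close>

lemma bar_simplex_Cons:
  assumes "g \<in> carrier G" "w \<in> words (Suc n)"
  shows "bar_simplex (g # w) = unit_fun (g, w) - bar_h (translate G g (bar_simplex w))"
proof -
  have w: "w \<noteq> []" "length w = Suc n" "set w \<subseteq> carrier G" using assms(2) by (auto simp: words_def)
  have hdw: "hd w \<in> carrier G" using w by (cases w) auto
  have lin: "lin_on (bar_module n) (\<lambda>x. bar_h (translate G g x))"
    by (rule lin_on_compose[OF lin_on_translate lin_on_bar_h]) (use translate_bar_module assms(1) in blast)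
  have summand: "unit_fun (if i = 0 then hd w else \<one>, bar_face G i w) \<in> bar_module n" if "i \<le> length w" for i
    using that assms(2) hdw w(2) by (auto simp: bar_face_words)
  have "bar_h (translate G g (bar_simplex w)) =
    (\<Sum>i\<le>length w. (-1) ^ i \<cdot> bar_h (translate G g (unit_fun (if i = 0 then hd w else \<one>, bar_face G i w))))"
    unfolding bar_simplex_def by (rule lin_on_sum_scale[OF lin subspace_bar_module]) (use summand in auto)
  also have "\<dots> = (\<Sum>i\<le>length w. (-1) ^ i \<cdot> unit_fun (\<one>, bar_face G (Suc i) (g # w)))"
    using assms(1) hdw w(1)
    by (intro sum.cong) (auto simp: translate_unit_fun bar_h_def bar_face_1 bar_face_Suc bar_face_def[of _ 0])
  finally have 1: "bar_h (translate G g (bar_simplex w)) = \<dots>" .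
  have "bar_simplex (g # w) = unit_fun (g, w) + (\<Sum>i\<le>length w. (-1) ^ Suc i \<cdot> unit_fun (\<one>, bar_face G (Suc i) (g # w)))"
    unfolding bar_simplex_def list.size(4) add_Suc_right add_0_right sum.atMost_Suc_shift
    by (simp add: bar_face_def[of _ 0])
  also have "\<dots> = unit_fun (g, w) - (\<Sum>i\<le>length w. (-1) ^ i \<cdot> unit_fun (\<one>, bar_face G (Suc i) (g # w)))"
    by (simp add: sum_negf)
  finally show ?thesis using 1 by simp
qed

lemma bar_simplex_single: "bar_simplex [g] = unit_fun (g, []) - unit_fun (\<one>, [])"
  by (simp add: bar_simplex_def bar_face_def)

lemma translate_one: "x \<in> grp_funs G \<Longrightarrow> translate G \<one> x = x"
  by (auto simp: translate_def fun_eq_iff fin_supp_on_def supp_def subset_iff)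

text \<open>The contraction h is not equivariant, so the identity is checked on all basis vectors
  g[w], not merely on the free generators [w].\<close>

lemma bar_d_h:
  assumes "x \<in> bar_module (Suc n)"
  shows "bar_d (bar_h x) = x - bar_h (bar_d x)"
proof (rule lin_on_fin_supp_eqI[OF _ _ _ assms[unfolded bar_module_def]])
  note [simp] = bar_module_def[symmetric]
  show "lin_on (fin_supp_on (carrier G \<times> words (Suc n))) (\<lambda>x. bar_d (bar_h x))"
    using lin_on_compose[OF lin_on_bar_h lin_on_bar_d, of "Suc n" "Suc (Suc n)"] bar_h_closed by auto
  show "lin_on (fin_supp_on (carrier G \<times> words (Suc n))) (\<lambda>x. x - bar_h (bar_d x))"
    using lin_on_compose[OF lin_on_bar_d lin_on_bar_h, of "Suc n" n] bar_d_closed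
    by (auto intro: lin_on_diff_fun lin_on_id)
  fix p assume "p \<in> carrier G \<times> words (Suc n)"
  then obtain g w where p: "p = (g, w)" "g \<in> carrier G" "w \<in> words (Suc n)" by auto
  then have "bar_simplex (g # w) \<in> bar_module (Suc n)"
    by (intro bar_simplex_closed) (auto simp: words_def)
  then have "translate G \<one> (bar_simplex (g # w)) = bar_simplex (g # w)"
    using bar_module_sub by (intro translate_one) blast
  then show "bar_d (bar_h (unit_fun p)) = unit_fun p - bar_h (bar_d (unit_fun p))"
    using bar_simplex_Cons[OF p(2,3)] by (simp add: p(1) bar_d_unit bar_h_def)
qed

lemma bar_d_h_0:
  assumes "x \<in> bar_module 0"
  shows "bar_d (bar_h x) = x - bar_eps x () \<cdot> unit_fun (\<one>, [])"
proof (rule lin_on_fin_supp_eqI[OF _ _ _ assms[unfolded bar_module_def]])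
  note [simp] = bar_module_def[symmetric]
  show "lin_on (fin_supp_on (carrier G \<times> words 0)) (\<lambda>x. bar_d (bar_h x))"
    using lin_on_compose[OF lin_on_bar_h lin_on_bar_d, of 0 "Suc 0"] bar_h_closed by auto
  show "lin_on (fin_supp_on (carrier G \<times> words 0)) (\<lambda>x. x - bar_eps x () \<cdot> unit_fun (\<one>, []))"
    by (intro lin_on_diff_fun lin_on_id lin_onI)
      (auto simp: lin_on_add[OF lin_on_bar_eps] lin_on_scale[OF lin_on_bar_eps] fun_eq_iff pointwise algebra_simps)
  fix p assume "p \<in> carrier G \<times> words 0"
  then obtain g where p: "p = (g, [])" "g \<in> carrier G" by (auto simp: words_def)
  then have "bar_simplex [g] \<in> bar_module 0"
    by (intro bar_simplex_closed) (auto simp: words_def)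
  then have "translate G \<one> (bar_simplex [g]) = bar_simplex [g]"
    using bar_module_sub by (intro translate_one) blast
  then show "bar_d (bar_h (unit_fun p)) = unit_fun p - bar_eps (unit_fun p) () \<cdot> unit_fun (\<one>, [])"
    by (simp add: p(1) bar_d_unit bar_h_def bar_eps_def bar_simplex_single)
qed

lemma bar_eps_translate: "g \<in> carrier G \<Longrightarrow> x \<in> bar_module n \<Longrightarrow> bar_eps (translate G g x) = bar_eps x"
  using bar_module_sub unfolding bar_eps_def by (subst lext_translate) (auto intro: lext_cong)

lemma bar_h_zero [simp]: "bar_h 0 = 0"
  by (simp add: bar_h_def)

lemma bar_eps_d:
  assumes "x \<in> bar_module (Suc 0)"
  shows "bar_eps (bar_d x) = 0"
proof (rule lin_on_fin_supp_eqI[OF _ _ _ assms[unfolded bar_module_def]])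
  show "lin_on (fin_supp_on (carrier G \<times> words (Suc 0))) (\<lambda>x. bar_eps (bar_d x))"
    using lin_on_compose[OF lin_on_bar_d lin_on_bar_eps, of "Suc 0" 0] bar_d_closed
    by (auto simp: bar_module_def[symmetric])
  show "lin_on (fin_supp_on (carrier G \<times> words (Suc 0))) (\<lambda>x. 0)"
    by (auto intro!: lin_onI)
  fix p assume "p \<in> carrier G \<times> words (Suc 0)"
  then obtain g a where p: "p = (g, [a])" "g \<in> carrier G" "a \<in> carrier G"
    by (auto simp: words_def length_Suc_conv)
  have "bar_simplex [a] \<in> bar_module 0"
    using p by (intro bar_simplex_closed) (auto simp: words_def)
  then have "bar_eps (bar_d (unit_fun p)) = bar_eps (unit_fun (a, []) - unit_fun (\<one>, []))"
    using p by (simp add: bar_d_unit bar_eps_translate flip: bar_simplex_single)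
  also have "\<dots> = 0"
    using p by (subst lin_on_diff[OF lin_on_bar_eps[of 0] subspace_bar_module]) (auto simp: words_def bar_eps_def)
  finally show "bar_eps (bar_d (unit_fun p)) = 0" .
qed

text \<open>A basis vector g[a|w] is the translate by g of h y with y = a[w]. By equivariance of d
  it suffices to treat h y, and d d h y = d y - d h d y by the homotopy formula. Hence d d = 0
  follows from d h d = d one degree lower, which is again a case of the homotopy formula.\<close>

lemma bar_d_d_step:
  assumes key: "\<And>y. y \<in> bar_module (Suc n) \<Longrightarrow> bar_d (bar_h (bar_d y)) = bar_d y"
    and x: "x \<in> bar_module (Suc (Suc n))"
  shows "bar_d (bar_d x) = 0"
proof (rule lin_on_fin_supp_eqI[OF _ _ _ x[unfolded bar_module_def]])
  show "lin_on (fin_supp_on (carrier G \<times> words (Suc (Suc n)))) (\<lambda>x. bar_d (bar_d x))"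
    using lin_on_compose[OF lin_on_bar_d lin_on_bar_d, of "Suc (Suc n)" "Suc n"] bar_d_closed
    by (auto simp: bar_module_def[symmetric])
  show "lin_on (fin_supp_on (carrier G \<times> words (Suc (Suc n)))) (\<lambda>x. 0)"
    by (auto intro!: lin_onI)
  fix p assume "p \<in> carrier G \<times> words (Suc (Suc n))"
  then obtain g a w where p: "p = (g, a # w)" "g \<in> carrier G" "a \<in> carrier G" "w \<in> words (Suc n)"
    by (auto simp: words_def length_Suc_conv)
  define y where "y = unit_fun (a, w)"
  have y: "y \<in> bar_module (Suc n)" using p by (simp add: y_def)
  have "unit_fun p = translate G g (bar_h y)"
    using p by (simp add: y_def bar_h_def translate_unit_fun)
  then have "bar_d (bar_d (unit_fun p)) = translate G g (bar_d (bar_d (bar_h y)))"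
    using p y by (simp add: bar_d_translate[of _ _ "Suc n"] bar_d_translate[of _ _ n] bar_h_closed bar_d_closed)
  also have "bar_d (bar_d (bar_h y)) = bar_d y - bar_d (bar_h (bar_d y))"
    using bar_d_h[OF y] lin_on_diff[OF lin_on_bar_d subspace_bar_module y] bar_h_closed[OF bar_d_closed[OF y]] by simp
  also have "\<dots> = 0" using key[OF y] by simp
  finally show "bar_d (bar_d (unit_fun p)) = 0"
    by (simp add: lin_on_zero[OF lin_on_translate fs.subspace_UNIV])
qed

lemma bar_d_d: "x \<in> bar_module (Suc (Suc n)) \<Longrightarrow> bar_d (bar_d x) = 0"
proof (induction n arbitrary: x)
  case (0 x)
  then show ?case
    by (rule bar_d_d_step[rotated]) (simp add: bar_d_h_0[OF bar_d_closed] bar_eps_d zero_fun_apply)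
next
  case (Suc n x)
  then show ?case
    by (intro bar_d_d_step[OF _ Suc.prems]) (simp add: bar_d_h[OF bar_d_closed])
qed

lemma bar_resolution: "group_resolution G bar_module (\<lambda>_. bar_d) bar_eps bar_gen"
proof unfold_locales
  fix n
  show "translation_hom G (bar_module (Suc n)) (bar_module n) bar_d"
    by (auto simp: translation_hom_def bar_d_closed lin_on_bar_d bar_d_translate)
  show "{x \<in> bar_module (Suc n). bar_d x = 0} = bar_d ` bar_module (Suc (Suc n))"
  proof (intro equalityI subsetI)
    fix x assume "x \<in> {x \<in> bar_module (Suc n). bar_d x = 0}"
    then have "x = bar_d (bar_h x)" "bar_h x \<in> bar_module (Suc (Suc n))"
      using bar_d_h[of x n] bar_h_closed by auto
    then show "x \<in> bar_d ` bar_module (Suc (Suc n))" by blast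
  qed (auto simp: bar_d_d bar_d_closed)
  show "bar_gen n w \<in> bar_module n" for w
    by (auto simp: bar_gen_def fs.subspace_0 subspace_bar_module)
  fix x assume x: "x \<in> bar_module n"
  have "lext (\<lambda>(g, w). translate G g (bar_gen n w)) x = lext unit_fun x"
    using x by (intro lext_cong) (auto simp: bar_module_def fin_supp_on_def bar_gen_def translate_unit_fun)
  then show "lext (\<lambda>(g, w). translate G g (bar_gen n w)) x = x"
    using x by (simp add: lext_id bar_module_def fin_supp_on_def)
next
  show "{x \<in> bar_module 0. bar_eps x = 0} = bar_d ` bar_module (Suc 0)"
  proof (intro equalityI subsetI)
    fix x assume "x \<in> {x \<in> bar_module 0. bar_eps x = 0}"
    then have "x = bar_d (bar_h x)" "bar_h x \<in> bar_module (Suc 0)"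
      using bar_d_h_0[of x] bar_h_closed by (auto simp: zero_fun_apply)
    then show "x \<in> bar_d ` bar_module (Suc 0)" by blast
  qed (auto simp: bar_eps_d bar_d_closed)
  show "bar_eps ` bar_module 0 = UNIV"
  proof -
    have "z = bar_eps (z () \<cdot> unit_fun (\<one>, []))" "z () \<cdot> unit_fun (\<one>, []) \<in> bar_module 0" for z
      using lin_on_scale[OF lin_on_bar_eps[of 0], of "unit_fun (\<one>, [])" "z ()"]
      by (auto simp: words_def bar_eps_def fun_eq_iff pointwise intro!: fs.subspace_scale subspace_bar_module)
    then show ?thesis by blast
  qed
qed (auto simp: bar_module_sub[THEN subsetD] subspace_bar_module translate_bar_module lin_on_bar_eps bar_eps_translate)

section \<open>Coinvariants of the bar resolution as bar chains\<close>

lemma carrier_bar_chains: "carrier (bar_chains G complex_line n) = fin_supp_on (words n)"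
  by (auto simp: bar_chains_def complex_line_def fin_supp_on_def supp_def words_def)

lemma coinv_bar_module: "coinv ` bar_module n = fin_supp_on (words n)"
proof (intro equalityI subsetI)
  fix c assume c: "c \<in> fin_supp_on (words n)"
  have "lext (\<lambda>w. unit_fun (\<one>, w)) c \<in> bar_module n"
    using c by (intro lext_in subspace_bar_module) (auto simp: fin_supp_on_def)
  moreover have "coinv (lext (\<lambda>w. unit_fun (\<one>, w)) c) = c"
    using c unfolding coinv_def by (subst lext_lext) (auto simp: fin_supp_on_def lext_id)
  ultimately show "c \<in> coinv ` bar_module n" by force
qed (use bar_moduleD in \<open>fastforce simp: coinv_def intro!: lext_fin_supp_on\<close>)

lemma bar_boundary_complex_line:
  assumes "c \<in> fin_supp_on (words (Suc n))"
  shows "bar_boundary G complex_line (\<lambda>z g. z) (Suc n) c =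
    lext (\<lambda>w. \<Sum>i\<le>Suc n. (-1) ^ i \<cdot> unit_fun (bar_face G i w)) c"
proof
  fix v
  have z: "\<zero>\<^bsub>complex_line\<^esub> = 0" by (simp add: complex_line_def)
  have fin: "finite {w. c w \<noteq> 0}" using assms by (simp add: fin_supp_on_def supp_def)
  show "bar_boundary G complex_line (\<lambda>z g. z) (Suc n) c v =
    lext (\<lambda>w. \<Sum>i\<le>Suc n. (-1) ^ i \<cdot> unit_fun (bar_face G i w)) c v"
    unfolding bar_boundary_def z finsum_complex_line[OF fin] finsum_complex_line[OF finite_atMost]
      lext_def supp_def sum_fun_apply cscale_apply sum_distrib_left
    by (auto intro!: sum.cong simp: bar_coeff_def a_inv_complex_line unit_fun_def)
qed

text \<open>Under \<open>coinv\<close> the group element at face 0 is forgotten, which is the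
  trivial action on \<complex>. The complex defining group homology is therefore the complex of
  coinvariants of the bar resolution.\<close>

lemma coinv_bar_d:
  assumes "x \<in> bar_module (Suc n)"
  shows "coinv (bar_d x) = bar_boundary G complex_line (\<lambda>z g. z) (Suc n) (coinv x)"
proof -
  let ?b = "\<lambda>w. \<Sum>i\<le>Suc n. (-1) ^ i \<cdot> unit_fun (bar_face G i w)"
  have x: "\<And>g w. (g, w) \<in> supp x \<Longrightarrow> g \<in> carrier G \<and> w \<in> words (Suc n)" "finite (supp x)"
    using assms by (auto simp: bar_module_def fin_supp_on_def)
  have "coinv (bar_d x) = lext (\<lambda>p. coinv (case p of (g, w) \<Rightarrow> translate G g (bar_simplex w))) x"
    unfolding bar_d_def
    using x translate_bar_module[OF _ bar_simplex_closed]
    by (intro lin_on_lext_apply[OF lin_on_coinv[OF bar_module_sub[of n]] subspace_bar_module[of n]]) auto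
  also have "\<dots> = lext (\<lambda>p. lext ?b (case p of (g, w) \<Rightarrow> unit_fun w)) x"
  proof (intro lext_cong, clarify)
    fix g w assume gw: "(g, w) \<in> supp x"
    have w: "length w = Suc n" "w \<in> words (Suc n)" "g \<in> carrier G" using x(1)[OF gw] by (auto simp: words_def)
    have "coinv (translate G g (bar_simplex w)) = coinv (bar_simplex w)"
      using w bar_simplex_closed bar_module_sub by (intro coinv_translate) blast+
    also have "\<dots> = ?b w"
      unfolding bar_simplex_def w(1) coinv_def
      by (subst lin_on_sum[OF lin_on_lext[of UNIV] subspace_fin_supp_on])
        (simp_all add: lin_on_scale[OF lin_on_lext[of UNIV]] fs.subspace_scale[OF subspace_fin_supp_on])
    finally show "coinv (translate G g (bar_simplex w)) = lext ?b (unit_fun w)" by simp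
  qed
  also have "\<dots> = lext ?b (coinv x)"
    unfolding coinv_def using x by (intro lext_lext[symmetric]) auto
  also have "\<dots> = bar_boundary G complex_line (\<lambda>z g. z) (Suc n) (coinv x)"
    using assms coinv_bar_module by (subst bar_boundary_complex_line) auto
  finally show ?thesis .
qed

lemma coinv_bar_cycles:
  "coinv ` cycles bar_module (\<lambda>_. bar_d) n = bar_cycles G complex_line (\<lambda>z g. z) n"
proof (cases n)
  case 0
  then show ?thesis
    by (auto simp: cycles_def coinv_bar_module bar_cycles_def carrier_bar_chains bar_boundary_def complex_line_simps)
next
  case (Suc m)
  have "bar_cycles G complex_line (\<lambda>z g. z) n =
    {c \<in> coinv ` bar_module (Suc m). bar_boundary G complex_line (\<lambda>z g. z) (Suc m) c = 0}"
    by (auto simp: bar_cycles_def carrier_bar_chains coinv_bar_module Suc complex_line_simps zero_fun_def)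
  also have "\<dots> = coinv ` {x \<in> bar_module (Suc m). coinv (bar_d x) = 0}"
    by (auto simp: coinv_bar_d)
  finally show ?thesis by (simp add: Suc cycles_def)
qed

lemma coinv_bar_boundaries:
  "coinv ` bar_d ` bar_module (Suc n) =
   bar_boundary G complex_line (\<lambda>z g. z) (Suc n) ` carrier (bar_chains G complex_line (Suc n))"
  by (force simp: carrier_bar_chains coinv_bar_d image_image simp flip: coinv_bar_module)

end

section \<open>Resolutions by finitely generated projective modules\<close>

lemma mod_homD:
  assumes "f \<in> mod_hom R M N"
  shows "x \<in> carrier M \<Longrightarrow> f x \<in> carrier N"
    and "x \<in> carrier M \<Longrightarrow> y \<in> carrier M \<Longrightarrow> f (x \<oplus>\<^bsub>M\<^esub> y) = f x \<oplus>\<^bsub>N\<^esub> f y"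
    and "a \<in> carrier R \<Longrightarrow> x \<in> carrier M \<Longrightarrow> f (a \<odot>\<^bsub>M\<^esub> x) = a \<odot>\<^bsub>N\<^esub> f x"
  using assms by (auto simp: mod_hom_def)

lemma free_module_simps:
  "v \<in> carrier (free_module R n) \<longleftrightarrow> (\<forall>i<n. v i \<in> carrier R) \<and> (\<forall>i\<ge>n. v i = \<zero>\<^bsub>R\<^esub>)"
  "v \<oplus>\<^bsub>free_module R n\<^esub> w = (\<lambda>i. v i \<oplus>\<^bsub>R\<^esub> w i)"
  "a \<odot>\<^bsub>free_module R n\<^esub> v = (\<lambda>i. a \<otimes>\<^bsub>R\<^esub> v i)"
  by (auto simp: free_module_def)

lemma matrix_module_simps:
  "carrier (matrix_module R n A) = row_mult R n A ` carrier (free_module R n)"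
  "v \<oplus>\<^bsub>matrix_module R n A\<^esub> w = (\<lambda>i. v i \<oplus>\<^bsub>R\<^esub> w i)"
  "a \<odot>\<^bsub>matrix_module R n A\<^esub> v = (\<lambda>i. a \<otimes>\<^bsub>R\<^esub> v i)"
  by (auto simp: matrix_module_def free_module_def)

text \<open>Over a noncommutative ring, linear maps of left modules act on row vectors by matrices
  on the right; the rows are the images of the unit vectors.\<close>

lemma (in ring) free_module_hom_eq_row_mult:
  assumes h: "h \<in> mod_hom R (free_module R n) (free_module R n)"
    and v: "v \<in> carrier (free_module R n)"
  shows "h v = row_mult R n (\<lambda>i. h (\<lambda>j. if j = i then \<one> else \<zero>)) v"
proof
  fix j
  define e where "e i = (\<lambda>j. if j = i then \<one> else \<zero>)" for i :: nat
  \<comment> \<open>Truncations of v: passing from \<open>t k\<close> to \<open>t (Suc k)\<close>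
    adds one multiple of a unit vector, so additivity of h yields the sum by induction.\<close>
  define t where "t k = (\<lambda>i. if i < k then v i else \<zero>)" for k
  have v_cl: "v i \<in> carrier R" for i using v by (cases "i < n") (auto simp: free_module_simps)
  have e_cl: "e i \<in> carrier (free_module R n)" if "i < n" for i
    using that by (auto simp: free_module_simps e_def)
  have t_cl: "t k \<in> carrier (free_module R n)" if "k \<le> n" for k
    using that v_cl by (auto simp: free_module_simps t_def)
  have h_cl: "h w j \<in> carrier R" if "w \<in> carrier (free_module R n)" for w j
    using mod_homD(1)[OF h that] by (cases "j < n") (auto simp: free_module_simps)
  have "h (t k) j = (\<Oplus>i\<in>{..<k}. v i \<otimes> h (e i) j)" if "k \<le> n" for k
    using that
  proof (induction k)
    case 0
    have "t 0 = \<zero> \<odot>\<^bsub>free_module R n\<^esub> t 0" by (simp add: free_module_simps t_def)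
    then have "h (t 0) = \<zero> \<odot>\<^bsub>free_module R n\<^esub> h (t 0)"
      using mod_homD(3)[OF h zero_closed t_cl[of 0]] by simp
    then have "h (t 0) j = \<zero> \<otimes> h (t 0) j" by (metis free_module_simps(3))
    then show ?case using h_cl[OF t_cl[of 0]] by simp
  next
    case (Suc k)
    have sm: "v k \<odot>\<^bsub>free_module R n\<^esub> e k \<in> carrier (free_module R n)"
      using v_cl e_cl[of k] Suc.prems by (auto simp: free_module_simps e_def)
    have "t (Suc k) = t k \<oplus>\<^bsub>free_module R n\<^esub> (v k \<odot>\<^bsub>free_module R n\<^esub> e k)"
      using v_cl by (auto simp: free_module_simps t_def e_def fun_eq_iff less_Suc_eq)
    then have "h (t (Suc k)) = h (t k) \<oplus>\<^bsub>free_module R n\<^esub> (v k \<odot>\<^bsub>free_module R n\<^esub> h (e k))"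
      using mod_homD(2)[OF h t_cl sm] mod_homD(3)[OF h v_cl e_cl] Suc.prems by simp
    then have "h (t (Suc k)) j = h (t k) j \<oplus> v k \<otimes> h (e k) j"
      by (simp add: free_module_simps)
    also have "\<dots> = (\<Oplus>i\<in>{..<k}. v i \<otimes> h (e i) j) \<oplus> v k \<otimes> h (e k) j"
      using Suc by simp
    also have "\<dots> = (\<Oplus>i\<in>{..<Suc k}. v i \<otimes> h (e i) j)"
      unfolding lessThan_Suc using v_cl h_cl e_cl Suc.prems
      by (subst finsum_insert) (auto intro!: a_comm finsum_closed)
    finally show ?case .
  qed
  moreover have "t n = v" using v by (auto simp: t_def free_module_simps fun_eq_iff)
  ultimately have "h v j = (\<Oplus>i\<in>{..<n}. v i \<otimes> h (e i) j)" by auto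
  then show "h v j = row_mult R n (\<lambda>i. h (\<lambda>j. if j = i then \<one> else \<zero>)) v j"
    using mod_homD(1)[OF h v] by (auto simp: row_mult_def e_def free_module_simps)
qed

text \<open>If P is a retract of a free module through f and g, the composite of g followed by f is
  an idempotent endomorphism. Its matrix A is idempotent, and f identifies P with the image of A.
  This makes the choice in \<open>matrix_presentation\<close> meaningful.\<close>

lemma fg_projective_presentation:
  assumes "fg_projective R P"
  shows "\<exists>n A. idempotent_matrix R n A \<and> mod_isomorphic R P (matrix_module R n A)"
proof -
  interpret P: left_module R P using assms by (simp add: fg_projective_def)
  obtain n f g where f: "f \<in> mod_hom R P (free_module R n)" and g: "g \<in> mod_hom R (free_module R n) P"
    and gf: "\<And>x. x \<in> carrier P \<Longrightarrow> g (f x) = x"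
    using assms by (auto simp: fg_projective_def)
  define h where "h v = f (g v)" for v
  define A where "A i = h (\<lambda>j. if j = i then \<one>\<^bsub>R\<^esub> else \<zero>\<^bsub>R\<^esub>)" for i :: nat
  have h: "h \<in> mod_hom R (free_module R n) (free_module R n)"
    using f g unfolding h_def by (auto simp: mod_hom_def Pi_iff)
  have hv: "h v = row_mult R n A v" if "v \<in> carrier (free_module R n)" for v
    unfolding A_def by (rule P.R.free_module_hom_eq_row_mult[OF h that])
  have hh: "h (h v) = h v" if "v \<in> carrier (free_module R n)" for v
    unfolding h_def using gf[OF mod_homD(1)[OF g that]] by simp
  have A: "A i \<in> carrier (free_module R n)" "row_mult R n A (A i) = A i" if "i < n" for i
  proof -
    have e: "(\<lambda>j. if j = i then \<one>\<^bsub>R\<^esub> else \<zero>\<^bsub>R\<^esub>) \<in> carrier (free_module R n)"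
      using that by (auto simp: free_module_simps)
    show Ai: "A i \<in> carrier (free_module R n)" unfolding A_def by (rule mod_homD(1)[OF h e])
    show "row_mult R n A (A i) = A i" using hv[OF Ai] hh[OF e] by (simp add: A_def)
  qed
  have "idempotent_matrix R n A"
    unfolding idempotent_matrix_def
  proof (intro conjI allI impI)
    fix i k assume "i < n" "k < n"
    then show "(\<Oplus>\<^bsub>R\<^esub>j\<in>{..<n}. A i j \<otimes>\<^bsub>R\<^esub> A j k) = A i k"
      using fun_cong[OF A(2)[of i], of k] by (simp add: row_mult_def)
  qed (use A(1) in \<open>auto simp: free_module_simps\<close>)
  moreover have "f \<in> mod_hom R P (matrix_module R n A)"
  proof -
    have "f x \<in> row_mult R n A ` carrier (free_module R n)" if "x \<in> carrier P" for x
      using hv[OF mod_homD(1)[OF f that]] gf[OF that] mod_homD(1)[OF f that] by (auto simp: h_def)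
    then show ?thesis using f by (auto simp: mod_hom_def matrix_module_simps free_module_simps)
  qed
  moreover have "bij_betw f (carrier P) (carrier (matrix_module R n A))"
  proof (rule bij_betwI[where g = g])
    show "f \<in> carrier P \<rightarrow> carrier (matrix_module R n A)"
      using \<open>f \<in> mod_hom R P (matrix_module R n A)\<close> by (auto simp: mod_hom_def)
    show "f (g y) = y" if "y \<in> carrier (matrix_module R n A)" for y
      using that hh by (auto simp: matrix_module_simps h_def[symmetric] simp flip: hv)
    show "g \<in> carrier (matrix_module R n A) \<rightarrow> carrier P"
      using mod_homD(1)[OF g] mod_homD(1)[OF h] by (auto simp: matrix_module_simps simp flip: hv)
  qed (use gf in auto)
  ultimately show ?thesis unfolding mod_isomorphic_def by blast
qed

lemma matrix_presentationD:
  assumes "fg_projective R P" "matrix_presentation R P = (n, A)"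
  shows "idempotent_matrix R n A" "mod_isomorphic R P (matrix_module R n A)"
proof -
  have "case matrix_presentation R P of (n, A) \<Rightarrow>
      idempotent_matrix R n A \<and> mod_isomorphic R P (matrix_module R n A)"
    unfolding matrix_presentation_def
    by (rule someI_ex) (use fg_projective_presentation[OF assms(1)] in auto)
  then show "idempotent_matrix R n A" "mod_isomorphic R P (matrix_module R n A)"
    using assms(2) by auto
qed

section \<open>The group ring and idempotent matrices over it\<close>

lemma carrier_group_ring: "carrier (group_ring G) = fin_supp_on (carrier G)"
  by (auto simp: group_ring_def fin_supp_on_def supp_def)

lemma group_ring_simps:
  "\<zero>\<^bsub>group_ring G\<^esub> = 0" "a \<oplus>\<^bsub>group_ring G\<^esub> b = a + b"
  "\<one>\<^bsub>group_ring G\<^esub> = unit_fun \<one>\<^bsub>G\<^esub>"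
  by (auto simp: group_ring_def fun_eq_iff pointwise unit_fun_def)

lemma group_ring_mult:
  "(a \<otimes>\<^bsub>group_ring G\<^esub> b) x = (if x \<in> carrier G then \<Sum>y\<in>supp a. a y * b (inv\<^bsub>G\<^esub> y \<otimes>\<^bsub>G\<^esub> x) else 0)"
  by (simp add: group_ring_def supp_def)

lemma group_ring_monomial_mult:
  "((c \<cdot> unit_fun g) \<otimes>\<^bsub>group_ring G\<^esub> b) x = (if x \<in> carrier G then c * b (inv\<^bsub>G\<^esub> g \<otimes>\<^bsub>G\<^esub> x) else 0)"
proof -
  have "supp (c \<cdot> unit_fun g) = (if c = 0 then {} else {g})"
    by (auto simp: supp_def pointwise unit_fun_def)
  then show ?thesis by (simp add: group_ring_mult pointwise)
qed

lemma monomial_in_group_ring: "g \<in> carrier G \<Longrightarrow> c \<cdot> unit_fun g \<in> carrier (group_ring G)"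
  by (simp add: carrier_group_ring fs.subspace_scale subspace_fin_supp_on)

lemma finsum_group_ring:
  assumes "ring (group_ring G)" "finite A" "f \<in> A \<rightarrow> carrier (group_ring G)"
  shows "finsum (group_ring G) f A = sum f A"
proof -
  interpret R: ring "group_ring G" by (rule assms(1))
  show ?thesis using assms(2,3)
  proof (induction A rule: finite_induct)
    case (insert x F)
    then show ?case by (subst R.finsum_insert) (auto simp: group_ring_simps)
  qed (simp add: group_ring_simps)
qed

definition swap_uncurry :: "('j \<Rightarrow> 'a \<Rightarrow> complex) \<Rightarrow> 'a \<times> 'j \<Rightarrow> complex"
  where "swap_uncurry v = (\<lambda>(g, j). v j g)"

lemma swap_uncurry_apply: "swap_uncurry v (g, j) = v j g"
  by (simp add: swap_uncurry_def)

lemma inj_swap_uncurry: "inj swap_uncurry"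
  by (auto simp: inj_def swap_uncurry_def fun_eq_iff)

text \<open>Row j of A as a function on pairs. Entries outside the n by n block are arbitrary in
  \<open>idempotent_matrix\<close>, hence the cut-off, which also provides a generator for every
  natural number.\<close>

definition matrix_gen :: "('a, 'b) monoid_scheme \<Rightarrow> nat \<Rightarrow> (nat \<Rightarrow> nat \<Rightarrow> 'a \<Rightarrow> complex) \<Rightarrow> nat \<Rightarrow> 'a \<times> nat \<Rightarrow> complex"
  where "matrix_gen G n A j = swap_uncurry (\<lambda>k. if j < n \<and> k < n then A j k else 0)"

lemma swap_uncurry_free_module:
  assumes "v \<in> carrier (free_module (group_ring G) n)"
  shows "swap_uncurry v \<in> fin_supp_on (carrier G \<times> {..<n})"
proof -
  have v: "\<And>i. i < n \<Longrightarrow> v i \<in> fin_supp_on (carrier G)" "\<And>i. i \<ge> n \<Longrightarrow> v i = 0"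
    using assms by (auto simp: free_module_simps carrier_group_ring group_ring_simps)
  have sub: "supp (swap_uncurry v) \<subseteq> (\<Union>i<n. supp (v i) \<times> {i})"
  proof
    fix p assume p: "p \<in> supp (swap_uncurry v)"
    obtain g j where gj: "p = (g, j)" by (cases p)
    with p have "v j g \<noteq> 0" by (simp add: supp_def swap_uncurry_apply)
    moreover from this have "j < n" by (rule_tac ccontr) (use v(2)[of j] in \<open>auto simp: zero_fun_apply\<close>)
    ultimately show "p \<in> (\<Union>i<n. supp (v i) \<times> {i})" using gj by (auto simp: supp_def)
  qed
  moreover have "finite (\<Union>i<n. supp (v i) \<times> {i})"
    using v(1) by (auto dest: fin_supp_onD)
  moreover have "(\<Union>i<n. supp (v i) \<times> {i}) \<subseteq> carrier G \<times> {..<n}"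
    using v(1) by (auto simp: fin_supp_on_def)
  ultimately show ?thesis unfolding fin_supp_on_def by (blast intro: finite_subset)
qed

text \<open>The ring property is part of \<open>left_module\<close>; it is obtained from the modules
  of the given resolution.\<close>

locale group_ring_matrix = group G for G :: "('a, 'b) monoid_scheme" (structure) +
  fixes n :: nat and A :: "nat \<Rightarrow> nat \<Rightarrow> 'a \<Rightarrow> complex"
  assumes ring_group_ring: "ring (group_ring G)"
    and idem: "idempotent_matrix (group_ring G) n A"
begin

interpretation R: ring "group_ring G" by (rule ring_group_ring)

definition proj_space :: "('a \<times> nat \<Rightarrow> complex) set"
  where "proj_space = swap_uncurry ` carrier (matrix_module (group_ring G) n A)"

definition row_map :: "('a \<times> nat \<Rightarrow> complex) \<Rightarrow> 'a \<times> nat \<Rightarrow> complex"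
  where "row_map = lext (\<lambda>(g, j). translate G g (matrix_gen G n A j))"

lemma A_closed: "i < n \<Longrightarrow> j < n \<Longrightarrow> A i j \<in> fin_supp_on (carrier G)"
  using idem by (simp add: idempotent_matrix_def carrier_group_ring)

lemma row_mult_closed:
  assumes "v \<in> carrier (free_module (group_ring G) n)"
  shows "row_mult (group_ring G) n A v \<in> carrier (free_module (group_ring G) n)"
  using assms idem
  by (auto simp: free_module_simps row_mult_def idempotent_matrix_def intro!: R.finsum_closed)

lemma row_in_free_module: "j < n \<Longrightarrow> (\<lambda>k. if k < n then A j k else 0) \<in> carrier (free_module (group_ring G) n)"
  by (auto simp: free_module_simps group_ring_simps carrier_group_ring A_closed)

lemma row_mult_row:
  assumes "j < n"
  shows "row_mult (group_ring G) n A (\<lambda>k. if k < n then A j k else 0) = (\<lambda>k. if k < n then A j k else 0)"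
proof
  fix k
  have "(\<Oplus>\<^bsub>group_ring G\<^esub>i\<in>{..<n}. (if i < n then A j i else 0) \<otimes>\<^bsub>group_ring G\<^esub> A i k) =
    (\<Oplus>\<^bsub>group_ring G\<^esub>i\<in>{..<n}. A j i \<otimes>\<^bsub>group_ring G\<^esub> A i k)" if "k < n"
    using assms that idem by (intro R.finsum_cong') (auto simp: idempotent_matrix_def)
  then show "row_mult (group_ring G) n A (\<lambda>k. if k < n then A j k else 0) k = (if k < n then A j k else 0)"
    using assms idem by (auto simp: row_mult_def idempotent_matrix_def group_ring_simps)
qed

lemma matrix_gen_grp_funs: "matrix_gen G n A j \<in> grp_funs G"
proof (cases "j < n")
  case True
  then show ?thesis
    using swap_uncurry_free_module[OF row_in_free_module[OF True]] fin_supp_on_mono[of "carrier G \<times> {..<n}" "carrier G \<times> UNIV"]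
    by (auto simp: matrix_gen_def)
next
  case False
  then have "matrix_gen G n A j = 0" by (auto simp: matrix_gen_def swap_uncurry_def fun_eq_iff pointwise)
  then show ?thesis by (simp add: fs.subspace_0 subspace_fin_supp_on)
qed

text \<open>Convolution evaluates \<open>A j k\<close> at g inverse times h, which is the value at
  (h, k) of row j translated by g. Multiplication by A is thus the linear extension of translated
  rows.\<close>

lemma swap_uncurry_row_mult:
  assumes v: "v \<in> carrier (free_module (group_ring G) n)"
  shows "swap_uncurry (row_mult (group_ring G) n A v) = row_map (swap_uncurry v)"
proof
  fix p :: "'a \<times> nat"
  obtain h k where p: "p = (h, k)" by (cases p)
  let ?x = "swap_uncurry v"
  have x: "finite (supp ?x)" "supp ?x \<subseteq> carrier G \<times> {..<n}"
    using swap_uncurry_free_module[OF v] by (auto simp: fin_supp_on_def)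
  have vn: "j < n" if "v j g \<noteq> 0" for g j
    using x(2) that by (auto simp: supp_def swap_uncurry_apply dest!: subsetD[of _ _ "(g, j)"])
  have vf: "finite (supp (v j))" if "j < n" for j
    using v that by (auto simp: free_module_simps carrier_group_ring dest: fin_supp_onD)
  have rm: "row_map ?x (h, k) = (\<Sum>(g, j)\<in>supp ?x. v j g * translate G g (matrix_gen G n A j) (h, k))"
    by (simp add: row_map_def lext_def pointwise swap_uncurry_def case_prod_unfold)
  show "swap_uncurry (row_mult (group_ring G) n A v) p = row_map ?x p"
  proof (cases "k < n \<and> h \<in> carrier G")
    case True
    have "swap_uncurry (row_mult (group_ring G) n A v) p = (\<Oplus>\<^bsub>group_ring G\<^esub>j\<in>{..<n}. v j \<otimes>\<^bsub>group_ring G\<^esub> A j k) h"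
      using True by (simp add: p swap_uncurry_apply row_mult_def)
    also have "\<dots> = (\<Sum>j<n. (v j \<otimes>\<^bsub>group_ring G\<^esub> A j k) h)"
      using v True idem
      by (subst finsum_group_ring[OF ring_group_ring]) (auto simp: pointwise free_module_simps idempotent_matrix_def)
    also have "\<dots> = (\<Sum>j<n. \<Sum>g\<in>supp (v j). v j g * A j k (inv g \<otimes> h))"
      using True by (simp add: group_ring_mult)
    also have "\<dots> = (\<Sum>(j, g)\<in>(SIGMA j:{..<n}. supp (v j)). v j g * A j k (inv g \<otimes> h))"
      using vf by (subst sum.Sigma) auto
    also have "\<dots> = (\<Sum>(g, j)\<in>supp ?x. v j g * A j k (inv g \<otimes> h))"
      using x(2) by (intro sum.reindex_bij_witness[of _ prod.swap prod.swap])
        (auto simp: supp_def swap_uncurry_apply intro: vn)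
    also have "\<dots> = row_map ?x p"
      unfolding p rm using True x(2)
      by (intro sum.cong) (auto simp: translate_def matrix_gen_def swap_uncurry_apply)
    finally show ?thesis .
  next
    case False
    have "row_map ?x p = 0"
      unfolding p rm using False
      by (intro sum.neutral) (auto simp: translate_def matrix_gen_def swap_uncurry_apply pointwise)
    moreover have "swap_uncurry (row_mult (group_ring G) n A v) p = 0"
    proof (cases "k < n")
      case True
      then have "row_mult (group_ring G) n A v k \<in> fin_supp_on (carrier G)"
        using row_mult_closed[OF v] by (simp add: free_module_simps carrier_group_ring)
      then show ?thesis using False True by (auto simp: p swap_uncurry_apply fin_supp_on_def supp_def)
    qed (simp add: p swap_uncurry_apply row_mult_def group_ring_simps pointwise)
    ultimately show ?thesis by simp
  qed
qed

lemma row_map_gen: "row_map (matrix_gen G n A j) = matrix_gen G n A j"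
proof (cases "j < n")
  case True
  then show ?thesis
    using swap_uncurry_row_mult[OF row_in_free_module[OF True]] row_mult_row[OF True]
    by (simp add: matrix_gen_def)
next
  case False
  then have "matrix_gen G n A j = 0" by (auto simp: matrix_gen_def swap_uncurry_def fun_eq_iff pointwise)
  then show ?thesis by (simp add: row_map_def)
qed

lemma row_map_translate:
  assumes "g \<in> carrier G" "x \<in> grp_funs G"
  shows "row_map (translate G g x) = translate G g (row_map x)"
proof -
  have "row_map (translate G g x) = lext (\<lambda>(h, j). translate G (g \<otimes> h) (matrix_gen G n A j)) x"
    unfolding row_map_def using assms by (subst lext_translate) auto
  also have "\<dots> = lext (\<lambda>p. translate G g (case p of (h, j) \<Rightarrow> translate G h (matrix_gen G n A j))) x"
    using assms fin_supp_onD(2)[OF assms(2)] by (intro lext_cong) (auto simp: translate_mult)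
  also have "\<dots> = translate G g (row_map x)"
    unfolding row_map_def
    by (rule lin_on_lext_apply[OF lin_on_translate[of UNIV] fs.subspace_UNIV, symmetric]) auto
  finally show ?thesis .
qed

text \<open>The image of \<open>row_map\<close> is spanned by translates of rows; these are fixed,
  since \<open>row_map\<close> is equivariant and fixes each row by idempotency.\<close>

lemma row_map_idem:
  assumes "x \<in> grp_funs G"
  shows "row_map (row_map x) = row_map x"
proof -
  have x: "\<And>g j. (g, j) \<in> supp x \<Longrightarrow> g \<in> carrier G" using fin_supp_onD(2)[OF assms] by blast
  define u where "u = (\<lambda>(g, j). translate G g (matrix_gen G n A j))"
  have u: "u p \<in> grp_funs G" "row_map (u p) = u p" if "p \<in> supp x" for p
    using x that matrix_gen_grp_funs
    by (auto simp: u_def translate_closed row_map_translate row_map_gen split: prod.splits)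
  have "row_map (row_map x) = row_map (lext u x)" by (simp add: row_map_def u_def)
  also have "\<dots> = lext (\<lambda>p. row_map (u p)) x"
    using u(1) by (intro lin_on_lext_apply[OF _ subspace_fin_supp_on]) (auto simp: row_map_def lin_on_lext)
  also have "\<dots> = lext u x" using u(2) by (intro lext_cong)
  also have "\<dots> = row_map x" by (simp add: row_map_def u_def)
  finally show ?thesis .
qed

lemma proj_space_sub: "proj_space \<subseteq> fin_supp_on (carrier G \<times> {..<n})"
  using swap_uncurry_free_module[OF row_mult_closed] by (auto simp: proj_space_def matrix_module_simps)

lemma proj_space_grp_funs: "proj_space \<subseteq> grp_funs G"
  using proj_space_sub fin_supp_on_mono[of "carrier G \<times> {..<n}" "carrier G \<times> UNIV"] by auto

lemma proj_space_expand:
  assumes "x \<in> proj_space"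
  shows "lext (\<lambda>(g, j). translate G g (matrix_gen G n A j)) x = x"
proof -
  obtain v where v: "v \<in> carrier (free_module (group_ring G) n)" "x = row_map (swap_uncurry v)"
    using assms by (auto simp: proj_space_def matrix_module_simps swap_uncurry_row_mult)
  have "swap_uncurry v \<in> grp_funs G"
    using swap_uncurry_free_module[OF v(1)] fin_supp_on_mono[of "carrier G \<times> {..<n}" "carrier G \<times> UNIV"] by auto
  from row_map_idem[OF this] show ?thesis by (simp add: v(2) row_map_def)
qed

lemma matrix_gen_proj_space:
  assumes "j < n" shows "matrix_gen G n A j \<in> proj_space"
proof -
  have "(\<lambda>k. if k < n then A j k else 0) \<in> carrier (matrix_module (group_ring G) n A)"
    unfolding matrix_module_simps using row_mult_row[OF assms] row_in_free_module[OF assms]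
    by (metis (no_types, lifting) imageI)
  then show ?thesis using assms by (auto simp: proj_space_def matrix_gen_def)
qed

end

section \<open>Transport of the given resolution to function spaces\<close>

context group_ring_matrix
begin

text \<open>Compatibility is recorded for monomials only. They contain both structures used on
  function spaces: complex scalars, as multiples of the identity element, and translations, with
  coefficient 1.\<close>

lemma module_iso_proj_space:
  fixes P :: "('a \<Rightarrow> complex, 'p, 'y) module_scheme"
  assumes iso: "mod_isomorphic (group_ring G) P (matrix_module (group_ring G) n A)"
  obtains \<Psi> where "bij_betw \<Psi> (carrier P) proj_space"
    "\<And>p q. p \<in> carrier P \<Longrightarrow> q \<in> carrier P \<Longrightarrow> \<Psi> (p \<oplus>\<^bsub>P\<^esub> q) = \<Psi> p + \<Psi> q"
    "\<And>c g p. g \<in> carrier G \<Longrightarrow> p \<in> carrier P \<Longrightarrow>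
      \<Psi> ((c \<cdot> unit_fun g) \<odot>\<^bsub>P\<^esub> p) = c \<cdot> translate G g (\<Psi> p)"
proof -
  obtain \<psi> where \<psi>: "\<psi> \<in> mod_hom (group_ring G) P (matrix_module (group_ring G) n A)"
    "bij_betw \<psi> (carrier P) (carrier (matrix_module (group_ring G) n A))"
    using iso by (auto simp: mod_isomorphic_def)
  show thesis
  proof
    show "bij_betw (swap_uncurry \<circ> \<psi>) (carrier P) proj_space"
      unfolding proj_space_def
      by (rule bij_betw_trans[OF \<psi>(2)]) (auto intro: inj_on_imp_bij_betw inj_on_subset[OF inj_swap_uncurry])
    show "(swap_uncurry \<circ> \<psi>) (p \<oplus>\<^bsub>P\<^esub> q) = (swap_uncurry \<circ> \<psi>) p + (swap_uncurry \<circ> \<psi>) q"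
      if "p \<in> carrier P" "q \<in> carrier P" for p q
      using mod_homD(2)[OF \<psi>(1) that]
      by (auto simp: matrix_module_simps swap_uncurry_def fun_eq_iff pointwise group_ring_simps)
    show "(swap_uncurry \<circ> \<psi>) ((c \<cdot> unit_fun g) \<odot>\<^bsub>P\<^esub> p) = c \<cdot> translate G g ((swap_uncurry \<circ> \<psi>) p)"
      if "g \<in> carrier G" "p \<in> carrier P" for c g p
      using mod_homD(3)[OF \<psi>(1) monomial_in_group_ring[OF that(1)] that(2), of c]
      by (auto simp: matrix_module_simps swap_uncurry_def fun_eq_iff pointwise group_ring_monomial_mult translate_def)
  qed
qed

end

text \<open>All maps are conjugated by the isomorphisms with the matrix modules. The generators are
  the rows of the selected matrices, which later ties the dimensions to the traces in E(G).\<close>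

theorem projective_resolution_grp_funs:
  fixes P :: "nat \<Rightarrow> ('a \<Rightarrow> complex, 'p) module"
  assumes "group G"
    and res: "fg_projective_resolution (group_ring G) (trivial_module G) N P d \<epsilon>"
    and pres: "\<And>i. matrix_presentation (group_ring G) (P i) = (m i, A i)"
  shows "\<exists>X D E. group_resolution G X D E (\<lambda>i. matrix_gen G (m i) (A i)) \<and>
    (\<forall>i. X i \<subseteq> fin_supp_on (carrier G \<times> {..<m i})) \<and> (\<forall>i>N. X i = {0})"
proof -
  interpret group G by (rule assms(1))
  have proj: "fg_projective (group_ring G) (P i)" for i
    using res by (simp add: fg_projective_resolution_def)
  then have lm: "left_module (group_ring G) (P i)" for i by (simp add: fg_projective_def)
  have ring: "ring (group_ring G)" using lm[of 0] by (simp add: left_module_def)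
  have grm: "group_ring_matrix G (m i) (A i)" for i
    by (intro group_ring_matrix.intro group_ring_matrix_axioms.intro group_axioms ring
        matrix_presentationD(1)[OF proj pres])
  define X where "X i = group_ring_matrix.proj_space G (m i) (A i)" for i
  have "\<exists>\<Psi>. bij_betw \<Psi> (carrier (P i)) (X i) \<and>
    (\<forall>p\<in>carrier (P i). \<forall>q\<in>carrier (P i). \<Psi> (p \<oplus>\<^bsub>P i\<^esub> q) = \<Psi> p + \<Psi> q) \<and>
    (\<forall>c. \<forall>g\<in>carrier G. \<forall>p\<in>carrier (P i). \<Psi> ((c \<cdot> unit_fun g) \<odot>\<^bsub>P i\<^esub> p) = c \<cdot> translate G g (\<Psi> p))" for i
    using group_ring_matrix.module_iso_proj_space[OF grm matrix_presentationD(2)[OF proj pres]]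
    unfolding X_def by metis
  then obtain \<Psi> where \<Psi>: "\<And>i. bij_betw (\<Psi> i) (carrier (P i)) (X i)"
    "\<And>i p q. p \<in> carrier (P i) \<Longrightarrow> q \<in> carrier (P i) \<Longrightarrow> \<Psi> i (p \<oplus>\<^bsub>P i\<^esub> q) = \<Psi> i p + \<Psi> i q"
    "\<And>i c g p. g \<in> carrier G \<Longrightarrow> p \<in> carrier (P i) \<Longrightarrow>
      \<Psi> i ((c \<cdot> unit_fun g) \<odot>\<^bsub>P i\<^esub> p) = c \<cdot> translate G g (\<Psi> i p)"
    by metis
  define \<theta> where "\<theta> i = inv_into (carrier (P i)) (\<Psi> i)" for i
  have \<theta>: "\<theta> i x \<in> carrier (P i)" "\<Psi> i (\<theta> i x) = x" if "x \<in> X i" for i x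
    using \<Psi>(1)[of i] that unfolding \<theta>_def bij_betw_def by (auto intro: inv_into_into f_inv_into_f)
  have \<theta>\<Psi>: "\<theta> i (\<Psi> i p) = p" if "p \<in> carrier (P i)" for i p
    using \<Psi>(1)[of i] that unfolding \<theta>_def bij_betw_def by simp
  have \<Psi>X: "\<Psi> i p \<in> X i" if "p \<in> carrier (P i)" for i p
    using \<Psi>(1)[of i] that by (auto simp: bij_betw_def)
  have add_cl: "p \<oplus>\<^bsub>P i\<^esub> q \<in> carrier (P i)" if "p \<in> carrier (P i)" "q \<in> carrier (P i)" for i p q
    using lm[of i] that by (simp add: left_module_def abelian_group_def abelian_monoid.a_closed)
  have zero_cl: "\<zero>\<^bsub>P i\<^esub> \<in> carrier (P i)" for i
    using lm[of i] by (simp add: left_module_def abelian_group_def abelian_monoid.zero_closed)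
  have smult_cl: "(c \<cdot> unit_fun g) \<odot>\<^bsub>P i\<^esub> p \<in> carrier (P i)" if "g \<in> carrier G" "p \<in> carrier (P i)" for c g i p
    using left_module.smult_closed[OF lm monomial_in_group_ring[OF that(1)] that(2)] .
  have X_grp: "X i \<subseteq> grp_funs G" for i
    unfolding X_def by (rule group_ring_matrix.proj_space_grp_funs[OF grm])
  have \<Psi>_scale: "\<Psi> i ((c \<cdot> unit_fun \<one>\<^bsub>G\<^esub>) \<odot>\<^bsub>P i\<^esub> p) = c \<cdot> \<Psi> i p" if "p \<in> carrier (P i)" for i c p
    using \<Psi>(3)[OF one_closed that] translate_one \<Psi>X[OF that] X_grp by (metis subsetD)
  have \<Psi>_translate: "\<Psi> i ((1 \<cdot> unit_fun g) \<odot>\<^bsub>P i\<^esub> p) = translate G g (\<Psi> i p)"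
    if "g \<in> carrier G" "p \<in> carrier (P i)" for i g p
    using \<Psi>(3)[OF that, of 1] by simp
  have \<Psi>_zero: "\<Psi> i \<zero>\<^bsub>P i\<^esub> = 0" for i
  proof -
    have "\<zero>\<^bsub>P i\<^esub> \<oplus>\<^bsub>P i\<^esub> \<zero>\<^bsub>P i\<^esub> = \<zero>\<^bsub>P i\<^esub>"
      using lm[of i] by (simp add: left_module_def abelian_group_def abelian_monoid.l_zero abelian_monoid.zero_closed)
    then show ?thesis using \<Psi>(2)[OF zero_cl zero_cl, of i] by simp
  qed
  have \<theta>_add: "\<theta> i (x + y) = \<theta> i x \<oplus>\<^bsub>P i\<^esub> \<theta> i y" if "x \<in> X i" "y \<in> X i" for i x y
    using \<theta>\<Psi>[OF add_cl[OF \<theta>(1) \<theta>(1)], OF that] \<Psi>(2)[OF \<theta>(1) \<theta>(1), OF that] \<theta>(2) that by simp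
  have \<theta>_scale: "\<theta> i (c \<cdot> x) = (c \<cdot> unit_fun \<one>\<^bsub>G\<^esub>) \<odot>\<^bsub>P i\<^esub> \<theta> i x" if "x \<in> X i" for i c x
    using \<theta>\<Psi>[OF smult_cl[OF one_closed \<theta>(1)], OF that, of c] \<Psi>_scale[OF \<theta>(1), OF that] \<theta>(2)[OF that] by simp
  have \<theta>_translate: "\<theta> i (translate G g x) = (1 \<cdot> unit_fun g) \<odot>\<^bsub>P i\<^esub> \<theta> i x"
    if "g \<in> carrier G" "x \<in> X i" for i g x
    using \<theta>\<Psi>[OF smult_cl[OF that(1) \<theta>(1)], OF that(2), of 1] \<Psi>_translate[OF that(1) \<theta>(1), OF that(2)]
      \<theta>(2)[OF that(2)] by simp
  have X_add: "x + y \<in> X i" if "x \<in> X i" "y \<in> X i" for i x y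
    using \<Psi>X[OF add_cl[OF \<theta>(1) \<theta>(1)], OF that] \<Psi>(2)[OF \<theta>(1) \<theta>(1), OF that] \<theta>(2) that by simp
  have X_scale: "c \<cdot> x \<in> X i" if "x \<in> X i" for i c x
    using \<Psi>X[OF smult_cl[OF one_closed \<theta>(1)], OF that, of c] \<Psi>_scale[OF \<theta>(1), OF that] \<theta>(2)[OF that] by simp
  have X_0: "0 \<in> X i" for i using \<Psi>X[OF zero_cl[of i]] by (simp add: \<Psi>_zero)
  have X_translate: "translate G g x \<in> X i" if "g \<in> carrier G" "x \<in> X i" for i g x
    using \<Psi>X[OF smult_cl[OF that(1) \<theta>(1)], OF that(2), of 1] \<Psi>_translate[OF that(1) \<theta>(1), OF that(2)]
      \<theta>(2)[OF that(2)] by simp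
  have d: "d i \<in> mod_hom (group_ring G) (P (Suc i)) (P i)" for i
    using res by (simp add: fg_projective_resolution_def)
  have \<epsilon>: "\<epsilon> \<in> mod_hom (group_ring G) (P 0) (trivial_module G)"
    using res by (simp add: fg_projective_resolution_def)
  have \<epsilon>_smult: "\<epsilon> ((c \<cdot> unit_fun g) \<odot>\<^bsub>P 0\<^esub> p) = c * \<epsilon> p" if "g \<in> carrier G" "p \<in> carrier (P 0)" for c g p
  proof -
    \<comment> \<open>The action on the trivial module sums over the support, which is empty for c =
      0.\<close>
    have "{x. (c \<cdot> unit_fun g) x \<noteq> 0} = (if c = 0 then {} else {g})"
      by (auto simp: pointwise unit_fun_def)
    then have "(\<Sum>x\<in>{x. (c \<cdot> unit_fun g) x \<noteq> 0}. (c \<cdot> unit_fun g) x) = c"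
      by (simp add: pointwise)
    then show ?thesis
      using mod_homD(3)[OF \<epsilon> monomial_in_group_ring[OF that(1)] that(2), of c] by (simp add: trivial_module_def)
  qed
  have \<epsilon>_add: "\<epsilon> (p \<oplus>\<^bsub>P 0\<^esub> q) = \<epsilon> p + \<epsilon> q" if "p \<in> carrier (P 0)" "q \<in> carrier (P 0)" for p q
    using mod_homD(2)[OF \<epsilon> that] by (simp add: trivial_module_def)
  define D where "D i x = \<Psi> i (d i (\<theta> (Suc i) x))" for i x
  define E where "E x = (\<lambda>_::unit. \<epsilon> (\<theta> 0 x))" for x
  have D_image: "D i ` X (Suc i) = \<Psi> i ` d i ` carrier (P (Suc i))" for i
    unfolding bij_betw_imp_surj_on[OF \<Psi>(1), symmetric] image_image
    by (intro image_cong) (auto simp: D_def \<theta>\<Psi>)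
  \<comment> \<open>Together with \<open>D_image\<close>, this carries kernels and images in the P i
    over to the X i, so exactness transfers as an equation of sets.\<close>
  have \<Psi>_Collect: "\<Psi> i ` {p \<in> carrier (P i). Q p} = {x \<in> X i. Q (\<theta> i x)}" for i Q
  proof (intro equalityI subsetI)
    fix x assume "x \<in> {x \<in> X i. Q (\<theta> i x)}"
    then have "\<theta> i x \<in> {p \<in> carrier (P i). Q p}" "x = \<Psi> i (\<theta> i x)" by (auto simp: \<theta>)
    then show "x \<in> \<Psi> i ` {p \<in> carrier (P i). Q p}" by blast
  qed (auto simp: \<theta>\<Psi> \<Psi>X)
  have "group_resolution G X D E (\<lambda>i. matrix_gen G (m i) (A i))"
  proof unfold_locales
    show "fs.subspace (X i)" for i by (rule fs.subspaceI) (auto simp: X_0 X_add X_scale)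
    show "translation_hom G (X (Suc i)) (X i) (D i)" for i
      unfolding translation_hom_def
    proof (intro conjI ballI lin_onI funcsetI)
      fix x assume x: "x \<in> X (Suc i)"
      note dx = mod_homD[OF d[of i]]
      show "D i x \<in> X i" unfolding D_def by (intro \<Psi>X dx(1) \<theta>(1) x)
      show "D i (x + y) = D i x + D i y" if y: "y \<in> X (Suc i)" for y
        using x y by (simp add: D_def \<theta>_add dx \<theta>(1) \<Psi>(2))
      show "D i (c \<cdot> x) = c \<cdot> D i x" for c
        using x by (simp add: D_def \<theta>_scale dx \<theta>(1) monomial_in_group_ring \<Psi>_scale)
      show "D i (translate G g x) = translate G g (D i x)" if g: "g \<in> carrier G" for g
        unfolding D_def \<theta>_translate[OF g x] dx(3)[OF monomial_in_group_ring[OF g] \<theta>(1)[OF x]]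
        by (rule \<Psi>_translate[OF g dx(1)[OF \<theta>(1)[OF x]]])
    qed
    show "lin_on (X 0) E"
      using \<epsilon>_smult[OF one_closed \<theta>(1)] \<epsilon>_add[OF \<theta>(1) \<theta>(1)]
      by (intro lin_onI) (auto simp: E_def \<theta>_add \<theta>_scale fun_eq_iff pointwise)
    show "E (translate G g x) = E x" if "g \<in> carrier G" "x \<in> X 0" for g x
      using \<epsilon>_smult[OF that(1) \<theta>(1)[OF that(2)], of 1] by (simp only: E_def \<theta>_translate[OF that] mult_1)
    show "E ` X 0 = UNIV"
    proof -
      have "z \<in> E ` X 0" for z
      proof -
        have "z () \<in> \<epsilon> ` carrier (P 0)"
          using res by (simp add: fg_projective_resolution_def trivial_module_def)
        then obtain p where p: "p \<in> carrier (P 0)" "\<epsilon> p = z ()" by auto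
        then have "z = E (\<Psi> 0 p)" by (auto simp: E_def \<theta>\<Psi> fun_eq_iff)
        then show ?thesis using \<Psi>X[OF p(1)] by blast
      qed
      then show ?thesis by blast
    qed
    show "{x \<in> X 0. E x = 0} = D 0 ` X (Suc 0)"
    proof -
      have "D 0 ` X (Suc 0) = \<Psi> 0 ` {p \<in> carrier (P 0). \<epsilon> p = 0}"
        using res by (simp add: D_image fg_projective_resolution_def trivial_module_def)
      also have "\<dots> = {x \<in> X 0. E x = 0}"
        unfolding \<Psi>_Collect by (auto simp: E_def fun_eq_iff pointwise)
      finally show ?thesis by simp
    qed
    show "{x \<in> X (Suc i). D i x = 0} = D (Suc i) ` X (Suc (Suc i))" for i
    proof -
      have inj: "\<Psi> i p = 0 \<longleftrightarrow> p = \<zero>\<^bsub>P i\<^esub>" if "p \<in> carrier (P i)" for p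
        using \<theta>\<Psi>[OF that] \<theta>\<Psi>[OF zero_cl[of i]] \<Psi>_zero by metis
      have "D (Suc i) ` X (Suc (Suc i)) = \<Psi> (Suc i) ` {p \<in> carrier (P (Suc i)). d i p = \<zero>\<^bsub>P i\<^esub>}"
        using res by (simp add: D_image fg_projective_resolution_def)
      also have "\<dots> = {x \<in> X (Suc i). D i x = 0}"
        unfolding \<Psi>_Collect using mod_homD(1)[OF d[of i] \<theta>(1)] by (auto simp: D_def inj \<Psi>_zero)
      finally show ?thesis by simp
    qed
    show "matrix_gen G (m i) (A i) j \<in> X i" for i j
    proof (cases "j < m i")
      case True
      then show ?thesis unfolding X_def by (rule group_ring_matrix.matrix_gen_proj_space[OF grm])
    next
      case False
      then have "matrix_gen G (m i) (A i) j = 0"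
        by (auto simp: matrix_gen_def swap_uncurry_def fun_eq_iff pointwise)
      then show ?thesis by (simp add: X_0)
    qed
    show "lext (\<lambda>(g, j). translate G g (matrix_gen G (m i) (A i) j)) x = x" if "x \<in> X i" for i x
      using that unfolding X_def by (rule group_ring_matrix.proj_space_expand[OF grm])
  qed (use X_grp X_translate in auto)
  moreover have "X i \<subseteq> fin_supp_on (carrier G \<times> {..<m i})" for i
    unfolding X_def by (rule group_ring_matrix.proj_space_sub[OF grm])
  moreover have "X i = {0}" if "i > N" for i
  proof -
    have "carrier (P i) = {\<zero>\<^bsub>P i\<^esub>}" using res that by (simp add: fg_projective_resolution_def)
    then show ?thesis using \<Psi>(1)[of i] by (simp add: bij_betw_def \<Psi>_zero)
  qed
  ultimately show ?thesis by blast
qed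

section \<open>The Euler characteristic\<close>

text \<open>For a row of the matrix, this makes the coefficient at k the augmentation of its k-th
  entry.\<close>

lemma coinv_apply:
  assumes "finite (supp y)"
  shows "coinv y k = (\<Sum>g\<in>supp (\<lambda>g. y (g, k)). y (g, k))"
proof -
  have "coinv y k = (\<Sum>p\<in>supp y. if snd p = k then y p else 0)"
    unfolding coinv_def lext_def sum_fun_apply cscale_apply
    by (intro sum.cong) (auto simp: unit_fun_def)
  also have "\<dots> = (\<Sum>p\<in>{p \<in> supp y. snd p = k}. y p)"
    by (rule sum.inter_filter[OF assms, symmetric])
  also have "\<dots> = (\<Sum>g\<in>supp (\<lambda>g. y (g, k)). y (g, k))"
    by (intro sum.reindex_bij_witness[of _ "\<lambda>g. (g, k)" fst]) (auto simp: supp_def)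
  finally show ?thesis .
qed

section \<open>Dimensions of coinvariants and the Euler-Poincare formula\<close>

context group_resolution
begin

lemma subspace_coinv: "fs.subspace (coinv ` X n)"
  by (rule subspace_image[OF X_subspace lin_on_coinv[OF X_sub]])

lemma subspace_coinv_cycles: "fs.subspace (coinv ` cycles X d n)"
  using cycles_sub X_sub by (intro subspace_image[OF subspace_cycles] lin_on_coinv[of _ G]) blast

lemma coinv_boundaries_sub: "coinv ` d n ` X (Suc n) \<subseteq> coinv ` cycles X d n"
  using d_cycles by auto

text \<open>\<open>coinv_hom\<close> for the identity map: the matrix with rows
  \<open>coinv (gen n j)\<close> fixes all coinvariants of \<open>X n\<close>, so it is a projection
  onto them and \<open>dim_eq_trace\<close> applies.\<close>

lemma coinv_expand: "x \<in> X n \<Longrightarrow> coinv x = lext (\<lambda>j. coinv (gen n j)) (coinv x)"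
  by (rule coinv_hom[OF translation_hom_id X_sub])

end

locale fg_group_resolution = group_resolution G X d eps gen
  for G :: "('a, 'b) monoid_scheme" (structure) and X :: "nat \<Rightarrow> ('a \<times> nat \<Rightarrow> complex) set"
    and d eps gen +
  fixes m :: "nat \<Rightarrow> nat"
  assumes X_fg: "X n \<subseteq> fin_supp_on (carrier G \<times> {..<m n})"
begin

lemma coinv_coord_space: "coinv ` X n \<subseteq> coord_space (m n)"
proof clarify
  fix x assume "x \<in> X n"
  then have "j < m n" if "(g, j) \<in> supp x" for g j
    using X_fg[of n] fin_supp_onD(2)[of x _ "(g, j)"] that by blast
  then show "coinv x \<in> coord_space (m n)"
    unfolding coord_space_fin_supp coinv_def by (intro lext_fin_supp_on) auto
qed

lemma dim_coinv: "of_nat (fs.dim (coinv ` X n)) = (\<Sum>j<m n. coinv (gen n j) j)"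
proof (rule dim_eq_trace[OF subspace_coinv coinv_coord_space, where a = "\<lambda>j. coinv (gen n j)"])
  show "coinv (gen n j) \<in> coinv ` X n" for j using gen_closed by blast
  fix v assume v: "v \<in> coinv ` X n"
  then have "v = lext (\<lambda>j. coinv (gen n j)) v" using coinv_expand by blast
  also have "\<dots> = (\<Sum>j<m n. v j \<cdot> coinv (gen n j))"
    using v coinv_coord_space[of n] by (intro lext_superset) (auto simp: coord_space_fin_supp fin_supp_on_def)
  finally show "v = (\<Sum>j<m n. v j \<cdot> coinv (gen n j))" .
qed

text \<open>Rank and nullity for the boundary map induced on coinvariants, whose kernel is the image
  of \<open>cycles\<close>.\<close>

lemma dim_coinv_Suc:
  "fs.dim (coinv ` X (Suc n)) = fs.dim (coinv ` cycles X d (Suc n)) + fs.dim (coinv ` d n ` X (Suc n))"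
proof -
  let ?B = "coinv ` d n ` X (Suc n)" and ?V = "coinv ` X (Suc n)"
  define f where "f = lext (\<lambda>j. coinv (d n (gen (Suc n) j)))"
  have f: "f (coinv x) = coinv (d n x)" if "x \<in> X (Suc n)" for x
    unfolding f_def by (rule coinv_hom[OF d_hom X_sub that, symmetric])
  have Bm: "?B \<subseteq> coord_space (m n)" using d_closed coinv_coord_space[of n] by blast
  \<comment> \<open>With denominator \<open>{0}\<close> the rank becomes a \<open>quot_dim\<close>,
    which can be transferred to the quotient of the coinvariants by the cycles.\<close>
  obtain k where k: "quot_dim ?B {0} k" "fs.dim ?B = fs.dim {0 :: nat \<Rightarrow> complex} + k"
    using quot_dim_exists[OF subspace_coinv_boundaries Bm fs.subspace_single_0]
      fs.subspace_0[OF subspace_coinv_boundaries[of n]] by blast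
  have k': "fs.dim ?B = k" using k(2) by (simp add: dim_zero_space)
  have "quot_dim ?V (coinv ` cycles X d (Suc n)) k"
  proof (rule quot_dim_transfer[OF _ _ _ _ _ _ k(1), of _ f])
    show "lin_on ?V f"
      unfolding f_def using coinv_coord_space[of "Suc n"] lin_on_subset[OF lin_on_lext]
      by (simp add: coord_space_fin_supp)
    show "f \<in> ?V \<rightarrow> ?B" using f by auto
    show "fs.subspace ?B" by (rule subspace_coinv_boundaries)
    show "coinv ` cycles X d (Suc n) \<subseteq> ?V" using cycles_sub by blast
    show "f z \<in> {0} \<longleftrightarrow> z \<in> coinv ` cycles X d (Suc n)" if z: "z \<in> ?V" for z
    proof -
      obtain x where x: "x \<in> X (Suc n)" "z = coinv x" using z by blast
      show ?thesis
      proof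
        assume "f z \<in> {0}"
        then have "x \<in> cycles X d (Suc n)" using f x by (simp add: cycles_def)
        then show "z \<in> coinv ` cycles X d (Suc n)" using x by blast
      next
        assume "z \<in> coinv ` cycles X d (Suc n)"
        then show "f z \<in> {0}" using f by (auto simp: cycles_def)
      qed
    qed
    show "\<exists>z\<in>?V. z' - f z \<in> {0}" if "z' \<in> ?B" for z'
      using that f by force
  qed
  then show ?thesis
    using quot_dim_dim[OF subspace_coinv coinv_coord_space subspace_coinv_cycles] cycles_sub k' by (metis image_mono)
qed

lemma homology_dim:
  "\<exists>k. quot_dim (coinv ` cycles X d n) (coinv ` d n ` X (Suc n)) k \<and>
    fs.dim (coinv ` cycles X d n) = fs.dim (coinv ` d n ` X (Suc n)) + k"
  using cycles_sub[of n] coinv_coord_space[of n]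
  by (intro quot_dim_exists[OF subspace_coinv_cycles _ subspace_coinv_boundaries coinv_boundaries_sub, of _ "m n"]) blast

theorem euler_poincare:
  assumes zero: "\<And>i. i > N \<Longrightarrow> X i = {0}"
    and b: "\<And>i. quot_dim (coinv ` cycles X d i) (coinv ` d i ` X (Suc i)) (b i)"
  shows "(\<Sum>i\<le>N. (-1) ^ i * int (b i)) = (\<Sum>i\<le>N. (-1) ^ i * int (fs.dim (coinv ` X i)))"
    and "i > N \<Longrightarrow> b i = 0"
proof -
  define B where "B i = fs.dim (coinv ` d i ` X (Suc i))" for i
  define Z where "Z i = fs.dim (coinv ` cycles X d i)" for i
  have Zb: "Z i = B i + b i" for i
    using homology_dim[of i] quot_dim_unique[OF subspace_coinv_cycles b] unfolding Z_def B_def by metis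
  have coinv0: "coinv (0 :: 'a \<times> nat \<Rightarrow> complex) = 0" by (simp add: coinv_def)
  have d0: "d i 0 = 0" for i using lin_on_zero[OF d_lin X_subspace] .
  have B0: "B i = 0" if "i \<ge> N" for i
    using zero[of "Suc i"] that by (simp add: B_def d0 coinv0 dim_zero_space)
  \<comment> \<open>Telescoping leaves the last boundary space as error term for a partial sum. At n
    = N it vanishes, since the resolution is zero in degree N + 1.\<close>
  have "(\<Sum>i\<le>n. (-1) ^ i * int (fs.dim (coinv ` X i))) = (\<Sum>i\<le>n. (-1) ^ i * int (b i)) + (-1) ^ n * int (B n)" for n
  proof (induction n)
    case 0
    have "cycles X d 0 = X 0" by (simp add: cycles_def)
    then show ?case using Zb[of 0] by (simp add: Z_def)
  next
    case (Suc n)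
    then show ?case
      using dim_coinv_Suc[of n] Zb[of "Suc n"] by (simp add: Z_def B_def algebra_simps)
  qed
  from this[of N] show "(\<Sum>i\<le>N. (-1) ^ i * int (b i)) = (\<Sum>i\<le>N. (-1) ^ i * int (fs.dim (coinv ` X i)))"
    using B0[of N] by simp
  show "b i = 0" if "i > N"
  proof -
    have "coinv ` cycles X d i \<subseteq> {0}" using cycles_sub[of i] zero[OF that] coinv0 by auto
    then have "coinv ` cycles X d i = {0}" using fs.subspace_0[OF subspace_coinv_cycles[of i]] by blast
    then show ?thesis using Zb[of i] by (simp add: Z_def dim_zero_space)
  qed
qed

end

text \<open>The bridge from coset modules to \<open>quot_dim\<close>. An equivalence is required
  because \<open>complex_dim\<close> is a definite description: one direction gives existence, the
  other uniqueness.\<close>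

lemma quotient_module_iso_iff:
  fixes M :: "(complex, 'i \<Rightarrow> complex) module"
  assumes M: "carrier M = Z" "\<And>x y. x \<oplus>\<^bsub>M\<^esub> y = x + y" "\<And>c x. c \<odot>\<^bsub>M\<^esub> x = c \<cdot> x"
    and Z: "fs.subspace Z" and B: "fs.subspace B" "B \<subseteq> Z"
  shows "mod_isomorphic complex_ring (quotient_module complex_ring M B) (free_module complex_ring k) \<longleftrightarrow>
    quot_dim Z B k"
proof
  define cos where "cos z = (\<lambda>b. b + z) ` B" for z
  let ?Q = "quotient_module complex_ring M B" and ?F = "free_module complex_ring k"
  have in_cos: "y \<in> cos z \<longleftrightarrow> y - z \<in> B" for y z
    unfolding cos_def by (force simp: image_iff algebra_simps)
  have Q_carrier: "carrier ?Q = cos ` Z"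
    by (auto simp: quotient_module_def A_RCOSETS_def RCOSETS_def r_coset_def cos_def M)
  have Q_add: "cos x \<oplus>\<^bsub>?Q\<^esub> cos y = cos (x + y)" for x y
  proof -
    have "cos x \<oplus>\<^bsub>?Q\<^esub> cos y = {u + v |u v. u \<in> cos x \<and> v \<in> cos y}"
      by (auto simp: quotient_module_def set_add_def set_mult_def M)
    also have "\<dots> = cos (x + y)"
    proof (intro equalityI subsetI)
      fix w assume "w \<in> {u + v |u v. u \<in> cos x \<and> v \<in> cos y}"
      then obtain u v where uv: "w = u + v" "u - x \<in> B" "v - y \<in> B" by (auto simp: in_cos)
      have eq: "w - (x + y) = (u - x) + (v - y)" using uv by simp
      show "w \<in> cos (x + y)" unfolding in_cos eq by (rule fs.subspace_add[OF B(1) uv(2,3)])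
    next
      fix w assume "w \<in> cos (x + y)"
      then have "w - y \<in> cos x" "y \<in> cos y" by (auto simp: in_cos fs.subspace_0[OF B(1)] algebra_simps)
      moreover have "w = (w - y) + y" by simp
      ultimately show "w \<in> {u + v |u v. u \<in> cos x \<and> v \<in> cos y}" by blast
    qed
    finally show ?thesis .
  qed
  \<comment> \<open>For c = 0 the multiples of the elements of a coset form only \<open>{0}\<close>;
    the summand B in the definition restores a full coset.\<close>
  have Q_smult: "c \<odot>\<^bsub>?Q\<^esub> cos x = cos (c \<cdot> x)" for c x
  proof -
    have "c \<odot>\<^bsub>?Q\<^esub> cos x = {u + c \<cdot> v |u v. u \<in> B \<and> v \<in> cos x}"
      by (auto simp: quotient_module_def set_add_def set_mult_def M)
    also have "\<dots> = cos (c \<cdot> x)"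
    proof (intro equalityI subsetI)
      fix w assume "w \<in> {u + c \<cdot> v |u v. u \<in> B \<and> v \<in> cos x}"
      then obtain u v where uv: "w = u + c \<cdot> v" "u \<in> B" "v - x \<in> B" by (auto simp: in_cos)
      have "w - c \<cdot> x = u + c \<cdot> (v - x)" using uv by (simp add: fs.scale_right_diff_distrib)
      then show "w \<in> cos (c \<cdot> x)" using fs.subspace_add[OF B(1) uv(2) fs.subspace_scale[OF B(1) uv(3)]] by (simp add: in_cos)
    next
      fix w assume "w \<in> cos (c \<cdot> x)"
      then have "w - c \<cdot> x \<in> B" "x \<in> cos x" by (auto simp: in_cos fs.subspace_0[OF B(1)])
      moreover have "w = (w - c \<cdot> x) + c \<cdot> x" by simp
      ultimately show "w \<in> {u + c \<cdot> v |u v. u \<in> B \<and> v \<in> cos x}" by blast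
    qed
    finally show ?thesis .
  qed
  have F_carrier: "carrier ?F = coord_space k"
    by (auto simp: free_module_simps coord_space_def complex_ring_def)
  have F_ops: "v \<oplus>\<^bsub>?F\<^esub> w = v + w" "c \<odot>\<^bsub>?F\<^esub> v = c \<cdot> v" for v w c
    by (auto simp: free_module_simps complex_ring_def fun_eq_iff pointwise)
  have cos_eq: "cos x = cos y \<longleftrightarrow> x - y \<in> B" if "x \<in> Z" "y \<in> Z" for x y
  proof
    assume "cos x = cos y"
    moreover have "x \<in> cos x" by (simp add: in_cos fs.subspace_0[OF B(1)])
    ultimately show "x - y \<in> B" by (simp add: in_cos)
  next
    assume xy: "x - y \<in> B"
    have "w - x \<in> B \<longleftrightarrow> w - y \<in> B" for w
      using fs.subspace_add[OF B(1) _ xy, of "w - x"] fs.subspace_diff[OF B(1) _ xy, of "w - y"] by auto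
    then show "cos x = cos y" by (auto simp: in_cos)
  qed
  show "quot_dim Z B k" if iso: "mod_isomorphic complex_ring ?Q ?F"
  proof -
    obtain f where f: "f \<in> mod_hom complex_ring ?Q ?F" "bij_betw f (cos ` Z) (coord_space k)"
      using iso by (auto simp: mod_isomorphic_def Q_carrier F_carrier)
    have lin: "lin_on Z (\<lambda>z. f (cos z))"
    proof (rule lin_onI)
      show "f (cos (x + y)) = f (cos x) + f (cos y)" if "x \<in> Z" "y \<in> Z" for x y
        using mod_homD(2)[OF f(1), of "cos x" "cos y"] that by (simp add: Q_carrier Q_add F_ops)
      show "f (cos (c \<cdot> x)) = c \<cdot> f (cos x)" if "x \<in> Z" for c x
      proof -
        have "c \<in> carrier complex_ring" by (simp add: complex_ring_def)
        then show ?thesis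
          using mod_homD(3)[OF f(1), of c "cos x"] that by (simp add: Q_carrier Q_smult F_ops)
      qed
    qed
    moreover have "(\<lambda>z. f (cos z)) ` Z = coord_space k"
      using f(2) by (simp add: bij_betw_def image_image)
    moreover have "f (cos x) = 0 \<longleftrightarrow> x \<in> B" if x: "x \<in> Z" for x
    proof -
      have "f (cos x) = 0 \<longleftrightarrow> f (cos x) = f (cos 0)" using lin_on_zero[OF lin Z] by simp
      also have "\<dots> \<longleftrightarrow> cos x = cos 0"
        using f(2) x fs.subspace_0[OF Z] by (auto simp: bij_betw_def inj_on_def)
      also have "\<dots> \<longleftrightarrow> x \<in> B" using cos_eq[OF x fs.subspace_0[OF Z]] by simp
      finally show ?thesis .
    qed
    then have "{x \<in> Z. f (cos x) = 0} = B" using B(2) by blast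
    ultimately show ?thesis unfolding quot_dim_def by blast
  qed
  show "mod_isomorphic complex_ring ?Q ?F" if dim: "quot_dim Z B k"
  proof -
    obtain L where L: "lin_on Z L" "L ` Z = coord_space k" "{x \<in> Z. L x = 0} = B"
      using dim by (auto simp: quot_dim_def)
    have L_eq: "L x = L y \<longleftrightarrow> x - y \<in> B" if "x \<in> Z" "y \<in> Z" for x y
      using lin_on_diff[OF L(1) Z that] fs.subspace_diff[OF Z that] L(3) by auto
    \<comment> \<open>L is constant on each coset of its kernel, so the image of a coset is a
      singleton.\<close>
    define f where "f W = the_elem (L ` W)" for W
    have f: "f (cos z) = L z" if z: "z \<in> Z" for z
    proof -
      have "L y = L z" if "y \<in> cos z" for y
      proof -
        have "y = (y - z) + z" by simp
        then have "y \<in> Z" using that z B(2) fs.subspace_add[OF Z, of "y - z" z] by (auto simp: in_cos)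
        then show ?thesis using L_eq z that by (simp add: in_cos)
      qed
      moreover have "z \<in> cos z" by (simp add: in_cos fs.subspace_0[OF B(1)])
      ultimately have "L ` cos z = {L z}" by blast
      then show ?thesis by (simp add: f_def)
    qed
    have "f \<in> mod_hom complex_ring ?Q ?F"
      using L(2) by (auto simp: mod_hom_def Q_carrier F_carrier Q_add Q_smult F_ops f
          fs.subspace_add[OF Z] fs.subspace_scale[OF Z] lin_on_add[OF L(1)] lin_on_scale[OF L(1)])
    moreover have "bij_betw f (carrier ?Q) (carrier ?F)"
      unfolding Q_carrier F_carrier bij_betw_def
      using L(2) by (auto simp: inj_on_def f L_eq cos_eq image_image)
    ultimately show ?thesis unfolding mod_isomorphic_def by blast
  qed
qed

section \<open>The Euler characteristic from a finite resolution\<close>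

context fg_group_resolution
begin

theorem euler_char_eq:
  assumes zero: "\<And>i. i > N \<Longrightarrow> X i = {0}"
  shows "euler_char_defined G \<and> euler_char G = (\<Sum>i\<le>N. (-1) ^ i * int (fs.dim (coinv ` X i)))"
proof -
  obtain b where b: "\<And>i. quot_dim (coinv ` cycles X d i) (coinv ` d i ` X (Suc i)) (b i)"
    using homology_dim by metis
  define Z where "Z i = bar_cycles G complex_line (\<lambda>z g. z) i" for i
  define B where "B i = bar_boundary G complex_line (\<lambda>z g. z) (Suc i) ` carrier (bar_chains G complex_line (Suc i))" for i
  interpret bar: group_resolution G bar_module "\<lambda>_. bar_d" bar_eps bar_gen by (rule bar_resolution)
  \<comment> \<open>The numbers b i are found on the finite side, where bases exist, and then moved
    to the infinite-dimensional bar chains.\<close>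
  have bar: "quot_dim (Z i) (B i) (b i)" for i
    using coinv_homology_invariant[OF bar_resolution group_resolution_axioms b, of i]
    by (simp add: coinv_bar_cycles coinv_bar_boundaries Z_def B_def)
  have Z: "fs.subspace (Z i)" and B: "fs.subspace (B i)" "B i \<subseteq> Z i" for i
    using bar.subspace_coinv_cycles[of i] bar.subspace_coinv_boundaries[of i] bar.coinv_boundaries_sub[of i]
    by (simp_all add: coinv_bar_cycles coinv_bar_boundaries Z_def B_def)
  have iso: "mod_isomorphic complex_ring (complex_homology G i) (free_module complex_ring k) \<longleftrightarrow> quot_dim (Z i) (B i) k"
    for i k
    unfolding complex_homology_def group_homology_def B_def[symmetric] Z_def[symmetric]
    by (rule quotient_module_iso_iff[OF _ _ _ Z B])
      (auto simp: bar_chains_def complex_line_def fun_eq_iff pointwise)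
  have dim: "complex_dim (complex_homology G i) = b i" for i
    unfolding complex_dim_def iso by (intro the_equality bar quot_dim_unique[OF Z _ bar])
  have fin: "finite_dim (complex_homology G i)" for i
    unfolding finite_dim_def iso using bar by blast
  have b0: "b i = 0" if "i > N" for i using euler_poincare(2)[OF zero b that] by simp
  then have sub: "{i. b i \<noteq> 0} \<subseteq> {..N}" by (metis (mono_tags) mem_Collect_eq atMost_iff not_le subsetI)
  then have "euler_char_defined G"
    unfolding euler_char_defined_def dim using fin by (auto intro: finite_subset)
  moreover have "euler_char G = (\<Sum>i\<le>N. (-1) ^ i * int (b i))"
    unfolding euler_char_def dim by (rule sum.mono_neutral_left) (use sub in auto)
  ultimately show ?thesis using euler_poincare(1)[OF zero b] by simp
qed

end

section \<open>Conjugacy classes and class traces\<close>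

context group
begin

lemma conj_class_self: "s \<in> carrier G \<Longrightarrow> s \<in> conj_class G s"
  unfolding conj_class_def by (rule image_eqI[of _ _ \<one>]) auto

lemma conj_class_sub: "s \<in> carrier G \<Longrightarrow> conj_class G s \<subseteq> carrier G"
  by (auto simp: conj_class_def)

lemma conj_class_trans:
  assumes "s \<in> carrier G" "t \<in> conj_class G s"
  shows "conj_class G t \<subseteq> conj_class G s"
proof
  fix u assume "u \<in> conj_class G t"
  then obtain g h where g: "g \<in> carrier G" "h \<in> carrier G" "u = h \<otimes> (g \<otimes> s \<otimes> inv g) \<otimes> inv h"
    using assms(2) by (auto simp: conj_class_def)
  then have "u = (h \<otimes> g) \<otimes> s \<otimes> inv (h \<otimes> g)"
    using assms(1) by (simp add: m_assoc inv_mult_group)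
  then show "u \<in> conj_class G s" using g unfolding conj_class_def by blast
qed

lemma conj_class_sym:
  assumes "s \<in> carrier G" "t \<in> conj_class G s"
  shows "s \<in> conj_class G t"
proof -
  obtain g where g: "g \<in> carrier G" "t = g \<otimes> s \<otimes> inv g" using assms(2) by (auto simp: conj_class_def)
  then have "s = inv g \<otimes> t \<otimes> inv (inv g)"
    using assms(1) by (simp add: m_assoc) (simp add: m_assoc[symmetric])
  then show ?thesis using g(1) unfolding conj_class_def by blast
qed

lemma conj_class_eq: "s \<in> carrier G \<Longrightarrow> t \<in> conj_class G s \<Longrightarrow> conj_class G t = conj_class G s"
  using conj_class_trans conj_class_sym conj_class_sub by (meson subset_antisym subsetD)

text \<open>The classes partition the support of a, so the class traces add up to the augmentation.
  F may be larger than the set of classes that meet this support: one F must serve all diagonal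
  entries of all matrices.\<close>

lemma sum_class_trace:
  assumes a: "a \<in> fin_supp_on (carrier G)"
    and rep: "\<And>c. c \<in> conj_classes G \<Longrightarrow> rep c \<in> c"
    and F: "finite F" "F \<subseteq> conj_classes G" "conj_class G ` supp a \<subseteq> F"
  shows "(\<Sum>c\<in>F. class_trace G (rep c) a) = (\<Sum>g\<in>supp a. a g)"
proof -
  have "class_trace G (rep c) a = sum a {g \<in> supp a. conj_class G g = c}" if "c \<in> F" for c
  proof -
    have cc: "c \<in> conj_classes G" using that F(2) by blast
    then obtain s where s: "s \<in> carrier G" "c = conj_class G s"
      unfolding conj_classes_def by (elim imageE)
    have "rep c \<in> conj_class G s" using rep[OF cc] s(2) by simp
    then have c: "conj_class G (rep c) = c" using conj_class_eq s by simp
    have "t \<in> c \<longleftrightarrow> conj_class G t = c" if "t \<in> carrier G" for t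
      using conj_class_eq[OF s(1)] conj_class_self[OF that] s(2) by auto
    then have "{t \<in> conj_class G (rep c). a t \<noteq> 0} = {g \<in> supp a. conj_class G g = c}"
      using a unfolding c by (auto simp: supp_def fin_supp_on_def)
    then show ?thesis by (simp add: class_trace_def)
  qed
  then have "(\<Sum>c\<in>F. class_trace G (rep c) a) = (\<Sum>c\<in>F. sum a {g \<in> supp a. conj_class G g = c})"
    by simp
  also have "\<dots> = (\<Sum>g\<in>supp a. a g)"
    using a F by (intro sum.group) (auto dest: fin_supp_onD)
  finally show ?thesis .
qed

lemma class_trace_zero:
  assumes "a \<in> fin_supp_on (carrier G)" "s \<in> carrier G" "conj_class G s \<notin> conj_class G ` supp a"
  shows "class_trace G s a = 0"
proof -
  have "a t = 0" if "t \<in> conj_class G s" for t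
  proof (rule ccontr)
    assume "a t \<noteq> 0"
    then have "conj_class G s \<in> conj_class G ` supp a"
      using conj_class_eq[OF assms(2) that] by (intro image_eqI[of _ _ t]) (auto simp: supp_def)
    then show False using assms(3) by contradiction
  qed
  then have "{t \<in> conj_class G s. a t \<noteq> 0} = {}" by blast
  then show ?thesis unfolding class_trace_def by simp
qed

end

theorem corollary4p5:
  fixes G :: "('a, 'b) monoid_scheme" and rep :: "'a set \<Rightarrow> 'a"
  assumes "group G" and "type_FP G"
    and "\<And>s i. \<lbrakk>s \<in> carrier G; \<exists>n>0. s [^]\<^bsub>G\<^esub> (n::nat) = \<one>\<^bsub>G\<^esub>\<rbrakk>
           \<Longrightarrow> l2_betti (centralizer_group G s) i < \<infinity>"
    and "\<And>s. s \<in> carrier G \<Longrightarrow>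
           l2_euler_char_defined (centralizer_group G s) \<and>
           complete_euler_char G s = complex_of_real (l2_euler_char (centralizer_group G s))"
    and rep: "\<And>c. c \<in> conj_classes G \<Longrightarrow> rep c \<in> c"
  shows "euler_char_defined G \<and>
    ((\<lambda>c. l2_euler_char (centralizer_group G (rep c))) has_sum real_of_int (euler_char G))
      (conj_classes G)"
proof -
  interpret group G by (rule assms(1))
  \<comment> \<open>The very tuple selected in \<open>complete_euler_char\<close>, so that E(G)
    unfolds to traces of matrices presenting these \<open>P i\<close>.\<close>
  define R where "R = (SOME (n, P, d, \<epsilon>). fg_projective_resolution (group_ring G) (trivial_module G) n
    (P :: nat \<Rightarrow> ('a \<Rightarrow> complex, nat \<Rightarrow> 'a \<Rightarrow> complex) module) d \<epsilon>)"
  obtain N P d \<epsilon> where R_eq: "R = (N, P, d, \<epsilon>)" by (cases R) auto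
  have "case R of (n, P, d, \<epsilon>) \<Rightarrow> fg_projective_resolution (group_ring G) (trivial_module G) n P d \<epsilon>"
    unfolding R_def by (rule someI_ex) (use assms(2) in \<open>auto simp: type_FP_def\<close>)
  then have res: "fg_projective_resolution (group_ring G) (trivial_module G) N P d \<epsilon>" by (simp add: R_eq)
  define m where "m i = fst (matrix_presentation (group_ring G) (P i))" for i
  define A where "A i = snd (matrix_presentation (group_ring G) (P i))" for i
  have pres: "matrix_presentation (group_ring G) (P i) = (m i, A i)" for i by (simp add: m_def A_def)
  have E: "complete_euler_char G s = (\<Sum>i\<le>N. (-1) ^ i * (\<Sum>j<m i. class_trace G s (A i j j)))" for s
    unfolding complete_euler_char_def R_def[symmetric] R_eq
    by (simp add: hattori_stallings_def projective_trace_def pres)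
  obtain X D e where X: "group_resolution G X D e (\<lambda>i. matrix_gen G (m i) (A i))"
    "\<And>i. X i \<subseteq> fin_supp_on (carrier G \<times> {..<m i})" "\<And>i. i > N \<Longrightarrow> X i = {0}"
    using projective_resolution_grp_funs[OF assms(1) res pres] by blast
  interpret fg_group_resolution G X D e "\<lambda>i. matrix_gen G (m i) (A i)" m
    by (intro fg_group_resolution.intro fg_group_resolution_axioms.intro X)
  have A: "A i j j \<in> fin_supp_on (carrier G)" if "j < m i" for i j
  proof -
    have "idempotent_matrix (group_ring G) (m i) (A i)"
      using res by (intro matrix_presentationD(1)[OF _ pres]) (simp add: fg_projective_resolution_def)
    then show ?thesis using that by (simp add: idempotent_matrix_def carrier_group_ring)
  qed
  \<comment> \<open>The trace formula for coinvariants, with each diagonal coefficient read as the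
    augmentation of \<open>A i j j\<close>.\<close>
  have dim: "of_nat (fs.dim (coinv ` X i)) = (\<Sum>j<m i. \<Sum>g\<in>supp (A i j j). A i j j g)" for i
    unfolding dim_coinv
  proof (rule sum.cong)
    fix j assume j: "j \<in> {..<m i}"
    have "finite (supp (matrix_gen G (m i) (A i) j))"
      using gen_closed[of i j] X_sub[of i] by (auto dest: fin_supp_onD)
    moreover have "(\<lambda>g. matrix_gen G (m i) (A i) j (g, j)) = A i j j"
      using j by (simp add: matrix_gen_def swap_uncurry_apply)
    ultimately show "coinv (matrix_gen G (m i) (A i) j) j = (\<Sum>g\<in>supp (A i j j). A i j j g)"
      using coinv_apply[of "matrix_gen G (m i) (A i) j" j] by (metis (no_types, lifting) sum.cong)
  qed simp
  \<comment> \<open>The finitely many classes that meet the support of some diagonal entry; every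
    other class has E-value 0.\<close>
  define F where "F = (\<Union>i\<le>N. \<Union>j<m i. conj_class G ` supp (A i j j))"
  have F: "finite F" "F \<subseteq> conj_classes G"
    using A by (auto simp: F_def conj_classes_def fin_supp_on_def)
  have F_supp: "conj_class G ` supp (A i j j) \<subseteq> F" if "i \<le> N" "j < m i" for i j
    using that by (auto simp: F_def)
  have rep_carrier: "rep c \<in> carrier G" and rep_class: "conj_class G (rep c) = c" if "c \<in> conj_classes G" for c
  proof -
    have "c \<in> conj_class G ` carrier G" using that by (simp add: conj_classes_def)
    then obtain s where s: "s \<in> carrier G" "c = conj_class G s" by (elim imageE)
    then show "rep c \<in> carrier G" "conj_class G (rep c) = c"
      using rep[OF that] conj_class_sub[OF s(1)] conj_class_eq[OF s(1)] by auto
  qed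
  let ?\<chi> = "\<lambda>c. l2_euler_char (centralizer_group G (rep c))"
  have \<chi>: "complex_of_real (?\<chi> c) = complete_euler_char G (rep c)" if "c \<in> conj_classes G" for c
    using assms(4)[OF rep_carrier[OF that]] by simp
  have "complex_of_real (\<Sum>c\<in>F. ?\<chi> c) = (\<Sum>c\<in>F. complete_euler_char G (rep c))"
    using \<chi> F(2) by (auto intro: sum.cong)
  also have "\<dots> = (\<Sum>i\<le>N. (-1) ^ i * (\<Sum>j<m i. \<Sum>c\<in>F. class_trace G (rep c) (A i j j)))"
    unfolding E by (subst sum.swap) (simp add: sum.swap[of _ F] flip: sum_distrib_left)
  \<comment> \<open>Over F the class traces of an entry sum to its augmentation, which turns the
    inner double sum into the trace of the augmented matrix.\<close>
  also have "\<dots> = (\<Sum>i\<le>N. (-1) ^ i * of_nat (fs.dim (coinv ` X i)))"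
    unfolding dim using sum_class_trace[OF A rep F F_supp] by (intro sum.cong) auto
  also have "\<dots> = complex_of_real (of_int (\<Sum>i\<le>N. (-1) ^ i * int (fs.dim (coinv ` X i))))"
    by simp
  also have "\<dots> = complex_of_real (of_int (euler_char G))"
    using euler_char_eq[OF X(3)] by simp
  finally have sum: "(\<Sum>c\<in>F. ?\<chi> c) = of_int (euler_char G)" by (simp only: of_real_eq_iff)
  have "?\<chi> c = 0" if c: "c \<in> conj_classes G - F" for c
  proof -
    have "class_trace G (rep c) (A i j j) = 0" if "i \<le> N" "j < m i" for i j
      using c F_supp[OF that] rep_class[of c] rep_carrier[of c] by (intro class_trace_zero[OF A[OF that(2)]]) auto
    then have "complete_euler_char G (rep c) = 0" unfolding E by simp
    then show ?thesis using \<chi>[of c] c by simp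
  qed
  then have "(?\<chi> has_sum of_int (euler_char G)) (conj_classes G)"
    using F sum by (intro has_sum_finite_neutralI[of F]) auto
  then show ?thesis using euler_char_eq[OF X(3)] by blast
qed

end
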